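(* Let $n,m>1$ and let $T$ be a positive pluriharmonic current of bidegree $(1,1)$ on $\mathbb{C}^N=\mathbb{C}^n\times\mathbb{C}^m$ ($N=n+m$). Suppose there exist compact sets $D\subset\mathbb{C}^n$ and $D'\subset\mathbb{C}^m$, each with nonempty interior, such that $T$ has finite directional order $\varrho_{(D,T)}$ in the direction of $\mathbb{C}^m$ with respect to $D$ and finite directional order $\varrho_{(T,D')}$ in the direction of $\mathbb{C}^n$ with respect to $D'$. Then $T$ is of finite order.
   Context: Notation: $\mathbb{B}_j(r)=\{x\in\mathbb{C}^j:|x|<r\}$, $d=\partial+\overline\partial$, $d^c=\frac{i}{4\pi}(\overline\partial-\partial)$; for $(z,t)\in\mathbb{C}^n\times\mathbb{C}^m$, $\beta_z=dd^c|z|^2$ and $\beta_t=dd^c|t|^2$. A current $T$ of bidegree $(1,1)$ (bidimension $(N-1,N-1)$) on $\mathbb{C}^N$ is positive if $T\wedge i\alpha_1\wedge\overline\alpha_1\wedge\dots\wedge i\alpha_{N-1}\wedge\overline\alpha_{N-1}$ is a positive measure for all smooth compactly supported $(1,0)$-forms $\alpha_j$; it is pluriharmonic if $dd^cT=0$. Order: with $\nu_T(r)=\frac{1}{r^{2(N-1)}}\int_{\mathbb{B}_N(r)}T\wedge(\beta_z+\beta_t)^{N-1}$, the order of $T$ is $\limsup_{r\to+\infty}\frac{\log\nu_T(r)}{\log r}$, and $T$ is of finite order if this is $<+\infty$. Directional orders: for a relatively compact Borel set $D'\subset\mathbb{C}^m$ put $\mathscr{N}_{(T,D')}(r)=\frac{1}{r^{2(n-1)}}\int_{\mathbb{B}_n(r)\times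 D'}T\wedge\beta_z^{n-1}\wedge\beta_t^m$ and $\varrho_{(T,D')}=\limsup_{r\to+\infty}\frac{\log\mathscr{N}_{(T,D')}(r)}{\log r}$ (directional order with respect to $D'$ in the direction of $\mathbb{C}^n$). For a relatively compact Borel set $D\subset\mathbb{C}^n$ put $\mathscr{M}_{(D,T)}(r)=\frac{1}{r^{2(m-1)}}\int_{D\times\mathbb{B}_m(r)}T\wedge\beta_z^{n}\wedge\beta_t^{m-1}$ and $\varrho_{(D,T)}=\limsup_{r\to+\infty}\frac{\log\mathscr{M}_{(D,T)}(r)}{\log r}$ (directional order with respect to $D$ in the direction of $\mathbb{C}^m$). Finite means $<+\infty$ (with $\log0=-\infty$). *)

theory Defs
  imports "HOL-Analysis.Analysis"
begin

type_synonym ('n, 'm) cspace = "(complex ^ 'n) \<times> (complex ^ 'm)"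

definition cscale :: "complex \<Rightarrow> ('n::finite, 'm::finite) cspace \<Rightarrow> ('n, 'm) cspace" where
  "cscale c v = (c *s fst v, c *s snd v)"

(* A complex-valued alternating k-linear map is a function on lists of tangent vectors that
   vanishes on lists of length other than k. *)
type_synonym ('n, 'm) covector = "('n, 'm) cspace list \<Rightarrow> complex"
type_synonym ('n, 'm) form = "('n, 'm) cspace \<Rightarrow> ('n, 'm) covector"

(* Sum over shuffles, without factorials: (a \<and> b) [u, v] = a [u] * b [v] - a [v] * b [u] for
   1-covectors a, b.  As covectors vanish on lists of the wrong length, the sum may run over all
   subsets S of positions. *)
definition cwedge :: "('n::finite, 'm::finite) covector \<Rightarrow> ('n, 'm) covector \<Rightarrow> ('n, 'm) covector" where
  "cwedge a b vs =
     (\<Sum>S\<in>Pow {..<length vs}.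
        (-1) ^ card {(i, j). i \<in> S \<and> j \<in> {..<length vs} - S \<and> j < i}
        * a (nths vs S) * b (nths vs ({..<length vs} - S)))"

definition unit_covector :: "('n::finite, 'm::finite) covector" where
  "unit_covector vs = (if vs = [] then 1 else 0)"

definition covector1 :: "(('n::finite, 'm::finite) cspace \<Rightarrow> complex) \<Rightarrow> ('n, 'm) covector" where
  "covector1 l vs = (case vs of [v] \<Rightarrow> l v | _ \<Rightarrow> 0)"

definition complex_linear :: "(('n::finite, 'm::finite) cspace \<Rightarrow> complex) \<Rightarrow> bool" where
  "complex_linear l \<longleftrightarrow>
     (\<forall>u v. l (u + v) = l u + l v) \<and> (\<forall>c v. l (cscale c v) = c * l v)"

(* The complex span of the products of p complex-linear and q conjugate-linear functionals. *)
inductive bidegree :: "nat \<Rightarrow> nat \<Rightarrow> ('n::finite, 'm::finite) covector \<Rightarrow> bool" where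
  unit: "bidegree 0 0 unit_covector"
| zero: "bidegree p q (\<lambda>vs. 0)"
| add: "bidegree p q a \<Longrightarrow> bidegree p q b \<Longrightarrow> bidegree p q (\<lambda>vs. a vs + b vs)"
| scale: "bidegree p q a \<Longrightarrow> bidegree p q (\<lambda>vs. c * a vs)"
| dz: "complex_linear l \<Longrightarrow> bidegree p q a \<Longrightarrow> bidegree (Suc p) q (cwedge (covector1 l) a)"
| dzbar: "complex_linear l \<Longrightarrow> bidegree p q a \<Longrightarrow>
            bidegree p (Suc q) (cwedge (covector1 (\<lambda>v. cnj (l v))) a)"

primrec iter_deriv :: "'a list \<Rightarrow> ('a::real_normed_vector \<Rightarrow> complex) \<Rightarrow> 'a \<Rightarrow> complex" where
  "iter_deriv [] f = f"
| "iter_deriv (u # us) f = (\<lambda>x. frechet_derivative (iter_deriv us f) (at x) u)"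

definition smooth :: "('a::real_normed_vector \<Rightarrow> complex) \<Rightarrow> bool" where
  "smooth f \<longleftrightarrow> (\<forall>us x. iter_deriv us f differentiable (at x))"

definition test_function :: "('a::real_normed_vector \<Rightarrow> complex) \<Rightarrow> bool" where
  "test_function f \<longleftrightarrow> smooth f \<and> (\<exists>K. compact K \<and> (\<forall>x. x \<notin> K \<longrightarrow> f x = 0))"

definition supported_in :: "('n::finite, 'm::finite) form \<Rightarrow> ('n, 'm) cspace set \<Rightarrow> bool" where
  "supported_in \<omega> K \<longleftrightarrow> (\<forall>x vs. x \<notin> K \<longrightarrow> \<omega> x vs = 0)"

definition test_form :: "nat \<Rightarrow> nat \<Rightarrow> ('n::finite, 'm::finite) form \<Rightarrow> bool" where
  "test_form p q \<omega> \<longleftrightarrow>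
     (\<forall>x. bidegree p q (\<omega> x)) \<and> (\<forall>vs. smooth (\<lambda>x. \<omega> x vs)) \<and> (\<exists>K. compact K \<and> supported_in \<omega> K)"

definition wedge :: "('n::finite, 'm::finite) form \<Rightarrow> ('n, 'm) form \<Rightarrow> ('n, 'm) form" (infixr "\<and>\<^sub>F" 70) where
  "(\<alpha> \<and>\<^sub>F \<beta>) x = cwedge (\<alpha> x) (\<beta> x)"

definition form_scale :: "complex \<Rightarrow> ('n::finite, 'm::finite) form \<Rightarrow> ('n, 'm) form" where
  "form_scale c \<omega> x vs = c * \<omega> x vs"

definition form_add :: "('n::finite, 'm::finite) form \<Rightarrow> ('n, 'm) form \<Rightarrow> ('n, 'm) form" where
  "form_add \<alpha> \<beta> x vs = \<alpha> x vs + \<beta> x vs"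

definition form_cnj :: "('n::finite, 'm::finite) form \<Rightarrow> ('n, 'm) form" where
  "form_cnj \<omega> x vs = cnj (\<omega> x vs)"

definition form0 :: "(('n::finite, 'm::finite) cspace \<Rightarrow> complex) \<Rightarrow> ('n, 'm) form" where
  "form0 f x vs = f x * unit_covector vs"

definition unit_form :: "('n::finite, 'm::finite) form" where
  "unit_form = form0 (\<lambda>x. 1)"

primrec wedge_power :: "('n::finite, 'm::finite) form \<Rightarrow> nat \<Rightarrow> ('n, 'm) form" where
  "wedge_power \<omega> 0 = unit_form"
| "wedge_power \<omega> (Suc k) = \<omega> \<and>\<^sub>F wedge_power \<omega> k"

(* The complex-linear and the conjugate-linear part of the real differential of f at x. *)
definition del_fun :: "(('n::finite, 'm::finite) cspace \<Rightarrow> complex) \<Rightarrow> ('n, 'm) cspace \<Rightarrow> ('n, 'm) cspace \<Rightarrow> complex" where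
  "del_fun f x v =
     (frechet_derivative f (at x) v - \<i> * frechet_derivative f (at x) (cscale \<i> v)) / 2"

definition delbar_fun :: "(('n::finite, 'm::finite) cspace \<Rightarrow> complex) \<Rightarrow> ('n, 'm) cspace \<Rightarrow> ('n, 'm) cspace \<Rightarrow> complex" where
  "delbar_fun f x v =
     (frechet_derivative f (at x) v + \<i> * frechet_derivative f (at x) (cscale \<i> v)) / 2"

definition omit :: "nat \<Rightarrow> 'a list \<Rightarrow> 'a list" where
  "omit i vs = take i vs @ drop (Suc i) vs"

definition del :: "('n::finite, 'm::finite) form \<Rightarrow> ('n, 'm) form" where
  "del \<omega> x vs = (\<Sum>i<length vs. (-1) ^ i * del_fun (\<lambda>y. \<omega> y (omit i vs)) x (vs ! i))"

definition delbar :: "('n::finite, 'm::finite) form \<Rightarrow> ('n, 'm) form" where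
  "delbar \<omega> x vs = (\<Sum>i<length vs. (-1) ^ i * delbar_fun (\<lambda>y. \<omega> y (omit i vs)) x (vs ! i))"

definition ext_d :: "('n::finite, 'm::finite) form \<Rightarrow> ('n, 'm) form" where
  "ext_d \<omega> = form_add (del \<omega>) (delbar \<omega>)"

definition ext_dc :: "('n::finite, 'm::finite) form \<Rightarrow> ('n, 'm) form" where
  "ext_dc \<omega> = form_scale (\<i> / (4 * of_real pi)) (form_add (delbar \<omega>) (form_scale (-1) (del \<omega>)))"

definition beta_z :: "('n::finite, 'm::finite) form" where
  "beta_z = ext_d (ext_dc (form0 (\<lambda>x. of_real ((norm (fst x))\<^sup>2))))"

definition beta_t :: "('n::finite, 'm::finite) form" where
  "beta_t = ext_d (ext_dc (form0 (\<lambda>x. of_real ((norm (snd x))\<^sup>2))))"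

(* Only the values on test forms of complementary bidegree matter.  Continuity is with respect to
   the usual C^k seminorms on the forms supported in a fixed compact set. *)
type_synonym ('n, 'm) functional = "('n, 'm) form \<Rightarrow> complex"

definition current :: "nat \<Rightarrow> nat \<Rightarrow> ('n::finite, 'm::finite) functional \<Rightarrow> bool" where
  "current p q T \<longleftrightarrow> p \<le> CARD('n) + CARD('m) \<and> q \<le> CARD('n) + CARD('m) \<and>
     (let test = test_form (CARD('n) + CARD('m) - p) (CARD('n) + CARD('m) - q) in
       (\<forall>\<phi> \<psi>. test \<phi> \<longrightarrow> test \<psi> \<longrightarrow> T (form_add \<phi> \<psi>) = T \<phi> + T \<psi>) \<and>
       (\<forall>c \<phi>. test \<phi> \<longrightarrow> T (form_scale c \<phi>) = c * T \<phi>) \<and>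
       (\<forall>K. compact K \<longrightarrow>
         (\<exists>C k. \<forall>\<phi> B. test \<phi> \<longrightarrow> supported_in \<phi> K \<longrightarrow>
           (\<forall>x us vs. set us \<subseteq> Basis \<longrightarrow> length us \<le> k \<longrightarrow> set vs \<subseteq> Basis \<longrightarrow>
              norm (iter_deriv us (\<lambda>y. \<phi> y vs) x) \<le> B) \<longrightarrow>
           norm (T \<phi>) \<le> C * B)))"

(* The top-degree current T \<and> \<omega>, as a functional on test functions; \<omega> is of even degree below,
   so its position does not matter. *)
definition current_wedge ::
    "('n::finite, 'm::finite) functional \<Rightarrow> ('n, 'm) form \<Rightarrow> (('n, 'm) cspace \<Rightarrow> complex) \<Rightarrow> complex" where
  "current_wedge T \<omega> f = T (form0 f \<and>\<^sub>F \<omega>)"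

definition represents :: "'a::euclidean_space measure \<Rightarrow> (('a \<Rightarrow> complex) \<Rightarrow> complex) \<Rightarrow> bool" where
  "represents \<mu> L \<longleftrightarrow> sets \<mu> = sets borel \<and> (\<forall>K. compact K \<longrightarrow> emeasure \<mu> K < \<infinity>) \<and>
     (\<forall>f. test_function f \<longrightarrow> L f = (LINT x|\<mu>. f x))"

definition positive_measure :: "(('a::euclidean_space \<Rightarrow> complex) \<Rightarrow> complex) \<Rightarrow> bool" where
  "positive_measure L \<longleftrightarrow> (\<exists>\<mu>. represents \<mu> L)"

(* The integral of T \<and> \<omega> over A, for T \<and> \<omega> a positive measure (which is then unique). *)
definition current_integral ::
    "('n::finite, 'm::finite) functional \<Rightarrow> ('n, 'm) form \<Rightarrow> ('n, 'm) cspace set \<Rightarrow> real" where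
  "current_integral T \<omega> A = measure (SOME \<mu>. represents \<mu> (current_wedge T \<omega>)) A"

definition positive_current11 :: "('n::finite, 'm::finite) functional \<Rightarrow> bool" where
  "positive_current11 T \<longleftrightarrow>
     (\<forall>\<alpha>s. length \<alpha>s = CARD('n) + CARD('m) - 1 \<longrightarrow> (\<forall>\<alpha>\<in>set \<alpha>s. test_form 1 0 \<alpha>) \<longrightarrow>
        positive_measure (current_wedge T
          (foldr (\<lambda>\<alpha> \<omega>. form_scale \<i> \<alpha> \<and>\<^sub>F form_cnj \<alpha> \<and>\<^sub>F \<omega>) \<alpha>s unit_form)))"

(* dd^c T = 0, where dd^c T is the current sending \<phi> to T (dd^c \<phi>). *)
definition pluriharmonic11 :: "('n::finite, 'm::finite) functional \<Rightarrow> bool" where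
  "pluriharmonic11 T \<longleftrightarrow>
     (\<forall>\<phi>. test_form (CARD('n) + CARD('m) - 2) (CARD('n) + CARD('m) - 2) \<phi> \<longrightarrow>
        T (ext_d (ext_dc \<phi>)) = 0)"

definition ln_ext :: "real \<Rightarrow> ereal" where
  "ln_ext x = (if x \<le> 0 then -\<infinity> else ereal (ln x))"

definition growth_order :: "(real \<Rightarrow> real) \<Rightarrow> ereal" where
  "growth_order f = Limsup at_top (\<lambda>r. ln_ext (f r) / ereal (ln r))"

definition nu :: "('n::finite, 'm::finite) functional \<Rightarrow> real \<Rightarrow> real" where
  "nu T r = current_integral T (wedge_power (form_add beta_z beta_t) (CARD('n) + CARD('m) - 1)) (ball 0 r)
     / r ^ (2 * (CARD('n) + CARD('m) - 1))"

definition N_dir :: "('n::finite, 'm::finite) functional \<Rightarrow> (complex ^ 'm) set \<Rightarrow> real \<Rightarrow> real" where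
  "N_dir T D' r =
     current_integral T (wedge_power beta_z (CARD('n) - 1) \<and>\<^sub>F wedge_power beta_t CARD('m)) (ball 0 r \<times> D')
     / r ^ (2 * (CARD('n) - 1))"

definition M_dir :: "(complex ^ 'n) set \<Rightarrow> ('n::finite, 'm::finite) functional \<Rightarrow> real \<Rightarrow> real" where
  "M_dir D T r =
     current_integral T (wedge_power beta_z CARD('n) \<and>\<^sub>F wedge_power beta_t (CARD('m) - 1)) (D \<times> ball 0 r)
     / r ^ (2 * (CARD('m) - 1))"

definition current_order :: "('n::finite, 'm::finite) functional \<Rightarrow> ereal" where
  "current_order T = growth_order (nu T)"

definition order_dir_n :: "('n::finite, 'm::finite) functional \<Rightarrow> (complex ^ 'm) set \<Rightarrow> ereal" where
  "order_dir_n T D' = growth_order (N_dir T D')"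

definition order_dir_m :: "(complex ^ 'n) set \<Rightarrow> ('n::finite, 'm::finite) functional \<Rightarrow> ereal" where
  "order_dir_m D T = growth_order (M_dir D T)"

end

theory Submission imports Defs begin

text \<open>Up to a constant, \<open>T \<and> \<beta>\<^sup>N\<^sup>-\<^sup>1\<close> is the sum of the positive measures obtained by wedging \<open>T\<close> with
  the products of the \<open>i dz\<^sub>k \<and> d\<bar>z\<^sub>k\<close> over all \<open>k\<close> but one. The hypotheses bound these measures
  polynomially on polydiscs whose radii grow in the coordinates of one factor only. The bounds spread to
  all coordinates by treating two coordinates \<open>u\<close>, \<open>v\<close> at a time: they hold when both \<open>u\<close> and \<open>v\<close> are
  unbounded as soon as they hold when one of the two is confined to a small disc. To see this, test
  \<open>dd\<^sup>cT = 0\<close> with \<open>h\<^sup>2a\<^sup>2b\<^sup>2g\<^sup>2\<close>, where \<open>h\<close> is a cutoff in the other coordinates, \<open>a\<close> and \<open>b\<close> vanish near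
  \<open>u = c\<close> and \<open>v = d\<close> and equal 1 farther away, and \<open>g\<close> is a bump function of \<open>w = (u - c)(v - d)\<close> that is
  subharmonic in \<open>w\<close> wherever \<open>a\<close> and \<open>b\<close> do not vanish. After completing squares, the mass of \<open>T\<close> against
  \<open>i dw \<and> d\<bar>w\<close> is bounded by terms that live where \<open>u\<close> is near \<open>c\<close> or \<open>v\<close> is near \<open>d\<close>. Finally, \<open>du\<close> is a
  multiple of the difference of the forms \<open>dw\<close> that belong to two different values of \<open>d\<close>.\<close>

subsection \<open>The wedge product of covectors\<close>

text \<open>No nonzero function of compact support is plurisubharmonic, so testing pluriharmonicity
  with a nonnegative cutoff always leaves terms of the wrong sign. The construction decides where
  they lie. A bump in the product \<open>w\<close> fails to be subharmonic only where
  \<open>w\<close> is small, and the region \<open>|w|^2 < R\<close> is unbounded only along the two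
  axes \<open>u = c\<close> and \<open>v = d\<close>. Both defects sit inside the strips removed by
  \<open>a\<close> and \<open>b\<close>. Every error is therefore supported in the strips, where
  masses are known by induction, and none comes from an outer boundary. The price is that the
  complex Hessian of the bump has rank one and sees a single covector \<open>dw\<close>. The factors
  are squared so that each mixed term with a derivative of \<open>g\<close> can be absorbed into a
  complete square. Wedging \<open>T\<close> first with the (1,1)-forms of all other coordinates
  kills the derivatives in these, so \<open>h\<close> is never differentiated. The bookkeeping
  closes up: the error near \<open>u = c\<close> is again a mass against \<open>du\<close> and the
  error near \<open>v = d\<close> one against \<open>dv\<close>, so only masses covered by the
  induction occur.\<close>

definition contract :: "('n::finite, 'm::finite) cspace \<Rightarrow> ('n, 'm) covector \<Rightarrow> ('n, 'm) covector" where
  "contract v a = (\<lambda>vs. a (v # vs))"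

definition grade_sign :: "('n::finite, 'm::finite) covector \<Rightarrow> ('n, 'm) covector" where
  "grade_sign a = (\<lambda>vs. (-1) ^ length vs * a vs)"

text \<open>Splits a sum over sets of positions according to which factor of a wedge product
  receives the first vector.\<close>

lemma sum_Pow_lessThan_Suc:
  fixes F :: "nat set \<Rightarrow> complex"
  shows "sum F (Pow {..<Suc n}) =
    (\<Sum>S\<in>Pow {..<n}. F (insert 0 (Suc ` S))) + (\<Sum>S\<in>Pow {..<n}. F (Suc ` S))"
proof -
  have P: "Pow (Suc ` {..<n}) = image Suc ` Pow {..<n}"
    by (simp add: image_Pow_surj)
  have inj: "inj_on (image Suc) (Pow {..<n})"
    by (rule inj_onI) (simp add: inj_image_eq_iff)
  have inj0: "inj_on (insert 0) (Pow (Suc ` {..<n}))"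
  proof (rule inj_onI)
    fix A B assume "A \<in> Pow (Suc ` {..<n})" "B \<in> Pow (Suc ` {..<n})" "insert 0 A = insert 0 B"
    moreover have "0 \<notin> A" "0 \<notin> B" using calculation by auto
    ultimately show "A = B" by (metis Diff_insert_absorb insert_Diff_if singletonI)
  qed
  have disj: "Pow (Suc ` {..<n}) \<inter> insert 0 ` Pow (Suc ` {..<n}) = {}" by auto
  have "sum F (Pow {..<Suc n}) = sum F (Pow (Suc ` {..<n}) \<union> insert 0 ` Pow (Suc ` {..<n}))"
    by (simp add: lessThan_Suc_eq_insert_0 Pow_insert)
  also have "\<dots> = sum F (Pow (Suc ` {..<n})) + sum F (insert 0 ` Pow (Suc ` {..<n}))"
    by (rule sum.union_disjoint) (use disj in auto)
  also have "sum F (Pow (Suc ` {..<n})) = (\<Sum>S\<in>Pow {..<n}. F (Suc ` S))"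
    unfolding P by (subst sum.reindex[OF inj]) (simp add: o_def)
  also have "sum F (insert 0 ` Pow (Suc ` {..<n})) = (\<Sum>S\<in>Pow {..<n}. F (insert 0 (Suc ` S)))"
    by (subst sum.reindex[OF inj0], unfold P, subst sum.reindex[OF inj]) (simp add: o_def)
  finally show ?thesis by simp
qed

lemma card_inversions_insert:
  assumes "S \<subseteq> {..<n}"
  shows "card {(i, j). i \<in> insert 0 (Suc ` S) \<and> j \<in> {..<Suc n} - insert 0 (Suc ` S) \<and> j < i}
    = card {(i, j). i \<in> S \<and> j \<in> {..<n} - S \<and> j < i}"
proof (rule bij_betw_same_card[symmetric], rule bij_betwI')
  fix p assume "p \<in> {(i, j). i \<in> insert 0 (Suc ` S) \<and> j \<in> {..<Suc n} - insert 0 (Suc ` S) \<and> j < i}"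
  then obtain i j where p: "p = (Suc i, Suc j)" "i \<in> S" "j < n" "j \<notin> S" "j < i"
    by (cases "fst p"; cases "snd p") (auto simp: inj_image_mem_iff)
  show "\<exists>x\<in>{(i, j). i \<in> S \<and> j \<in> {..<n} - S \<and> j < i}. p = map_prod Suc Suc x"
    by (rule bexI[of _ "(i, j)"]) (use p in auto)
qed auto

text \<open>When position 0 goes to the second factor, each of the \<open>card S\<close> chosen
  positions stands after it. The resulting sign is what \<open>grade_sign\<close> records in
  \<open>cwedge_Cons\<close>.\<close>

lemma card_inversions_shift:
  assumes "S \<subseteq> {..<n}"
  shows "card {(i, j). i \<in> Suc ` S \<and> j \<in> {..<Suc n} - Suc ` S \<and> j < i}
    = card S + card {(i, j). i \<in> S \<and> j \<in> {..<n} - S \<and> j < i}"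
proof -
  define I where "I = {(i, j). i \<in> S \<and> j \<in> {..<n} - S \<and> j < i}"
  define A where "A = {(i, j). i \<in> Suc ` S \<and> j \<in> {..<Suc n} - Suc ` S \<and> j < i}"
  have fS: "finite S" using assms finite_subset by blast
  have fI: "finite I" by (rule finite_subset[of _ "S \<times> {..<n}"]) (use fS in \<open>auto simp: I_def\<close>)
  have mem: "p \<in> A \<longleftrightarrow> p \<in> map_prod Suc Suc ` I \<union> (\<lambda>i. (Suc i, 0)) ` S" for p
  proof (cases p)
    case (Pair i j)
    show ?thesis unfolding Pair A_def I_def
      by (cases j) (auto simp: image_iff)
  qed
  have eq: "A = map_prod Suc Suc ` I \<union> (\<lambda>i. (Suc i, 0)) ` S"
    using mem by blast
  have "inj_on (map_prod Suc Suc) I" by (auto intro: inj_onI)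
  hence "card (map_prod Suc Suc ` I) = card I" by (rule card_image)
  moreover have "card ((\<lambda>i. (Suc i, 0::nat)) ` S) = card S" by (rule card_image) (auto intro: inj_onI)
  moreover have "map_prod Suc Suc ` I \<inter> (\<lambda>i. (Suc i, 0)) ` S = {}" by auto
  ultimately have "card A = card S + card I" unfolding eq using fS fI by (subst card_Un_disjoint) auto
  thus ?thesis unfolding A_def I_def .
qed

lemma cwedge_Nil [simp]: "cwedge a b [] = a [] * b []"
  by (simp add: cwedge_def)

text \<open>Recursion on the first vector; it replaces the combinatorics of shuffles by list induction.\<close>

lemma cwedge_Cons:
  "cwedge a b (v # vs) = cwedge (contract v a) b vs + cwedge (grade_sign a) (contract v b) vs"
proof -
  let ?n = "length vs"
  have S1: "{j. Suc j \<in> insert 0 (Suc ` S)} = S" "{j. Suc j \<in> Suc ` S} = S"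
    "{j. Suc j \<in> {..<Suc ?n} - insert 0 (Suc ` S)} = {..<?n} - S"
    "{j. Suc j \<in> {..<Suc ?n} - Suc ` S} = {..<?n} - S" for S by auto
  have c: "card S = length (nths vs S)" if "S \<subseteq> {..<?n}" for S
  proof -
    have "{i. i < ?n \<and> i \<in> S} = S" using that by auto
    thus ?thesis by (simp add: length_nths)
  qed
  have "cwedge a b (v # vs) =
    (\<Sum>S\<in>Pow {..<?n}. (-1) ^ card {(i, j). i \<in> S \<and> j \<in> {..<?n} - S \<and> j < i}
        * a (v # nths vs S) * b (nths vs ({..<?n} - S))) +
    (\<Sum>S\<in>Pow {..<?n}. (-1) ^ (card S + card {(i, j). i \<in> S \<and> j \<in> {..<?n} - S \<and> j < i})
        * a (nths vs S) * b (v # nths vs ({..<?n} - S)))"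
    unfolding cwedge_def length_Cons sum_Pow_lessThan_Suc
    by (intro arg_cong2[where f="(+)"] sum.cong refl)
       (simp_all only: Pow_iff card_inversions_insert card_inversions_shift nths_Cons S1, auto)
  also have "\<dots> = cwedge (contract v a) b vs + cwedge (grade_sign a) (contract v b) vs"
    unfolding cwedge_def contract_def grade_sign_def
    by (intro arg_cong2[where f="(+)"] sum.cong refl) (auto simp: power_add c)
  finally show ?thesis .
qed

lemma cwedge_add_left: "cwedge (\<lambda>vs. a vs + a' vs) b = (\<lambda>vs. cwedge a b vs + cwedge a' b vs)"
  and cwedge_add_right: "cwedge a (\<lambda>vs. b vs + b' vs) = (\<lambda>vs. cwedge a b vs + cwedge a b' vs)"
  and cwedge_scale_left: "cwedge (\<lambda>vs. c * a vs) b = (\<lambda>vs. c * cwedge a b vs)"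
  and cwedge_scale_right: "cwedge a (\<lambda>vs. c * b vs) = (\<lambda>vs. c * cwedge a b vs)"
  and cwedge_zero_left: "cwedge (\<lambda>vs. 0) b = (\<lambda>vs. 0)"
  and cwedge_zero_right: "cwedge a (\<lambda>vs. 0) = (\<lambda>vs. 0)"
  by (rule ext, simp add: cwedge_def algebra_simps sum.distrib sum_distrib_left)+

lemma cwedge_sum_left: "cwedge (\<lambda>vs. \<Sum>k\<in>I. a k vs) b = (\<lambda>vs. \<Sum>k\<in>I. cwedge (a k) b vs)"
  by (induction I rule: infinite_finite_induct) (simp_all add: cwedge_zero_left cwedge_add_left)

lemma cwedge_sum_right: "cwedge a (\<lambda>vs. \<Sum>k\<in>I. b k vs) = (\<lambda>vs. \<Sum>k\<in>I. cwedge a (b k) vs)"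
  by (induction I rule: infinite_finite_induct) (simp_all add: cwedge_zero_right cwedge_add_right)

lemma contract_cwedge:
  "contract v (cwedge a b) = (\<lambda>vs. cwedge (contract v a) b vs + cwedge (grade_sign a) (contract v b) vs)"
  by (rule ext) (simp add: contract_def[of v "cwedge a b"] cwedge_Cons)

lemma grade_sign_cwedge: "grade_sign (cwedge a b) = cwedge (grade_sign a) (grade_sign b)"
proof
  fix vs :: "('a, 'b) cspace list"
  let ?n = "length vs"
  have c: "length (nths vs S) + length (nths vs ({..<?n} - S)) = length vs" if "S \<subseteq> {..<?n}" for S
  proof -
    have "{i. i < ?n \<and> i \<in> S} = S" "{i. i < ?n \<and> i \<in> {..<?n} - S} = {..<?n} - S" using that by auto
    thus ?thesis using card_Diff_subset[of S "{..<?n}"] card_mono[OF finite_lessThan that] that finite_subset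
      by (fastforce simp: length_nths)
  qed
  show "grade_sign (cwedge a b) vs = cwedge (grade_sign a) (grade_sign b) vs"
    unfolding cwedge_def grade_sign_def sum_distrib_left
  proof (rule sum.cong[OF refl])
    fix S assume "S \<in> Pow {..<?n}"
    hence "(-1::complex) ^ length vs = (-1) ^ length (nths vs S) * (-1) ^ length (nths vs ({..<?n} - S))"
      using c[of S] by (metis PowD power_add)
    thus "(- 1) ^ length vs * ((- 1) ^ card {(i, j). i \<in> S \<and> j \<in> {..<?n} - S \<and> j < i} * a (nths vs S) * b (nths vs ({..<?n} - S)))
      = (- 1) ^ card {(i, j). i \<in> S \<and> j \<in> {..<?n} - S \<and> j < i} * ((- 1) ^ length (nths vs S) * a (nths vs S)) * ((- 1) ^ length (nths vs ({..<?n} - S)) * b (nths vs ({..<?n} - S)))"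
      by simp
  qed
qed

text \<open>\<open>contract v\<close> is an antiderivation with sign \<open>grade_sign\<close>, so
  both bracketings satisfy the same recursion in the first vector. Generalising over all three
  covectors makes plain list induction sufficient.\<close>

lemma cwedge_assoc: "cwedge (cwedge a b) c vs = cwedge a (cwedge b c) vs"
  by (induction vs arbitrary: a b c)
     (simp_all add: cwedge_Cons contract_cwedge grade_sign_cwedge cwedge_add_left cwedge_add_right)

lemma cwedge_unit_left: "cwedge unit_covector b vs = b vs"
proof (induction vs arbitrary: b)
  case (Cons v vs)
  have "contract v unit_covector = (\<lambda>vs. 0)" "grade_sign (unit_covector :: ('a, 'b) covector) = unit_covector"
    by (auto simp: contract_def grade_sign_def unit_covector_def)
  thus ?case using Cons by (simp add: cwedge_Cons cwedge_zero_left) (simp add: contract_def)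
qed (simp add: unit_covector_def)

lemma cwedge_unit_right: "cwedge b unit_covector vs = b vs"
proof (induction vs arbitrary: b)
  case (Cons v vs)
  have "contract v unit_covector = (\<lambda>vs. 0)"
    by (auto simp: contract_def unit_covector_def)
  thus ?case using Cons by (simp add: cwedge_Cons cwedge_zero_right) (simp add: contract_def)
qed (simp add: unit_covector_def)

section \<open>Exterior multiplication by a single functional\<close>

definition wedge1 :: "(('n::finite, 'm::finite) cspace \<Rightarrow> complex) \<Rightarrow> ('n, 'm) covector \<Rightarrow> ('n, 'm) covector" where
  "wedge1 l b = cwedge (covector1 l) b"

lemma wedge1_Nil [simp]: "wedge1 l b [] = 0"
  by (simp add: wedge1_def covector1_def)

lemma wedge1_Cons: "wedge1 l b (v # vs) = l v * b vs - wedge1 l (contract v b) vs"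
proof -
  have "contract v (covector1 l) = (\<lambda>vs. l v * unit_covector vs)"
    by (auto simp: contract_def covector1_def unit_covector_def split: list.split)
  moreover have "grade_sign (covector1 l) = (\<lambda>vs. (-1) * covector1 l vs)"
    by (auto simp: grade_sign_def covector1_def split: list.split)
  ultimately show ?thesis
    using cwedge_scale_left[of "l v" unit_covector b] cwedge_scale_left[of "-1" "covector1 l" "contract v b"]
    by (simp add: wedge1_def cwedge_Cons cwedge_unit_left)
qed

lemma wedge1_add: "wedge1 l (\<lambda>vs. b vs + b' vs) = (\<lambda>vs. wedge1 l b vs + wedge1 l b' vs)"
  and wedge1_scale: "wedge1 l (\<lambda>vs. c * b vs) = (\<lambda>vs. c * wedge1 l b vs)"
  and wedge1_zero: "wedge1 l (\<lambda>vs. 0) = (\<lambda>vs. 0)"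
  and wedge1_sum: "wedge1 l (\<lambda>vs. \<Sum>k\<in>I. B k vs) = (\<lambda>vs. \<Sum>k\<in>I. wedge1 l (B k) vs)"
  unfolding wedge1_def
  by (rule cwedge_add_right cwedge_scale_right cwedge_zero_right cwedge_sum_right)+

lemma wedge1_diff: "wedge1 l (\<lambda>vs. b vs - b' vs) = (\<lambda>vs. wedge1 l b vs - wedge1 l b' vs)"
  using wedge1_add[of l b "\<lambda>vs. (-1) * b' vs"] wedge1_scale[of l "-1" b'] by simp

lemma wedge1_uminus: "wedge1 l (\<lambda>vs. - b vs) = (\<lambda>vs. - wedge1 l b vs)"
  using wedge1_scale[of l "-1" b] by simp

lemma wedge1_anticommute: "wedge1 l (wedge1 m b) vs = - wedge1 m (wedge1 l b) vs"
proof (induction vs arbitrary: b)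
  case (Cons v vs)
  have "contract v (wedge1 l b) = (\<lambda>vs. l v * b vs - wedge1 l (contract v b) vs)" for l b
    by (auto simp: contract_def wedge1_Cons)
  thus ?case using Cons by (simp add: wedge1_Cons wedge1_diff wedge1_scale)
qed simp

lemma wedge1_same: "wedge1 l (wedge1 l b) vs = 0"
  using wedge1_anticommute[of l l b vs] by simp

text \<open>The right-hand side has the shape of \<open>del\<close> and \<open>delbar\<close>; this
  is what identifies these operators with wedging by the coordinate covectors.\<close>

lemma wedge1_eq_sum_omit:
  "wedge1 l b vs = (\<Sum>i<length vs. (-1) ^ i * l (vs ! i) * b (omit i vs))"
proof (induction vs arbitrary: b)
  case (Cons v vs)
  show ?case
    by (simp add: wedge1_Cons Cons sum.lessThan_Suc_shift omit_def contract_def sum_negf del: sum.lessThan_Suc)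
qed simp

lemma cwedge_wedge1: "cwedge (wedge1 l a) b = wedge1 l (cwedge a b)"
  by (rule ext) (simp add: wedge1_def cwedge_assoc)

subsection \<open>Products of the coordinate forms\<close>

definition coord :: "'n + 'm \<Rightarrow> ('n::finite, 'm::finite) cspace \<Rightarrow> complex" where
  "coord k v = (case k of Inl i \<Rightarrow> fst v $ i | Inr i \<Rightarrow> snd v $ i)"

lemma coord_add [simp]: "coord k (u + v) = coord k u + coord k v"
  and coord_cscale [simp]: "coord k (cscale c v) = c * coord k v"
  and coord_scaleR [simp]: "coord k (r *\<^sub>R v) = of_real r * coord k v"
  and coord_zero [simp]: "coord k 0 = 0"
  unfolding coord_def cscale_def by (auto split: sum.split simp: scaleR_conv_of_real[where 'a=complex])

lemma complex_linear_coord: "complex_linear (coord k)"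
  by (simp add: complex_linear_def)

text \<open>The factor \<open>\<i>\<close> is built in, so that equal functionals give
  multiplication by a positive (1,1)-form. As an operator on covectors it commutes with all others
  of its kind.\<close>

definition wedge11 :: "(('n::finite, 'm::finite) cspace \<Rightarrow> complex) \<Rightarrow> (('n, 'm) cspace \<Rightarrow> complex) \<Rightarrow>
    ('n, 'm) covector \<Rightarrow> ('n, 'm) covector" where
  "wedge11 l m b = (\<lambda>vs. \<i> * wedge1 l (wedge1 (\<lambda>v. cnj (m v)) b) vs)"

text \<open>Two transpositions, hence no sign.\<close>

lemma wedge1_rotate: "wedge1 l (wedge1 m (wedge1 p b)) = wedge1 p (wedge1 l (wedge1 m b))"
proof -
  have anti: "wedge1 l (wedge1 m b) = (\<lambda>vs. - wedge1 m (wedge1 l b) vs)" for l m and b :: "('a, 'b) covector"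
    by (rule ext) (rule wedge1_anticommute)
  have "wedge1 l (wedge1 m (wedge1 p b)) = (\<lambda>vs. - wedge1 l (wedge1 p (wedge1 m b)) vs)"
    by (subst anti[of m p]) (rule wedge1_uminus)
  also have "\<dots> = wedge1 p (wedge1 l (wedge1 m b))"
    by (subst anti[of l p]) simp
  finally show ?thesis .
qed

lemma wedge11_scale: "wedge11 l m (\<lambda>vs. c * b vs) = (\<lambda>vs. c * wedge11 l m b vs)"
  by (simp add: wedge11_def wedge1_scale algebra_simps)

lemma wedge11_sum: "wedge11 l m (\<lambda>vs. \<Sum>k\<in>I. B k vs) = (\<lambda>vs. \<Sum>k\<in>I. wedge11 l m (B k) vs)"
  by (simp add: wedge11_def wedge1_sum sum_distrib_left)

lemma wedge11_commute: "wedge11 l m (wedge11 l' m' b) = wedge11 l' m' (wedge11 l m b)"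
proof -
  have "wedge1 l (wedge1 (\<lambda>v. cnj (m v)) (wedge1 l' (wedge1 (\<lambda>v. cnj (m' v)) b)))
    = wedge1 l' (wedge1 l (wedge1 (\<lambda>v. cnj (m v)) (wedge1 (\<lambda>v. cnj (m' v)) b)))"
    by (rule wedge1_rotate)
  also have "wedge1 l (wedge1 (\<lambda>v. cnj (m v)) (wedge1 (\<lambda>v. cnj (m' v)) b)) =
     wedge1 (\<lambda>v. cnj (m' v)) (wedge1 l (wedge1 (\<lambda>v. cnj (m v)) b))"
    by (rule wedge1_rotate)
  finally show ?thesis by (simp add: wedge11_def wedge1_scale)
qed

lemma wedge11_same: "wedge11 l m (wedge11 l m b) = (\<lambda>vs. 0)"
proof -
  have same: "wedge1 l (wedge1 l b) = (\<lambda>vs. 0)" for l and b :: "('a, 'b) covector"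
    by (rule ext) (rule wedge1_same)
  have "wedge1 l (wedge1 (\<lambda>v. cnj (m v)) (wedge1 l (wedge1 (\<lambda>v. cnj (m v)) b))) = (\<lambda>vs. 0)"
    by (subst wedge1_rotate) (simp add: same wedge1_zero)
  thus ?thesis by (simp add: wedge11_def wedge1_scale)
qed

lemma cwedge_wedge11: "cwedge (wedge11 l m a) b = wedge11 l m (cwedge a b)"
  unfolding wedge11_def cwedge_scale_left cwedge_wedge1 ..

lemma bidegree_wedge11:
  assumes "complex_linear l" "complex_linear m" "bidegree p q b"
  shows "bidegree (Suc p) (Suc q) (wedge11 l m b)"
  unfolding wedge11_def wedge1_def by (intro bidegree.intros assms)

text \<open>A fold over the set instead of a list: the factors commute, so no order of the
  coordinates has to be chosen.\<close>

definition Pi_form :: "('n::finite + 'm::finite) set \<Rightarrow> ('n, 'm) covector" where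
  "Pi_form J = Finite_Set.fold (\<lambda>k. wedge11 (coord k) (coord k)) unit_covector J"

interpretation Pi_form: comp_fun_commute "\<lambda>k. wedge11 (coord k) (coord k)"
  by standard (auto simp: wedge11_commute)

lemma Pi_form_empty [simp]: "Pi_form {} = unit_covector"
  by (simp add: Pi_form_def)

lemma Pi_form_insert: "k \<notin> J \<Longrightarrow> Pi_form (insert k J) = wedge11 (coord k) (coord k) (Pi_form J)"
  by (simp add: Pi_form_def Pi_form.fold_insert)

lemma Pi_form_mem: "k \<in> J \<Longrightarrow> wedge11 (coord k) (coord k) (Pi_form J) = (\<lambda>vs. 0)"
  using Pi_form_insert[of k "J - {k}"] by (simp add: insert_absorb wedge11_same)

lemma bidegree_Pi_form: "bidegree (card J) (card J) (Pi_form J)"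
proof -
  have "finite J" by simp
  thus ?thesis
    by (induction J rule: finite_induct)
       (auto simp: Pi_form_insert intro!: bidegree.unit bidegree_wedge11 complex_linear_coord)
qed

lemma cwedge_Pi_form:
  assumes "J \<inter> K = {}"
  shows "cwedge (Pi_form J) (Pi_form K) = Pi_form (J \<union> K)"
proof -
  have "finite J" by simp
  thus ?thesis using assms
  proof (induction J rule: finite_induct)
    case empty
    show ?case by (rule ext) (simp add: cwedge_unit_left)
  next
    case (insert k J)
    thus ?case by (simp add: Pi_form_insert cwedge_wedge11)
  qed
qed

lemma foldr_wedge11_Pi_form:
  "distinct ks \<Longrightarrow> foldr (\<lambda>k. wedge11 (coord k) (coord k)) ks unit_covector = Pi_form (set ks)"
  by (induction ks) (auto simp: Pi_form_insert)

definition subsets_of_card :: "'a set \<Rightarrow> nat \<Rightarrow> 'a set set" where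
  "subsets_of_card I p = {J. J \<subseteq> I \<and> card J = p}"

text \<open>Each set of \<open>p + 1\<close> coordinates arises once for every one of its elements
  as the newly added factor. This multiplicity is the source of the factorial in
  \<open>wedge_power_sum\<close>.\<close>

lemma sum_wedge11_Pi_form:
  "(\<Sum>k\<in>I. wedge11 (coord k) (coord k) (\<lambda>vs. \<Sum>J\<in>subsets_of_card I p. Pi_form J vs) vs)
    = of_nat (Suc p) * (\<Sum>J\<in>subsets_of_card I (Suc p). Pi_form J vs)"
    (is "?lhs = ?rhs")
proof -
  let ?S = "subsets_of_card I"
  have "?lhs = (\<Sum>k\<in>I. \<Sum>J\<in>?S p. wedge11 (coord k) (coord k) (Pi_form J) vs)"
    by (simp add: wedge11_sum)
  also have "\<dots> = (\<Sum>k\<in>I. \<Sum>J\<in>{J \<in> ?S p. k \<notin> J}. Pi_form (insert k J) vs)"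
    by (intro sum.cong refl sum.mono_neutral_cong_right) (auto simp: Pi_form_mem Pi_form_insert)
  also have "\<dots> = (\<Sum>(k, J)\<in>Sigma I (\<lambda>k. {J \<in> ?S p. k \<notin> J}). Pi_form (insert k J) vs)"
    by (subst sum.Sigma) auto
  also have "\<dots> = (\<Sum>(J, k)\<in>Sigma (?S (Suc p)) (\<lambda>J. J). Pi_form J vs)"
    by (rule sum.reindex_bij_witness[of _ "\<lambda>(J, k). (k, J - {k})" "\<lambda>(k, J). (insert k J, k)"])
       (auto simp: subsets_of_card_def insert_absorb)
  also have "\<dots> = (\<Sum>J\<in>?S (Suc p). \<Sum>k\<in>J. Pi_form J vs)"
    by (subst sum.Sigma) auto
  also have "\<dots> = ?rhs"
    unfolding sum_distrib_left by (intro sum.cong refl) (auto simp: subsets_of_card_def)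
  finally show ?thesis .
qed

lemma wedge_power_sum:
  assumes "\<And>x. \<omega> x = (\<lambda>vs. c * (\<Sum>k\<in>I. wedge11 (coord k) (coord k) unit_covector vs))"
  shows "wedge_power \<omega> p x = (\<lambda>vs. c ^ p * fact p * (\<Sum>J\<in>subsets_of_card I p. Pi_form J vs))"
proof (induction p)
  case 0
  have "subsets_of_card I 0 = {{}}" by (auto simp: subsets_of_card_def)
  thus ?case by (simp add: unit_form_def form0_def[abs_def])
next
  case (Suc p)
  have unit: "cwedge unit_covector b = b" for b :: "('a, 'b) covector"
    by (rule ext) (rule cwedge_unit_left)
  have "wedge_power \<omega> (Suc p) x = (\<lambda>vs. c * (c ^ p * fact p) *
    (\<Sum>k\<in>I. wedge11 (coord k) (coord k) (\<lambda>vs. \<Sum>J\<in>subsets_of_card I p. Pi_form J vs) vs))"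
    unfolding wedge_power.simps wedge_def Suc assms cwedge_scale_left cwedge_sum_left cwedge_wedge11
      unit wedge11_scale
    by (simp add: sum_distrib_left mult.assoc)
  thus ?case unfolding sum_wedge11_Pi_form by (simp add: algebra_simps)
qed

lemma subsets_of_card_pred:
  assumes "finite I" "I \<noteq> {}"
  shows "(\<Sum>J\<in>subsets_of_card I (card I - 1). f J) = (\<Sum>i\<in>I. f (I - {i}))"
proof -
  have "inj_on (\<lambda>i. I - {i}) I" by (auto intro!: inj_onI)
  moreover have "(\<lambda>i. I - {i}) ` I = subsets_of_card I (card I - 1)"
  proof (intro equalityI subsetI)
    fix J assume "J \<in> subsets_of_card I (card I - 1)"
    hence J: "J \<subseteq> I" "card J = card I - 1" by (auto simp: subsets_of_card_def)
    have "card (I - J) = 1"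
      using J assms by (simp add: card_Diff_subset finite_subset card_gt_0_iff Suc_leI)
    then obtain i where "I - J = {i}" using card_1_singletonE by blast
    hence "J = I - {i}" "i \<in> I" using J by auto
    thus "J \<in> (\<lambda>i. I - {i}) ` I" by blast
  qed (use assms in \<open>auto simp: subsets_of_card_def\<close>)
  ultimately show ?thesis by (metis (mono_tags, lifting) sum.reindex_cong)
qed

subsection \<open>Smooth functions\<close>

definition dir_deriv :: "'a \<Rightarrow> ('a::real_normed_vector \<Rightarrow> complex) \<Rightarrow> 'a \<Rightarrow> complex" where
  "dir_deriv u f x = frechet_derivative f (at x) u"

lemma dir_deriv_eqI: "(f has_derivative f') (at x) \<Longrightarrow> dir_deriv u f x = f' u"
  unfolding dir_deriv_def using frechet_derivative_at by metis

lemma has_derivative_dir_deriv: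
  "f differentiable at x \<Longrightarrow> (f has_derivative (\<lambda>u. dir_deriv u f x)) (at x)"
  unfolding dir_deriv_def using frechet_derivative_works by blast

text \<open>\<open>iter_deriv\<close> applies the head of its list last. Peeling off the innermost
  derivative instead, with a bound on the order, gives the induction that closes smoothness under
  products, inverses and compositions.\<close>

primrec smooth_upto :: "nat \<Rightarrow> ('a::real_normed_vector \<Rightarrow> complex) \<Rightarrow> bool" where
  "smooth_upto 0 f \<longleftrightarrow> (\<forall>x. f differentiable at x)"
| "smooth_upto (Suc n) f \<longleftrightarrow> (\<forall>x. f differentiable at x) \<and> (\<forall>u. smooth_upto n (dir_deriv u f))"

lemma iter_deriv_snoc: "iter_deriv (us @ [u]) f = iter_deriv us (dir_deriv u f)"
  by (induction us) (simp_all add: dir_deriv_def[abs_def])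

lemma smooth_upto_iff:
  "smooth_upto n f \<longleftrightarrow> (\<forall>us x. length us \<le> n \<longrightarrow> iter_deriv us f differentiable at x)"
proof (induction n arbitrary: f)
  case (Suc n)
  show ?case
  proof
    assume s: "smooth_upto (Suc n) f"
    show "\<forall>us x. length us \<le> Suc n \<longrightarrow> iter_deriv us f differentiable at x"
    proof (intro allI impI)
      fix us :: "'a list" and x assume len: "length us \<le> Suc n"
      show "iter_deriv us f differentiable at x"
        using s len Suc by (cases us rule: rev_cases) (auto simp: iter_deriv_snoc)
    qed
  next
    assume a: "\<forall>us x. length us \<le> Suc n \<longrightarrow> iter_deriv us f differentiable at x"
    have "iter_deriv us (dir_deriv u f) differentiable at x" if "length us \<le> n" for us u x
      using a[rule_format, of "us @ [u]" x] that by (simp add: iter_deriv_snoc)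
    thus "smooth_upto (Suc n) f"
      using a[rule_format, of "[]"] by (simp add: Suc)
  qed
qed simp

lemma smooth_iff_upto: "smooth f \<longleftrightarrow> (\<forall>n. smooth_upto n f)"
  unfolding smooth_def smooth_upto_iff by blast

lemma smooth_upto_differentiable: "smooth_upto n f \<Longrightarrow> f differentiable at x"
  by (cases n) auto

lemma smooth_upto_mono: "smooth_upto (Suc n) f \<Longrightarrow> smooth_upto n f"
  unfolding smooth_upto_iff by simp

lemma smooth_differentiable: "smooth f \<Longrightarrow> f differentiable at x"
  using smooth_iff_upto smooth_upto_differentiable by blast

lemma smooth_dir_deriv: "smooth f \<Longrightarrow> smooth (dir_deriv u f)"
  unfolding smooth_iff_upto using smooth_upto.simps(2) by blast

lemma dir_deriv_const: "dir_deriv u (\<lambda>x. c) = (\<lambda>x. 0)"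
  by (rule ext) (simp add: dir_deriv_def)

lemma dir_deriv_add:
  "f differentiable at x \<Longrightarrow> g differentiable at x \<Longrightarrow>
    dir_deriv u (\<lambda>x. f x + g x) x = dir_deriv u f x + dir_deriv u g x"
  by (rule dir_deriv_eqI) (intro has_derivative_add has_derivative_dir_deriv)

lemma dir_deriv_mult:
  "f differentiable at x \<Longrightarrow> g differentiable at x \<Longrightarrow>
    dir_deriv u (\<lambda>x. f x * g x) x = f x * dir_deriv u g x + dir_deriv u f x * g x"
  by (rule dir_deriv_eqI) (intro has_derivative_mult has_derivative_dir_deriv)

lemma dir_deriv_cnj:
  "f differentiable at x \<Longrightarrow> dir_deriv u (\<lambda>x. cnj (f x)) x = cnj (dir_deriv u f x)"
  by (rule dir_deriv_eqI) (intro has_derivative_cnj has_derivative_dir_deriv)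

lemma differentiable_cnj_fun: "f differentiable at x \<Longrightarrow> (\<lambda>x. cnj (f x)) differentiable at x"
  using has_derivative_cnj has_derivative_dir_deriv differentiableI by blast

lemma dir_deriv_inverse:
  assumes "f differentiable at x" "f x \<noteq> 0"
  shows "dir_deriv u (\<lambda>x. inverse (f x)) x = - (inverse (f x) * dir_deriv u f x * inverse (f x))"
  by (rule dir_deriv_eqI, rule Deriv.has_derivative_inverse)
    (rule assms, rule has_derivative_dir_deriv[OF assms(1)])

text \<open>\<open>smooth\<close> speaks of complex-valued functions, so a real inner function
  enters through its embedding; its differential is first shown to be real because the imaginary
  part is constantly 0.\<close>

lemma has_derivative_compose_real:
  assumes "h differentiable at (f x)" "(\<lambda>x. complex_of_real (f x)) differentiable at x"
  shows "((\<lambda>x. h (f x)) has_derivative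
    (\<lambda>u. dir_deriv 1 h (f x) * dir_deriv u (\<lambda>x. complex_of_real (f x)) x)) (at x)"
proof -
  let ?D = "\<lambda>u. dir_deriv u (\<lambda>x. complex_of_real (f x)) x"
  have "((\<lambda>x. complex_of_real (f x)) has_derivative ?D) (at x)"
    using has_derivative_dir_deriv[OF assms(2)] .
  hence f': "(f has_derivative (\<lambda>u. Re (?D u))) (at x)" and "((\<lambda>x. 0) has_derivative (\<lambda>u. Im (?D u))) (at x)"
    using has_derivative_Re has_derivative_Im by force+
  hence "(\<lambda>u. Im (?D u)) = (\<lambda>u. 0)"
    using has_derivative_unique[OF _ has_derivative_const] by blast
  hence D: "?D u = of_real (Re (?D u))" for u by (simp add: complex_eq_iff fun_eq_iff)
  have h: "(h has_derivative (\<lambda>t. dir_deriv t h (f x))) (at (f x))"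
    by (rule has_derivative_dir_deriv) (rule assms)
  have lin: "dir_deriv t h (f x) = of_real t * dir_deriv 1 h (f x)" for t
    using linear_scale[OF has_derivative_linear[OF h], of t 1] by (simp add: scaleR_conv_of_real)
  have "((\<lambda>x. h (f x)) has_derivative (\<lambda>u. dir_deriv (Re (?D u)) h (f x))) (at x)"
    using has_derivative_compose[OF f' h] .
  also have "(\<lambda>u. dir_deriv (Re (?D u)) h (f x)) = (\<lambda>u. dir_deriv 1 h (f x) * ?D u)"
    using lin D by (metis mult.commute)
  finally show ?thesis .
qed

lemma dir_deriv_compose_real:
  assumes "h differentiable at (f x)" "(\<lambda>x. complex_of_real (f x)) differentiable at x"
  shows "dir_deriv u (\<lambda>x. h (f x)) x = dir_deriv 1 h (f x) * dir_deriv u (\<lambda>x. complex_of_real (f x)) x"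
  by (rule dir_deriv_eqI[OF has_derivative_compose_real[OF assms]])

lemma dir_deriv_bounded_linear: "bounded_linear f \<Longrightarrow> dir_deriv u f = (\<lambda>x. f u)"
  by (rule ext) (rule dir_deriv_eqI, rule bounded_linear_imp_has_derivative)

lemma smooth_upto_const: "smooth_upto n (\<lambda>x. c)"
  by (induction n arbitrary: c) (auto simp: dir_deriv_const)

lemma smooth_upto_add:
  "smooth_upto n f \<Longrightarrow> smooth_upto n g \<Longrightarrow> smooth_upto n (\<lambda>x. f x + g x)"
proof (induction n arbitrary: f g)
  case (Suc n)
  hence "dir_deriv u (\<lambda>x. f x + g x) = (\<lambda>x. dir_deriv u f x + dir_deriv u g x)" for u
    by (auto simp: fun_eq_iff dir_deriv_add)
  with Suc show ?case by auto
qed auto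

lemma smooth_upto_mult:
  "smooth_upto n f \<Longrightarrow> smooth_upto n g \<Longrightarrow> smooth_upto n (\<lambda>x. f x * g x)"
proof (induction n arbitrary: f g)
  case (Suc n)
  have d: "f differentiable at x" "g differentiable at x" for x
    using Suc.prems by auto
  have "dir_deriv u (\<lambda>x. f x * g x) = (\<lambda>x. f x * dir_deriv u g x + dir_deriv u f x * g x)" for u
    by (rule ext) (rule dir_deriv_mult[OF d])
  moreover have "smooth_upto n (\<lambda>x. f x * dir_deriv u g x + dir_deriv u f x * g x)" for u
    using Suc.prems smooth_upto_mono[OF Suc.prems(1)] smooth_upto_mono[OF Suc.prems(2)]
    by (intro smooth_upto_add Suc.IH) auto
  ultimately show ?case using d by simp
qed auto

lemma smooth_upto_cnj: "smooth_upto n f \<Longrightarrow> smooth_upto n (\<lambda>x. cnj (f x))"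
proof (induction n arbitrary: f)
  case 0
  thus ?case by (auto intro: differentiable_cnj_fun)
next
  case (Suc n)
  hence "dir_deriv u (\<lambda>x. cnj (f x)) = (\<lambda>x. cnj (dir_deriv u f x))" for u
    by (auto simp: fun_eq_iff dir_deriv_cnj)
  with Suc show ?case by (auto intro: differentiable_cnj_fun)
qed

lemma smooth_upto_inverse:
  assumes "smooth_upto n f" "\<And>x. f x \<noteq> 0"
  shows "smooth_upto n (\<lambda>x. inverse (f x))"
  using assms(1)
proof (induction n)
  case (Suc n)
  have d: "f differentiable at x" for x using Suc.prems by auto
  have "dir_deriv u (\<lambda>x. inverse (f x)) = (\<lambda>x. (-1) * (inverse (f x) * dir_deriv u f x * inverse (f x)))" for u
    by (rule ext) (simp add: dir_deriv_inverse[OF d assms(2)])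
  moreover have "smooth_upto n (\<lambda>x. (-1) * (inverse (f x) * dir_deriv u f x * inverse (f x)))" for u
    using Suc.prems Suc.IH[OF smooth_upto_mono[OF Suc.prems]]
    by (intro smooth_upto_mult smooth_upto_const) auto
  ultimately show ?case using d assms(2) by (simp add: differentiable_inverse)
qed (use assms(2) in \<open>simp add: differentiable_inverse\<close>)

lemma smooth_upto_compose_real:
  "smooth_upto n h \<Longrightarrow> smooth_upto n (\<lambda>x. complex_of_real (f x)) \<Longrightarrow> smooth_upto n (\<lambda>x. h (f x))"
proof (induction n arbitrary: h)
  case 0
  have "h differentiable at y" "(\<lambda>x. complex_of_real (f x)) differentiable at x" for x y
    using 0 by simp_all
  from differentiableI[OF has_derivative_compose_real[OF this]] show ?case by simp
next
  case (Suc n)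
  have d: "h differentiable at y" "(\<lambda>x. complex_of_real (f x)) differentiable at x" for x y
    using Suc.prems by auto
  have "dir_deriv u (\<lambda>x. h (f x)) = (\<lambda>x. dir_deriv 1 h (f x) * dir_deriv u (\<lambda>x. complex_of_real (f x)) x)" for u
    by (rule ext) (rule dir_deriv_compose_real[OF d])
  moreover have "smooth_upto n (\<lambda>x. dir_deriv 1 h (f x) * dir_deriv u (\<lambda>x. complex_of_real (f x)) x)" for u
  proof (rule smooth_upto_mult)
    show "smooth_upto n (\<lambda>x. dir_deriv 1 h (f x))"
      by (rule Suc.IH) (use Suc.prems smooth_upto_mono[OF Suc.prems(2)] in auto)
  qed (use Suc.prems in auto)
  moreover have "(\<lambda>x. h (f x)) differentiable at x" for x
    using has_derivative_compose_real[OF d] differentiableI by blast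
  ultimately show ?case by simp
qed

lemma smooth_const: "smooth (\<lambda>x. c)"
  and smooth_add: "smooth f \<Longrightarrow> smooth g \<Longrightarrow> smooth (\<lambda>x. f x + g x)"
  and smooth_mult: "smooth f \<Longrightarrow> smooth g \<Longrightarrow> smooth (\<lambda>x. f x * g x)"
  and smooth_cnj: "smooth f \<Longrightarrow> smooth (\<lambda>x. cnj (f x))"
  and smooth_inverse: "smooth f \<Longrightarrow> (\<And>x. f x \<noteq> 0) \<Longrightarrow> smooth (\<lambda>x. inverse (f x))"
  and smooth_compose_real: "smooth h \<Longrightarrow> smooth (\<lambda>x. complex_of_real (k x)) \<Longrightarrow> smooth (\<lambda>x. h (k x))"
  unfolding smooth_iff_upto
  by (simp_all add: smooth_upto_const smooth_upto_add smooth_upto_mult smooth_upto_cnj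
      smooth_upto_inverse smooth_upto_compose_real)

lemma smooth_bounded_linear: "bounded_linear f \<Longrightarrow> smooth f"
proof -
  assume f: "bounded_linear f"
  have "f differentiable at x" for x
    using f by (rule bounded_linear_imp_differentiable)
  hence "smooth_upto n f" for n
    by (cases n) (simp_all add: dir_deriv_bounded_linear[OF f] smooth_upto_const)
  thus ?thesis by (simp add: smooth_iff_upto)
qed

lemma smooth_uminus: "smooth f \<Longrightarrow> smooth (\<lambda>x. - f x)"
  using smooth_mult[OF smooth_const[of "-1"], of f] by simp

lemma smooth_diff: "smooth f \<Longrightarrow> smooth g \<Longrightarrow> smooth (\<lambda>x. f x - g x)"
  using smooth_add[OF _ smooth_uminus, of f g] by simp

lemma smooth_power: "smooth f \<Longrightarrow> smooth (\<lambda>x. f x ^ n)"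
  by (induction n) (simp_all add: smooth_const smooth_mult)

lemma smooth_sum: "(\<And>k. k \<in> I \<Longrightarrow> smooth (f k)) \<Longrightarrow> smooth (\<lambda>x. \<Sum>k\<in>I. f k x)"
  by (induction I rule: infinite_finite_induct) (simp_all add: smooth_const smooth_add)

lemma smooth_prod: "(\<And>k. k \<in> I \<Longrightarrow> smooth (f k)) \<Longrightarrow> smooth (\<lambda>x. \<Prod>k\<in>I. f k x)"
  by (induction I rule: infinite_finite_induct) (simp_all add: smooth_const smooth_mult)

subsection \<open>Symmetry of second derivatives\<close>

text \<open>The mean value theorem along \<open>u\<close> reduces the second difference to a
  difference of first derivatives, and differentiability of these at the point \<open>x\<close>
  gives the limit. The mean value theorem is the reason for real values.\<close>

lemma second_difference_estimate:
  fixes F :: "'a::real_normed_vector \<Rightarrow> real"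
  assumes F: "\<And>y. (F has_derivative F' y) (at y)"
    and G: "((\<lambda>y. F' y u) has_derivative G) (at x)"
  shows "((\<lambda>t. (F (x + t *\<^sub>R u + t *\<^sub>R v) - F (x + t *\<^sub>R u) - F (x + t *\<^sub>R v) + F x) / t\<^sup>2)
    \<longlongrightarrow> G v) (at_right 0)"
proof (rule tendstoI)
  fix e :: real assume e: "e > 0"
  \<comment> \<open>The linear approximation is used at two points of size at most
    \<open>t * (norm u + norm v)\<close>; \<open>c\<close> exceeds twice this factor, so that the
    two errors together stay below \<open>e\<close>.\<close>
  define c where "c = 2 * (norm u + norm v) + 1"
  have c: "c > 0" unfolding c_def by (simp add: add_nonneg_pos)
  obtain d where d: "d > 0" and R: "\<And>y. norm (y - x) < d \<Longrightarrow>
      norm (F' y u - F' x u - G (y - x)) \<le> e / c * norm (y - x)"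
    using G divide_pos_pos[OF e c] unfolding has_derivative_at_alt by blast
  interpret G: bounded_linear G using G by (rule has_derivative_bounded_linear)
  have "eventually (\<lambda>t. t \<in> {0<..<d / c}) (at_right 0)"
    by (rule eventually_at_right_real) (use d c in simp)
  thus "eventually (\<lambda>t. dist ((F (x + t *\<^sub>R u + t *\<^sub>R v) - F (x + t *\<^sub>R u) - F (x + t *\<^sub>R v) + F x) / t\<^sup>2) (G v) < e) (at_right 0)"
  proof (rule eventually_mono)
    fix t assume "t \<in> {0<..<d / c}"
    hence t: "t > 0" "t * c < d" using c by (auto simp: field_simps)
    let ?p = "\<lambda>s. F (x + s *\<^sub>R u + t *\<^sub>R v) - F (x + s *\<^sub>R u)"
    have lin: "F' y (s *\<^sub>R w) = s * F' y w" for y s w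
      using linear_scale[OF has_derivative_linear[OF F[of y]]] by simp
    have "(?p has_real_derivative (F' (x + s *\<^sub>R u + t *\<^sub>R v) u - F' (x + s *\<^sub>R u) u)) (at s)" for s
    proof -
      have "((\<lambda>s. F (x + s *\<^sub>R u + w)) has_derivative (\<lambda>h. F' (x + s *\<^sub>R u + w) (h *\<^sub>R u))) (at s)" for w
        by (rule has_derivative_compose[OF _ F]) (auto intro!: derivative_eq_intros)
      from has_derivative_diff[OF this[of "t *\<^sub>R v"] this[of 0]]
      have "(?p has_derivative (\<lambda>h. F' (x + s *\<^sub>R u + t *\<^sub>R v) (h *\<^sub>R u) - F' (x + s *\<^sub>R u) (h *\<^sub>R u))) (at s)"
        by simp
      thus ?thesis
        unfolding has_field_derivative_def
        by (rule has_derivative_eq_rhs) (simp add: fun_eq_iff lin algebra_simps)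
    qed
    then obtain s where s: "0 < s" "s < t" and
      mvt: "?p t - ?p 0 = (t - 0) * (F' (x + s *\<^sub>R u + t *\<^sub>R v) u - F' (x + s *\<^sub>R u) u)"
      using MVT2[OF t(1), of ?p "\<lambda>s. F' (x + s *\<^sub>R u + t *\<^sub>R v) u - F' (x + s *\<^sub>R u) u"] by blast
    have n1: "norm (s *\<^sub>R u + t *\<^sub>R v) \<le> t * (norm u + norm v)" "norm (s *\<^sub>R u) \<le> t * (norm u + norm v)"
      using s t norm_triangle_ineq[of "s *\<^sub>R u" "t *\<^sub>R v"] mult_right_mono[of s t "norm u"]
      by (auto simp: algebra_simps intro: add_increasing2)
    have "t * (norm u + norm v) \<le> t * c" using t by (simp add: c_def)
    hence lt: "t * (norm u + norm v) < d" using t by linarith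
    have ec: "e / c \<ge> 0" using e c by simp
    have R1: "\<bar>F' (x + s *\<^sub>R u + t *\<^sub>R v) u - F' x u - G (s *\<^sub>R u + t *\<^sub>R v)\<bar> \<le> e / c * (t * (norm u + norm v))"
      using R[of "x + s *\<^sub>R u + t *\<^sub>R v"] n1(1) lt mult_left_mono[OF n1(1) ec] by (auto simp: add.assoc)
    have R2: "\<bar>F' (x + s *\<^sub>R u) u - F' x u - G (s *\<^sub>R u)\<bar> \<le> e / c * (t * (norm u + norm v))"
      using R[of "x + s *\<^sub>R u"] n1(2) lt mult_left_mono[OF n1(2) ec] by auto
    have "\<bar>(?p t - ?p 0) / t\<^sup>2 - G v\<bar> = \<bar>(F' (x + s *\<^sub>R u + t *\<^sub>R v) u - F' (x + s *\<^sub>R u) u - t * G v) / t\<bar>"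
      by (subst mvt) (use t in \<open>simp add: power2_eq_square diff_divide_distrib\<close>)
    also have "\<dots> \<le> (2 * (e / c * (t * (norm u + norm v)))) / t"
    proof -
      have "\<bar>F' (x + s *\<^sub>R u + t *\<^sub>R v) u - F' (x + s *\<^sub>R u) u - t * G v\<bar> \<le> 2 * (e / c * (t * (norm u + norm v)))"
        using R1 R2 unfolding G.add G.scaleR real_scaleR_def by linarith
      thus ?thesis using t by (simp only: abs_divide abs_of_pos divide_right_mono less_imp_le)
    qed
    also have "\<dots> = e * (2 * (norm u + norm v)) / c" using t by simp
    also have "\<dots> < e" using e c by (simp add: c_def divide_less_eq)
    finally show "dist ((F (x + t *\<^sub>R u + t *\<^sub>R v) - F (x + t *\<^sub>R u) - F (x + t *\<^sub>R v) + F x) / t\<^sup>2) (G v) < e"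
      by (simp add: dist_real_def algebra_simps)
  qed
qed

text \<open>The second difference quotient is symmetric in \<open>u\<close> and \<open>v\<close> and
  converges to either iterated derivative; real and imaginary parts are treated separately.\<close>

lemma dir_deriv_commute:
  assumes "smooth f"
  shows "dir_deriv u (dir_deriv v f) x = dir_deriv v (dir_deriv u f) x"
proof -
  have d: "(f has_derivative (\<lambda>u. dir_deriv u f y)) (at y)" for y
    by (rule has_derivative_dir_deriv[OF smooth_differentiable[OF assms]])
  have d2: "(dir_deriv w f has_derivative (\<lambda>u. dir_deriv u (dir_deriv w f) y)) (at y)" for w y
    by (rule has_derivative_dir_deriv[OF smooth_differentiable[OF smooth_dir_deriv[OF assms]]])
  have "P (dir_deriv u (dir_deriv v f) x) = P (dir_deriv v (dir_deriv u f) x)"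
    if P: "bounded_linear P" for P :: "complex \<Rightarrow> real"
  proof -
    let ?F = "\<lambda>y. P (f y)"
    have F: "(?F has_derivative (\<lambda>u. P (dir_deriv u f y))) (at y)" for y
      by (rule bounded_linear.has_derivative[OF P d])
    have G: "((\<lambda>y. P (dir_deriv w f y)) has_derivative (\<lambda>u. P (dir_deriv u (dir_deriv w f) x))) (at x)" for w
      by (rule bounded_linear.has_derivative[OF P d2])
    have L1: "((\<lambda>t. (?F (x + t *\<^sub>R u + t *\<^sub>R v) - ?F (x + t *\<^sub>R u) - ?F (x + t *\<^sub>R v) + ?F x) / t\<^sup>2)
        \<longlongrightarrow> P (dir_deriv v (dir_deriv u f) x)) (at_right 0)"
      by (rule second_difference_estimate[OF F G])
    have L2: "((\<lambda>t. (?F (x + t *\<^sub>R v + t *\<^sub>R u) - ?F (x + t *\<^sub>R v) - ?F (x + t *\<^sub>R u) + ?F x) / t\<^sup>2)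
        \<longlongrightarrow> P (dir_deriv u (dir_deriv v f) x)) (at_right 0)"
      by (rule second_difference_estimate[OF F G])
    have eq: "(\<lambda>t. (?F (x + t *\<^sub>R v + t *\<^sub>R u) - ?F (x + t *\<^sub>R v) - ?F (x + t *\<^sub>R u) + ?F x) / t\<^sup>2)
      = (\<lambda>t. (?F (x + t *\<^sub>R u + t *\<^sub>R v) - ?F (x + t *\<^sub>R u) - ?F (x + t *\<^sub>R v) + ?F x) / t\<^sup>2)"
      by (simp add: algebra_simps)
    show ?thesis
      by (rule tendsto_unique[OF trivial_limit_at_right_real L2[unfolded eq] L1])
  qed
  from this[OF bounded_linear_Re] this[OF bounded_linear_Im] show ?thesis
    by (simp add: complex_eq_iff)
qed

subsection \<open>Wirtinger derivatives\<close>

definition basis_vec :: "'n + 'm \<Rightarrow> ('n::finite, 'm::finite) cspace" where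
  "basis_vec k = (case k of Inl i \<Rightarrow> (axis i 1, 0) | Inr i \<Rightarrow> (0, axis i 1))"

lemma coord_basis_vec [simp]: "coord l (basis_vec k) = (if k = l then 1 else 0)"
  by (auto simp: coord_def basis_vec_def axis_def split: sum.split)

lemma coord_sum: "coord k (\<Sum>a\<in>A. f a) = (\<Sum>a\<in>A. coord k (f a))"
  by (induction A rule: infinite_finite_induct) auto

lemma cspace_eqI:
  assumes "\<And>k. coord k u = coord k v"
  shows "u = v"
proof -
  have "fst u $ i = fst v $ i" "snd u $ j = snd v $ j" for i j
    using assms[of "Inl i"] assms[of "Inr j"] by (simp_all add: coord_def)
  thus ?thesis by (simp add: prod_eq_iff vec_eq_iff)
qed

lemma cspace_expand: "v = (\<Sum>k\<in>UNIV. cscale (coord k v) (basis_vec k))"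
proof (rule cspace_eqI)
  fix k
  have "coord k (\<Sum>l\<in>UNIV. cscale (coord l v) (basis_vec l)) = (\<Sum>l\<in>UNIV. if l = k then coord l v else 0)"
    unfolding coord_sum by (rule sum.cong) auto
  thus "coord k v = coord k (\<Sum>l\<in>UNIV. cscale (coord l v) (basis_vec l))" by simp
qed

lemma cscale_eq_scaleR: "cscale c v = Re c *\<^sub>R v + Im c *\<^sub>R cscale \<i> v"
  by (rule cspace_eqI) (simp add: complex_eq_iff)

lemma norm_coord_le: "norm (coord k v) \<le> norm v"
proof (cases k)
  case (Inl i)
  show ?thesis
    using Finite_Cartesian_Product.norm_nth_le[of "fst v" i] norm_fst_le[of "fst v" "snd v"] by (simp add: coord_def Inl)
next
  case (Inr i)
  show ?thesis
    using Finite_Cartesian_Product.norm_nth_le[of "snd v" i] norm_snd_le[of "snd v" "fst v"] by (simp add: coord_def Inr)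
qed

lemma bounded_linear_coord: "bounded_linear (coord k)"
  by (rule bounded_linear_intro[of _ 1])
     (simp_all add: norm_coord_le scaleR_conv_of_real)

lemma smooth_coord: "smooth (coord k)"
  by (rule smooth_bounded_linear[OF bounded_linear_coord])

text \<open>The sign \<open>s = -1\<close> gives the derivative in the \<open>k\<close>-th coordinate, \<open>s = 1\<close> the one in its conjugate.\<close>

definition wirt :: "real \<Rightarrow> 'n + 'm \<Rightarrow> (('n::finite, 'm::finite) cspace \<Rightarrow> complex) \<Rightarrow> ('n, 'm) cspace \<Rightarrow> complex" where
  "wirt s k f x = (dir_deriv (basis_vec k) f x + of_real s * \<i> * dir_deriv (cscale \<i> (basis_vec k)) f x) / 2"

lemma smooth_wirt: "smooth f \<Longrightarrow> smooth (wirt s k f)"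
proof -
  assume f: "smooth f"
  have "smooth (\<lambda>x. (1 / 2) * (dir_deriv (basis_vec k) f x + (of_real s * \<i>) * dir_deriv (cscale \<i> (basis_vec k)) f x))"
    by (intro smooth_mult smooth_add smooth_const smooth_dir_deriv f)
  moreover have "wirt s k f = (\<lambda>x. (1 / 2) * (dir_deriv (basis_vec k) f x + (of_real s * \<i>) * dir_deriv (cscale \<i> (basis_vec k)) f x))"
    by (rule ext) (simp add: wirt_def)
  ultimately show ?thesis by simp
qed

lemma wirt_const: "wirt s k (\<lambda>x. c) = (\<lambda>x. 0)"
  by (rule ext) (simp add: wirt_def dir_deriv_const)

lemma wirt_add:
  "smooth f \<Longrightarrow> smooth g \<Longrightarrow> wirt s k (\<lambda>x. f x + g x) = (\<lambda>x. wirt s k f x + wirt s k g x)"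
  by (rule ext) (simp add: wirt_def dir_deriv_add smooth_differentiable algebra_simps add_divide_distrib)

lemma wirt_mult:
  "smooth f \<Longrightarrow> smooth g \<Longrightarrow> wirt s k (\<lambda>x. f x * g x) = (\<lambda>x. f x * wirt s k g x + wirt s k f x * g x)"
  by (rule ext) (simp add: wirt_def dir_deriv_mult smooth_differentiable algebra_simps add_divide_distrib)

lemma wirt_cmult: "smooth f \<Longrightarrow> wirt s k (\<lambda>x. c * f x) = (\<lambda>x. c * wirt s k f x)"
  using wirt_mult[OF smooth_const[of c], of f s k] by (simp add: wirt_const)

lemma wirt_uminus: "smooth f \<Longrightarrow> wirt s k (\<lambda>x. - f x) = (\<lambda>x. - wirt s k f x)"
  using wirt_cmult[of f s k "-1"] by simp

lemma wirt_diff: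
  "smooth f \<Longrightarrow> smooth g \<Longrightarrow> wirt s k (\<lambda>x. f x - g x) = (\<lambda>x. wirt s k f x - wirt s k g x)"
  using wirt_add[OF _ smooth_uminus, of f g s k] by (simp add: wirt_uminus)

lemma wirt_sum:
  "(\<And>a. a \<in> A \<Longrightarrow> smooth (f a)) \<Longrightarrow> wirt s k (\<lambda>x. \<Sum>a\<in>A. f a x) = (\<lambda>x. \<Sum>a\<in>A. wirt s k (f a) x)"
  by (induction A rule: infinite_finite_induct) (simp_all add: wirt_const wirt_add smooth_sum)

lemma wirt_cnj: "smooth f \<Longrightarrow> wirt s k (\<lambda>x. cnj (f x)) = (\<lambda>x. cnj (wirt (- s) k f x))"
  by (rule ext) (simp add: wirt_def dir_deriv_cnj smooth_differentiable)

lemma wirt_coord: "wirt s k (coord l) = (\<lambda>x. if k = l then (1 - of_real s) / 2 else 0)"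
  by (rule ext) (simp add: wirt_def dir_deriv_bounded_linear[OF bounded_linear_coord])

lemma wirt_inverse:
  assumes "smooth f" "\<And>x. f x \<noteq> 0"
  shows "wirt s k (\<lambda>x. inverse (f x)) = (\<lambda>x. - wirt s k f x * (inverse (f x))\<^sup>2)"
  by (rule ext)
     (simp add: wirt_def dir_deriv_inverse assms smooth_differentiable algebra_simps
       power2_eq_square add_divide_distrib diff_divide_distrib)

lemma wirt_compose_real:
  assumes "smooth h" "smooth (\<lambda>x. complex_of_real (f x))"
  shows "wirt s k (\<lambda>x. h (f x)) = (\<lambda>x. dir_deriv 1 h (f x) * wirt s k (\<lambda>x. complex_of_real (f x)) x)"
  by (rule ext)
     (simp add: wirt_def algebra_simps add_divide_distrib
       dir_deriv_compose_real[of h f, OF smooth_differentiable[OF assms(1)] smooth_differentiable[OF assms(2)]])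

lemma dir_deriv_lincomb:
  assumes "smooth f" "smooth g"
  shows "dir_deriv u (\<lambda>x. (f x + c * g x) / 2) x = (dir_deriv u f x + c * dir_deriv u g x) / 2"
proof -
  have "dir_deriv u (\<lambda>x. (f x + c * g x) * (1 / 2)) x = (f x + c * g x) * dir_deriv u (\<lambda>x. 1 / 2) x
      + dir_deriv u (\<lambda>x. f x + c * g x) x * (1 / 2)"
    by (intro dir_deriv_mult smooth_differentiable smooth_const smooth_add smooth_mult assms)
  also have "dir_deriv u (\<lambda>x. f x + c * g x) x = dir_deriv u f x + dir_deriv u (\<lambda>x. c * g x) x"
    by (intro dir_deriv_add smooth_differentiable smooth_mult smooth_const assms)
  also have "dir_deriv u (\<lambda>x. c * g x) x = c * dir_deriv u g x + dir_deriv u (\<lambda>x. c) x * g x"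
    by (intro dir_deriv_mult smooth_differentiable smooth_const assms)
  finally show ?thesis by (simp add: dir_deriv_const)
qed

lemma wirt_commute:
  assumes "smooth f"
  shows "wirt s k (wirt t l f) x = wirt t l (wirt s k f) x"
  unfolding wirt_def[of t l "wirt s k f"] wirt_def[of s k "wirt t l f"]
  unfolding wirt_def[abs_def]
  by (simp only: dir_deriv_lincomb smooth_dir_deriv assms)
     (simp add: dir_deriv_commute[OF assms] algebra_simps add_divide_distrib)

lemma del_fun_eq_sum:
  assumes "f differentiable at x"
  shows "del_fun f x v = (\<Sum>k\<in>UNIV. wirt (-1) k f x * coord k v)"
    and "delbar_fun f x v = (\<Sum>k\<in>UNIV. wirt 1 k f x * cnj (coord k v))"
proof -
  let ?D = "\<lambda>v. dir_deriv v f x"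
  have lin: "linear ?D"
    using has_derivative_linear[OF has_derivative_dir_deriv[OF assms]] .
  have c: "?D (cscale c w) = of_real (Re c) * ?D w + of_real (Im c) * ?D (cscale \<i> w)" for c w
    by (subst cscale_eq_scaleR)
       (simp only: linear_add[OF lin] linear_scale[OF lin] scaleR_conv_of_real)
  have ex: "?D w = (\<Sum>k\<in>UNIV. of_real (Re (coord k w)) * ?D (basis_vec k)
      + of_real (Im (coord k w)) * ?D (cscale \<i> (basis_vec k)))" for w
    by (subst cspace_expand[of w], subst linear_sum[OF lin], intro sum.cong refl c)
  have cc: "z = of_real (Re z) + \<i> * of_real (Im z)" for z
    by (simp add: complex_eq)
  have cc': "cnj z = of_real (Re z) - \<i> * of_real (Im z)" for z
    by (simp add: complex_eq_iff)
  show "del_fun f x v = (\<Sum>k\<in>UNIV. wirt (-1) k f x * coord k v)"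
    unfolding del_fun_def wirt_def dir_deriv_def[symmetric] ex[of v] ex[of "cscale \<i> v"]
      sum_distrib_left sum_subtractf[symmetric] sum_divide_distrib
    by (intro sum.cong refl, subst (5) cc) (simp add: algebra_simps add_divide_distrib diff_divide_distrib)
  show "delbar_fun f x v = (\<Sum>k\<in>UNIV. wirt 1 k f x * cnj (coord k v))"
    unfolding delbar_fun_def wirt_def dir_deriv_def[symmetric] ex[of v] ex[of "cscale \<i> v"]
      sum_distrib_left sum.distrib[symmetric] sum_divide_distrib cc'
    by (intro sum.cong refl) (simp add: algebra_simps add_divide_distrib diff_divide_distrib)
qed

subsection \<open>The operator \<open>dd\<^sup>c\<close> on forms with constant covectors\<close>

lemma wirt_lincomb:
  assumes "\<And>a. a \<in> A \<Longrightarrow> smooth (f a)"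
  shows "wirt s k (\<lambda>y. \<Sum>a\<in>A. f a y * c a) x = (\<Sum>a\<in>A. wirt s k (f a) x * c a)"
proof -
  have "wirt s k (\<lambda>y. \<Sum>a\<in>A. c a * f a y) = (\<lambda>x. \<Sum>a\<in>A. wirt s k (\<lambda>y. c a * f a y) x)"
    by (rule wirt_sum) (intro smooth_mult smooth_const assms)
  also have "\<dots> = (\<lambda>x. \<Sum>a\<in>A. c a * wirt s k (f a) x)"
    by (intro ext sum.cong refl) (simp add: wirt_cmult assms)
  finally have "wirt s k (\<lambda>y. \<Sum>a\<in>A. c a * f a y) x = (\<Sum>a\<in>A. c a * wirt s k (f a) x)"
    by (rule fun_cong)
  thus ?thesis by (simp add: mult.commute)
qed

lemma sum_omit_wirt:
  assumes "\<And>a. a \<in> A \<Longrightarrow> smooth (f a)"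
  shows "(\<Sum>i<length vs. (-1) ^ i * (\<Sum>k\<in>UNIV. wirt s k (\<lambda>y. \<Sum>a\<in>A. f a y * P a (omit i vs)) x * l k (vs ! i)))
    = (\<Sum>a\<in>A. \<Sum>k\<in>UNIV. wirt s k (f a) x * wedge1 (l k) (P a) vs)"
proof -
  have "(\<Sum>i<length vs. (-1) ^ i * (\<Sum>k\<in>UNIV. wirt s k (\<lambda>y. \<Sum>a\<in>A. f a y * P a (omit i vs)) x * l k (vs ! i)))
    = (\<Sum>i<length vs. \<Sum>k\<in>UNIV. \<Sum>a\<in>A. wirt s k (f a) x * ((-1) ^ i * l k (vs ! i) * P a (omit i vs)))"
    by (simp only: wirt_lincomb[OF assms] sum_distrib_left sum_distrib_right)
       (simp add: mult_ac)
  also have "\<dots> = (\<Sum>a\<in>A. \<Sum>k\<in>UNIV. \<Sum>i<length vs. wirt s k (f a) x * ((-1) ^ i * l k (vs ! i) * P a (omit i vs)))"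
  proof -
    let ?g = "\<lambda>i k a. wirt s k (f a) x * ((-1) ^ i * l k (vs ! i) * P a (omit i vs))"
    have "(\<Sum>i<length vs. \<Sum>k\<in>UNIV. \<Sum>a\<in>A. ?g i k a) = (\<Sum>k\<in>UNIV. \<Sum>i<length vs. \<Sum>a\<in>A. ?g i k a)"
      by (rule sum.swap)
    also have "\<dots> = (\<Sum>k\<in>UNIV. \<Sum>a\<in>A. \<Sum>i<length vs. ?g i k a)"
      by (rule sum.cong[OF refl], rule sum.swap)
    also have "\<dots> = (\<Sum>a\<in>A. \<Sum>k\<in>UNIV. \<Sum>i<length vs. ?g i k a)"
      by (rule sum.swap)
    finally show ?thesis .
  qed
  finally show ?thesis by (simp add: wedge1_eq_sum_omit sum_distrib_left)
qed

lemma del_lincomb: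
  assumes "\<And>a. a \<in> A \<Longrightarrow> smooth (f a)"
  shows "del (\<lambda>x vs. \<Sum>a\<in>A. f a x * P a vs)
    = (\<lambda>x vs. \<Sum>a\<in>A. \<Sum>k\<in>UNIV. wirt (-1) k (f a) x * wedge1 (coord k) (P a) vs)"
    and "delbar (\<lambda>x vs. \<Sum>a\<in>A. f a x * P a vs)
    = (\<lambda>x vs. \<Sum>a\<in>A. \<Sum>k\<in>UNIV. wirt 1 k (f a) x * wedge1 (\<lambda>v. cnj (coord k v)) (P a) vs)"
proof -
  have d: "(\<lambda>y. \<Sum>a\<in>A. f a y * P a (omit i vs)) differentiable at x" for i vs x
    by (intro smooth_differentiable smooth_sum smooth_mult smooth_const assms)
  show "del (\<lambda>x vs. \<Sum>a\<in>A. f a x * P a vs)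
    = (\<lambda>x vs. \<Sum>a\<in>A. \<Sum>k\<in>UNIV. wirt (-1) k (f a) x * wedge1 (coord k) (P a) vs)"
    unfolding del_def[abs_def] del_fun_eq_sum(1)[OF d]
    by (intro ext sum_omit_wirt[where l = coord and P = P and f = f and A = A] assms)
  show "delbar (\<lambda>x vs. \<Sum>a\<in>A. f a x * P a vs)
    = (\<lambda>x vs. \<Sum>a\<in>A. \<Sum>k\<in>UNIV. wirt 1 k (f a) x * wedge1 (\<lambda>v. cnj (coord k v)) (P a) vs)"
    unfolding delbar_def[abs_def] del_fun_eq_sum(2)[OF d]
    by (intro ext sum_omit_wirt[where l = "\<lambda>k v. cnj (coord k v)" and P = P and f = f and A = A] assms)
qed

definition fform :: "(('n::finite, 'm::finite) cspace \<Rightarrow> complex) \<Rightarrow> ('n, 'm) covector \<Rightarrow> ('n, 'm) form" where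
  "fform f P = (\<lambda>x vs. f x * P vs)"

lemma antisym_sum_zero:
  fixes S W :: "'k \<Rightarrow> 'k \<Rightarrow> complex"
  assumes "\<And>k l. S k l = S l k" "\<And>k l. W k l = - W l k"
  shows "(\<Sum>k\<in>A. \<Sum>l\<in>A. S k l * W k l) = 0"
proof -
  have "(\<Sum>k\<in>A. \<Sum>l\<in>A. S k l * W k l) = (\<Sum>l\<in>A. \<Sum>k\<in>A. S k l * W k l)" by (rule sum.swap)
  also have "\<dots> = (\<Sum>l\<in>A. \<Sum>k\<in>A. - (S l k * W l k))"
  proof (intro sum.cong refl)
    fix k l
    show "S k l * W k l = - (S l k * W l k)" using assms(1)[of k l] assms(2)[of k l] by simp
  qed
  finally show ?thesis by (simp add: sum_negf)
qed

text \<open>The (2,0) and (0,2) parts pair symmetric second derivatives with antisymmetric products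
  and vanish. The two mixed parts agree, which doubles the constant \<open>1 / (4 * pi)\<close>; the
  \<open>\<i>\<close> of \<open>ext_dc\<close> is absorbed by \<open>wedge11\<close>.\<close>

lemma ddc_fform:
  assumes "smooth \<phi>"
  shows "ext_d (ext_dc (fform \<phi> P)) = (\<lambda>x vs. 1 / (2 * of_real pi) *
    (\<Sum>l\<in>UNIV. \<Sum>k\<in>UNIV. wirt (-1) l (wirt 1 k \<phi>) x * wedge11 (coord l) (coord k) P vs))"
proof -
  define c :: complex where "c = \<i> / (4 * of_real pi)"
  let ?e = "\<lambda>k. coord k" and ?eb = "\<lambda>k v. cnj (coord k v)"
  \<comment> \<open>The boolean marks the type of the covector, \<open>True\<close> for
    conjugate-linear, so that \<open>ext_dc\<close> becomes a single linear combination to which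
    \<open>del_lincomb\<close> applies.\<close>
  define f where "f = (\<lambda>a. case a of (True, k) \<Rightarrow> (\<lambda>x. c * wirt 1 k \<phi> x) | (False, k) \<Rightarrow> (\<lambda>x. - c * wirt (-1) k \<phi> x))"
  define Q where "Q = (\<lambda>a. case a of (True, k) \<Rightarrow> wedge1 (?eb k) P | (False, k) \<Rightarrow> wedge1 (?e k) P)"
  have f: "smooth (f a)" for a
    unfolding f_def by (cases a; cases "fst a") (auto intro!: smooth_mult smooth_const smooth_wirt assms smooth_uminus)
  have UB: "(\<Sum>a\<in>UNIV. g a) = (\<Sum>k\<in>UNIV. g (True, k)) + (\<Sum>k\<in>UNIV. g (False, k))"
    for g :: "bool \<times> ('a + 'b) \<Rightarrow> complex"
  proof -
    have "(\<Sum>a\<in>UNIV. g a) = (\<Sum>b\<in>UNIV. \<Sum>k\<in>UNIV. g (b, k))"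
      unfolding sum.cartesian_product by simp
    thus ?thesis by (simp add: UNIV_bool add.commute)
  qed
  have dcform: "ext_dc (fform \<phi> P) = (\<lambda>x vs. \<Sum>a\<in>UNIV. f a x * Q a vs)"
    unfolding ext_dc_def form_scale_def form_add_def c_def[symmetric]
    using del_lincomb[of "{()}" "\<lambda>_. \<phi>" "\<lambda>_. P"] assms
    by (simp add: fform_def fun_eq_iff form_scale_def UB f_def Q_def sum_distrib_left algebra_simps sum_negf)
  have "ext_d (ext_dc (fform \<phi> P)) x vs = 1 / (2 * of_real pi) *
    (\<Sum>l\<in>UNIV. \<Sum>k\<in>UNIV. wirt (-1) l (wirt 1 k \<phi>) x * wedge11 (coord l) (coord k) P vs)" for x vs
  proof -
    have "ext_d (ext_dc (fform \<phi> P)) x vs =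
        c * (\<Sum>k\<in>UNIV. \<Sum>l\<in>UNIV. wirt (-1) l (wirt 1 k \<phi>) x * wedge1 (?e l) (wedge1 (?eb k) P) vs)
      - c * (\<Sum>k\<in>UNIV. \<Sum>l\<in>UNIV. wirt (-1) l (wirt (-1) k \<phi>) x * wedge1 (?e l) (wedge1 (?e k) P) vs)
      + c * (\<Sum>k\<in>UNIV. \<Sum>l\<in>UNIV. wirt 1 l (wirt 1 k \<phi>) x * wedge1 (?eb l) (wedge1 (?eb k) P) vs)
      - c * (\<Sum>k\<in>UNIV. \<Sum>l\<in>UNIV. wirt 1 l (wirt (-1) k \<phi>) x * wedge1 (?eb l) (wedge1 (?e k) P) vs)"
      unfolding dcform ext_d_def form_add_def del_lincomb[of UNIV f Q, OF f]
      by (simp add: UB f_def Q_def wirt_cmult wirt_uminus smooth_mult smooth_const smooth_wirt assms sum_distrib_left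
          mult.assoc sum_negf)
    also have "(\<Sum>k\<in>UNIV. \<Sum>l\<in>UNIV. wirt (-1) l (wirt (-1) k \<phi>) x * wedge1 (?e l) (wedge1 (?e k) P) vs) = 0"
      by (rule antisym_sum_zero) (rule wirt_commute[OF assms] wedge1_anticommute)+
    also have "(\<Sum>k\<in>UNIV. \<Sum>l\<in>UNIV. wirt 1 l (wirt 1 k \<phi>) x * wedge1 (?eb l) (wedge1 (?eb k) P) vs) = 0"
      by (rule antisym_sum_zero) (rule wirt_commute[OF assms] wedge1_anticommute)+
    also have "(\<Sum>k\<in>UNIV. \<Sum>l\<in>UNIV. wirt 1 l (wirt (-1) k \<phi>) x * wedge1 (?eb l) (wedge1 (?e k) P) vs)
      = - (\<Sum>k\<in>UNIV. \<Sum>l\<in>UNIV. wirt (-1) k (wirt 1 l \<phi>) x * wedge1 (?e k) (wedge1 (?eb l) P) vs)"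
      unfolding sum_negf[symmetric]
    proof (intro sum.cong refl)
      fix k l
      show "wirt 1 l (wirt (-1) k \<phi>) x * wedge1 (?eb l) (wedge1 (?e k) P) vs
        = - (wirt (-1) k (wirt 1 l \<phi>) x * wedge1 (?e k) (wedge1 (?eb l) P) vs)"
        using wirt_commute[OF assms, of 1 l "-1" k x] wedge1_anticommute[of "?eb l" "?e k" P vs] by simp
    qed
    also have "(\<Sum>k\<in>UNIV. \<Sum>l\<in>UNIV. wirt (-1) l (wirt 1 k \<phi>) x * wedge1 (?e l) (wedge1 (?eb k) P) vs)
      = (\<Sum>k\<in>UNIV. \<Sum>l\<in>UNIV. wirt (-1) k (wirt 1 l \<phi>) x * wedge1 (?e k) (wedge1 (?eb l) P) vs)"
      by (rule sum.swap)
    finally have "ext_d (ext_dc (fform \<phi> P)) x vs =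
      2 * c * (\<Sum>k\<in>UNIV. \<Sum>l\<in>UNIV. wirt (-1) k (wirt 1 l \<phi>) x * wedge1 (?e k) (wedge1 (?eb l) P) vs)"
      by simp
    moreover have "(\<Sum>l\<in>UNIV. \<Sum>k\<in>UNIV. wirt (-1) l (wirt 1 k \<phi>) x * wedge11 (coord l) (coord k) P vs)
      = \<i> * (\<Sum>k\<in>UNIV. \<Sum>l\<in>UNIV. wirt (-1) k (wirt 1 l \<phi>) x * wedge1 (?e k) (wedge1 (?eb l) P) vs)"
      by (simp add: wedge11_def sum_distrib_left mult_ac)
    ultimately show ?thesis
      by (simp add: c_def)
  qed
  thus ?thesis by (intro ext)
qed

subsection \<open>Flat functions and smooth steps\<close>

text \<open>The family is closed under differentiation, which yields the smoothness of \<open>exp (-1/x)\<close>.\<close>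

definition flat :: "nat \<Rightarrow> real \<Rightarrow> real" where
  "flat k x = (if x > 0 then exp (- 1 / x) / x ^ k else 0)"

lemma flat_nonneg: "flat k x \<ge> 0"
  by (simp add: flat_def)

lemma flat_nonpos_arg: "x \<le> 0 \<Longrightarrow> flat k x = 0"
  by (simp add: flat_def)

lemma flat_pos: "x > 0 \<Longrightarrow> flat k x > 0"
  by (simp add: flat_def)

lemma tendsto_flat_at_right_0: "(flat k \<longlongrightarrow> 0) (at_right 0)"
proof -
  have "((\<lambda>x. inverse x ^ k / exp (inverse x)) \<longlongrightarrow> (0::real)) (at_right 0)"
    by (rule filterlim_compose[OF tendsto_power_div_exp_0 filterlim_inverse_at_top_right])
  moreover have "eventually (\<lambda>x. inverse x ^ k / exp (inverse x) = flat k x) (at_right 0)"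
    by (rule eventually_at_right_less[THEN eventually_mono])
       (simp add: flat_def exp_minus field_simps)
  ultimately show ?thesis by (rule Lim_transform_eventually)
qed

lemma DERIV_flat: "(flat k has_real_derivative flat (k + 2) x - real k * flat (k + 1) x) (at x)"
proof -
  consider "x > 0" | "x < 0" | "x = 0" by linarith
  thus ?thesis
  proof cases
    case 1
    have "((\<lambda>x. exp (- 1 / x) / x ^ k) has_real_derivative flat (k + 2) x - real k * flat (k + 1) x) (at x)"
    proof (cases k)
      case 0
      show ?thesis unfolding 0 using 1
        by (auto intro!: derivative_eq_intros simp: flat_def power2_eq_square)
    next
      case (Suc n)
      have "((\<lambda>x. exp (- 1 / x) / x ^ k) has_real_derivative
        ((exp (- 1 / x) * (1 / (x * x))) * x ^ k - exp (- 1 / x) * (real k * x ^ n)) / (x ^ k * x ^ k)) (at x)"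
        using 1 by (auto intro!: derivative_eq_intros simp: Suc) (cases n; simp add: algebra_simps)
      also have "((exp (- 1 / x) * (1 / (x * x))) * x ^ k - exp (- 1 / x) * (real k * x ^ n)) / (x ^ k * x ^ k)
        = flat (k + 2) x - real k * flat (k + 1) x"
        using 1 by (simp add: flat_def Suc field_simps)
      finally show ?thesis .
    qed
    moreover have "eventually (\<lambda>y. exp (- 1 / y) / y ^ k = flat k y) (nhds x)"
      using eventually_nhds_in_open[of "{0<..}" x] 1 by (auto elim!: eventually_mono simp: flat_def)
    ultimately show ?thesis by (subst DERIV_cong_ev[OF refl _ refl, symmetric])
  next
    case 2
    have "eventually (\<lambda>y. 0 = flat k y) (nhds x)"
      using eventually_nhds_in_open[of "{..<0}" x] 2 by (auto elim!: eventually_mono simp: flat_def)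
    hence "((\<lambda>_. 0) has_real_derivative 0) (at x) = (flat k has_real_derivative 0) (at x)"
      by (rule DERIV_cong_ev[OF refl _ refl])
    hence "(flat k has_real_derivative 0) (at x)" by simp
    thus ?thesis using 2 by (simp add: flat_def)
  next
    case 3
    \<comment> \<open>To the right of 0 the difference quotient is \<open>flat (k + 1)\<close>,
      another member of the family.\<close>
    have "((\<lambda>h. flat k h / h) \<longlongrightarrow> 0) (at_right 0)"
      using tendsto_flat_at_right_0[of "k + 1"]
      by (rule Lim_transform_eventually)
         (rule eventually_at_right_less[THEN eventually_mono], simp add: flat_def)
    moreover have "((\<lambda>h. flat k h / h) \<longlongrightarrow> 0) (at_left 0)"
      by (rule Lim_transform_eventually[OF tendsto_const])
         (rule eventually_at_left_real[of "-1" 0, THEN eventually_mono], auto simp: flat_def)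
    ultimately have "((\<lambda>h. flat k h / h) \<longlongrightarrow> 0) (at 0)"
      by (simp add: filterlim_split_at)
    thus ?thesis unfolding 3 DERIV_def by (simp add: flat_def)
  qed
qed

abbreviation smooth_real :: "('a::real_normed_vector \<Rightarrow> real) \<Rightarrow> bool" where
  "smooth_real f \<equiv> smooth (\<lambda>x. complex_of_real (f x))"

lemma dir_deriv_of_real:
  assumes "(h has_real_derivative d) (at x)"
  shows "dir_deriv u (\<lambda>x. complex_of_real (h x)) x = of_real (u * d)"
  by (rule dir_deriv_eqI[where f' = "\<lambda>u. of_real (u * d)"], rule has_derivative_of_real)
     (use assms in \<open>simp add: has_field_derivative_def mult_commute_abs\<close>)

text \<open>Induction on the order, for all members of the family at once: a derivative leads back
  to a finite combination of members.\<close>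

lemma smooth_realI:
  fixes h :: "nat \<Rightarrow> real \<Rightarrow> real"
  assumes "\<And>k x. (h k has_real_derivative (\<Sum>i\<le>N k. c k i * h i x)) (at x)"
  shows "smooth_real (h k)"
proof -
  have "smooth_upto n (\<lambda>x. complex_of_real (h k x))" for n k
  proof (induction n arbitrary: k)
    case 0
    show ?case using has_derivative_of_real[OF assms[of k, unfolded has_field_derivative_def]] differentiableI
      by fastforce
  next
    case (Suc n)
    have "smooth_upto n (\<lambda>x. \<Sum>i\<in>I. complex_of_real (u * c k i) * complex_of_real (h i x))" for I :: "nat set" and u
      by (induction I rule: infinite_finite_induct)
         (auto intro!: smooth_upto_add smooth_upto_mult smooth_upto_const Suc)
    moreover have "dir_deriv u (\<lambda>x. complex_of_real (h k x)) =
        (\<lambda>x. \<Sum>i\<le>N k. complex_of_real (u * c k i) * complex_of_real (h i x))" for u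
      by (rule ext) (subst dir_deriv_of_real[OF assms], simp add: sum_distrib_left mult.assoc)
    moreover have "(\<lambda>x. complex_of_real (h k x)) differentiable at x" for x
      using Suc.IH[of k] smooth_upto_differentiable by blast
    ultimately show ?case by simp
  qed
  thus ?thesis by (simp add: smooth_iff_upto)
qed

lemma smooth_real_flat: "smooth_real (flat k)"
proof (rule smooth_realI[where N = "\<lambda>k. k + 2" and c = "\<lambda>k i. if i = k + 2 then 1 else if i = k + 1 then - real k else 0"])
  fix k x
  have "(\<Sum>i\<le>k + 2. (if i = k + 2 then 1 else if i = k + 1 then - real k else 0) * flat i x)
    = flat (k + 2) x - real k * flat (k + 1) x"
    by (simp add: sum.atMost_Suc)
  thus "(flat k has_real_derivative (\<Sum>i\<le>k + 2. (if i = k + 2 then 1 else if i = k + 1 then - real k else 0) * flat i x)) (at x)"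
    using DERIV_flat[of k x] by simp
qed

lemma smooth_real_const: "smooth_real (\<lambda>x. c)"
  and smooth_real_add: "smooth_real f \<Longrightarrow> smooth_real g \<Longrightarrow> smooth_real (\<lambda>x. f x + g x)"
  and smooth_real_diff: "smooth_real f \<Longrightarrow> smooth_real g \<Longrightarrow> smooth_real (\<lambda>x. f x - g x)"
  and smooth_real_mult: "smooth_real f \<Longrightarrow> smooth_real g \<Longrightarrow> smooth_real (\<lambda>x. f x * g x)"
  and smooth_real_inverse: "smooth_real f \<Longrightarrow> (\<And>x. f x \<noteq> 0) \<Longrightarrow> smooth_real (\<lambda>x. inverse (f x))"
  by (simp_all add: smooth_const smooth_add smooth_diff smooth_mult smooth_inverse)

lemma smooth_real_ident: "smooth_real (\<lambda>x::real. x)"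
  by (rule smooth_bounded_linear[OF bounded_linear_of_real])

lemma smooth_real_compose: "smooth_real h \<Longrightarrow> smooth_real f \<Longrightarrow> smooth_real (\<lambda>x. h (f x))"
  by (rule smooth_compose_real)

lemma smooth_real_power: "smooth_real f \<Longrightarrow> smooth_real (\<lambda>x. f x ^ n)"
  by (simp add: smooth_power)

definition real_deriv :: "(real \<Rightarrow> real) \<Rightarrow> real \<Rightarrow> real" where
  "real_deriv h x = Re (dir_deriv 1 (\<lambda>x. complex_of_real (h x)) x)"

lemma DERIV_real_deriv:
  assumes "smooth_real h"
  shows "(h has_real_derivative real_deriv h x) (at x)"
proof -
  let ?h = "\<lambda>x. complex_of_real (h x)"
  have d: "(?h has_derivative (\<lambda>u. dir_deriv u ?h x)) (at x)"
    by (rule has_derivative_dir_deriv[OF smooth_differentiable[OF assms]])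
  have lin: "dir_deriv u ?h x = u *\<^sub>R dir_deriv 1 ?h x" for u
    using linear_scale[OF has_derivative_linear[OF d], of u 1] by simp
  have "(\<lambda>u. Re (dir_deriv u ?h x)) = (*) (real_deriv h x)"
    by (rule ext, subst lin) (simp add: real_deriv_def)
  thus ?thesis using has_derivative_Re[OF d] by (simp add: has_field_derivative_def)
qed

lemma dir_deriv_real_deriv:
  assumes "smooth_real h"
  shows "dir_deriv 1 (\<lambda>x. complex_of_real (h x)) x = of_real (real_deriv h x)"
  using dir_deriv_of_real[OF DERIV_real_deriv[OF assms], of 1] by simp

lemma smooth_real_deriv: "smooth_real h \<Longrightarrow> smooth_real (real_deriv h)"
proof -
  assume h: "smooth_real h"
  have "dir_deriv 1 (\<lambda>x. complex_of_real (h x)) = (\<lambda>x. of_real (real_deriv h x))"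
    by (rule ext) (rule dir_deriv_real_deriv[OF h])
  thus ?thesis using smooth_dir_deriv[OF h, of 1] by simp
qed

lemma smooth_continuous: "smooth f \<Longrightarrow> continuous_on A f"
  by (intro continuous_at_imp_continuous_on ballI differentiable_imp_continuous_within smooth_differentiable)

lemma smooth_real_continuous:
  assumes "smooth_real f"
  shows "continuous_on A f"
  using continuous_on_Re[OF smooth_continuous[OF assms, of A]] by simp

lemma real_deriv_eqI:
  "smooth_real h \<Longrightarrow> (h has_real_derivative d) (at x) \<Longrightarrow> real_deriv h x = d"
  using DERIV_unique DERIV_real_deriv by blast

text \<open>The transition lies between 1 and 4 because the argument will be a squared distance over
  a squared radius, so that it takes place between one and two radii.\<close>

definition step :: "real \<Rightarrow> real" where
  "step s = flat 0 (s - 1) * inverse (flat 0 (s - 1) + flat 0 (4 - s))"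

lemma step_denominator_pos: "flat 0 (s - 1) + flat 0 (4 - s) > 0"
proof (cases "s > 1")
  case True thus ?thesis using flat_pos[of "s - 1" 0] flat_nonneg[of 0 "4 - s"] by linarith
next
  case False thus ?thesis using flat_pos[of "4 - s" 0] flat_nonneg[of 0 "s - 1"] by linarith
qed

lemma smooth_real_step: "smooth_real step"
  unfolding step_def[abs_def]
proof (intro smooth_real_mult smooth_real_inverse smooth_real_add)
  show "smooth_real (\<lambda>x. flat 0 (x - 1))" "smooth_real (\<lambda>x. flat 0 (x - 1))" "smooth_real (\<lambda>x. flat 0 (4 - x))"
    by (intro smooth_real_compose[OF smooth_real_flat] smooth_real_diff smooth_real_ident smooth_real_const)+
  show "flat 0 (x - 1) + flat 0 (4 - x) \<noteq> 0" for x
    using step_denominator_pos[of x] by simp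
qed

lemma step_ge_0: "step s \<ge> 0"
  by (simp add: step_def flat_nonneg)

lemma step_le_1: "step s \<le> 1"
  using step_denominator_pos[of s] flat_nonneg[of 0 "4 - s"]
  by (simp add: step_def divide_inverse[symmetric])

lemma step_eq_0: "s \<le> 1 \<Longrightarrow> step s = 0"
  by (simp add: step_def flat_nonpos_arg)

lemma step_eq_1: "s \<ge> 4 \<Longrightarrow> step s = 1"
  using flat_pos[of "s - 1" 0] by (simp add: step_def flat_nonpos_arg[of "4 - s"])

lemma real_deriv_locally_const:
  assumes "smooth_real h" "open U" "x \<in> U" "\<And>y. y \<in> U \<Longrightarrow> h y = c"
  shows "real_deriv h x = 0"
proof (rule real_deriv_eqI[OF assms(1)])
  have "eventually (\<lambda>y. h y = c) (nhds x)"
    using eventually_nhds_in_open[OF assms(2,3)] assms(4) by (auto elim: eventually_mono)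
  thus "(h has_real_derivative 0) (at x)"
    by (subst DERIV_cong_ev[OF refl _ refl, of _ "\<lambda>_. c"]) auto
qed

lemma step_derivs_eq_0:
  assumes "s < 1 \<or> s > 4"
  shows "real_deriv step s = 0" "real_deriv (real_deriv step) s = 0"
proof -
  have 1: "real_deriv step s = 0" if "s < 1 \<or> s > 4" for s
    using that real_deriv_locally_const[OF smooth_real_step, of "{..<1}" s 0]
      real_deriv_locally_const[OF smooth_real_step, of "{4<..}" s 1]
    by (auto simp: step_eq_0 step_eq_1)
  show "real_deriv step s = 0" by (rule 1[OF assms])
  show "real_deriv (real_deriv step) s = 0"
    by (rule real_deriv_locally_const[of _ "{..<1} \<union> {4<..}"])
       (use assms 1 in \<open>auto intro: smooth_real_deriv smooth_real_step\<close>)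
qed

text \<open>With \<open>v = c |z|\<^sup>2\<close> and \<open>a = step v\<close>, the value at \<open>v\<close> is
  \<open>(5 |\<partial>a|\<^sup>2 - a \<partial>\<bar>\<partial>a) / c\<close>.\<close>

definition step_defect :: "real \<Rightarrow> real" where
  "step_defect v = 5 * (real_deriv step v)\<^sup>2 * v - step v * (real_deriv (real_deriv step) v * v + real_deriv step v)"

lemma step_defect_eq_0: "s < 1 \<or> s > 4 \<Longrightarrow> step_defect s = 0"
  unfolding step_defect_def by (simp add: step_derivs_eq_0)

text \<open>Continuous on \<open>{1..4}\<close> and zero elsewhere. An upper bound is enough, since
  the defect is only multiplied by nonnegative weights.\<close>

lemma step_defect_bounded: "\<exists>M>0. \<forall>v. step_defect v \<le> M"
proof -
  have "continuous_on {1..4} step_defect"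
    unfolding step_defect_def[abs_def]
    by (intro continuous_intros smooth_real_continuous smooth_real_deriv smooth_real_step)
  hence "compact (step_defect ` {1..4})"
    by (rule compact_continuous_image) simp
  then obtain M where M: "\<And>v. v \<in> {1..4} \<Longrightarrow> \<bar>step_defect v\<bar> \<le> M"
    using compact_imp_bounded bounded_iff by (metis imageI real_norm_def)
  have "step_defect v \<le> max M 1" for v
    using M[of v] step_defect_eq_0[of v] by (cases "v \<in> {1..4}") force+
  moreover have "max M 1 > 0" by simp
  ultimately show ?thesis by blast
qed

text \<open>The extra factor \<open>x\<close> makes the second derivative \<open>flat 3\<close>
  nonnegative, whereas \<open>flat 0\<close> alone stops being convex at \<open>1 / 2\<close>. The
  first derivative is nonnegative as well.\<close>

definition convex_flat :: "real \<Rightarrow> real" where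
  "convex_flat x = x * flat 0 x"

lemma DERIV_convex_flat: "(convex_flat has_real_derivative flat 0 x + flat 1 x) (at x)"
proof -
  have "(convex_flat has_real_derivative 1 * flat 0 x + (flat (0 + 2) x - real 0 * flat (0 + 1) x) * x) (at x)"
    unfolding convex_flat_def[abs_def] by (intro DERIV_mult DERIV_ident DERIV_flat)
  thus ?thesis by (simp add: flat_def power2_eq_square split: if_splits)
qed

lemma DERIV_convex_flat': "((\<lambda>x. flat 0 x + flat 1 x) has_real_derivative flat 3 x) (at x)"
  using DERIV_add[OF DERIV_flat[of 0 x] DERIV_flat[of 1 x]] by (simp add: numeral_eq_Suc)

lemma smooth_real_convex_flat: "smooth_real convex_flat"
  unfolding convex_flat_def[abs_def] by (intro smooth_real_mult smooth_real_ident smooth_real_flat)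

lemma convex_flat_nonneg: "convex_flat x \<ge> 0"
  by (simp add: convex_flat_def flat_def)

lemma convex_flat_eq_0: "x \<le> 0 \<Longrightarrow> convex_flat x = 0"
  by (simp add: convex_flat_def flat_def)

lemma flat_0_le_1: "flat 0 x \<le> 1"
  by (simp add: flat_def)

lemma convex_flat_le: "x \<ge> 0 \<Longrightarrow> convex_flat x \<le> x"
  unfolding convex_flat_def by (rule mult_left_le) (simp_all add: flat_0_le_1)

subsection \<open>Cutoff functions on polydiscs\<close>

definition polydisc :: "('n + 'm \<Rightarrow> complex) \<Rightarrow> ('n + 'm \<Rightarrow> real) \<Rightarrow> ('n::finite, 'm::finite) cspace set" where
  "polydisc c \<rho> = {x. \<forall>k. cmod (coord k x - c k) \<le> \<rho> k}"

text \<open>A product over \<open>K\<close>, so that it is constant in all other coordinates; its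
  transition in coordinate \<open>k\<close> runs from \<open>\<rho> k\<close> to
  \<open>2 * \<rho> k\<close>.\<close>

definition cutoff :: "('n + 'm) set \<Rightarrow> ('n + 'm \<Rightarrow> complex) \<Rightarrow> ('n + 'm \<Rightarrow> real) \<Rightarrow> ('n::finite, 'm::finite) cspace \<Rightarrow> real" where
  "cutoff K c \<rho> x = (\<Prod>k\<in>K. 1 - step ((cmod (coord k x - c k))\<^sup>2 / (\<rho> k)\<^sup>2))"

lemma norm_le_sum_coord: "norm x \<le> (\<Sum>k\<in>UNIV. cmod (coord k x))"
proof -
  have "norm x \<le> norm (fst x) + norm (snd x)"
    using norm_Pair_le[of "fst x" "snd x"] by simp
  also have "\<dots> \<le> (\<Sum>i\<in>UNIV. cmod (fst x $ i)) + (\<Sum>i\<in>UNIV. cmod (snd x $ i))"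
    by (intro add_mono; simp add: norm_vec_def L2_set_le_sum)
  also have "\<dots> = (\<Sum>k\<in>UNIV. cmod (coord k x))"
    by (simp add: UNIV_Plus_UNIV[symmetric] sum.Plus coord_def del: UNIV_Plus_UNIV)
  finally show ?thesis .
qed

lemma compact_polydisc: "compact (polydisc c \<rho>)"
proof -
  have "closed (polydisc c \<rho>)"
  proof -
    have "closed {x. cmod (coord k x - c k) \<le> \<rho> k}" for k
      by (intro closed_Collect_le continuous_intros linear_continuous_on bounded_linear_coord)
    moreover have "polydisc c \<rho> = (\<Inter>k. {x. cmod (coord k x - c k) \<le> \<rho> k})"
      by (auto simp: polydisc_def)
    ultimately show ?thesis by auto
  qed
  moreover have "norm x \<le> (\<Sum>k\<in>UNIV. \<rho> k + cmod (c k))" if "x \<in> polydisc c \<rho>" for x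
  proof -
    have "cmod (coord k x) \<le> \<rho> k + cmod (c k)" for k
      using that norm_triangle_ineq[of "coord k x - c k" "c k"] by (auto simp: polydisc_def intro: order_trans)
    thus ?thesis using norm_le_sum_coord[of x] by (meson order_trans sum_mono)
  qed
  ultimately show ?thesis unfolding compact_eq_bounded_closed bounded_iff by blast
qed

lemma smooth_coord_diff: "smooth (\<lambda>x. coord k x - c)"
  by (intro smooth_diff smooth_coord smooth_const)

lemma smooth_real_norm_power2:
  assumes "smooth f"
  shows "smooth_real (\<lambda>x. (cmod (f x))\<^sup>2)"
  using smooth_mult[OF assms smooth_cnj[OF assms]] by (simp only: complex_norm_square)

lemma smooth_real_cutoff: "smooth_real (cutoff K c \<rho>)"
proof -
  have "smooth_real (\<lambda>x. 1 - step ((cmod (coord k x - c k))\<^sup>2 / (\<rho> k)\<^sup>2))" for k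
    unfolding divide_inverse
    by (intro smooth_real_diff smooth_real_const smooth_real_compose[OF smooth_real_step]
        smooth_real_mult smooth_real_norm_power2 smooth_coord_diff)
  from smooth_prod[OF this] show ?thesis by (simp add: cutoff_def)
qed

lemma cutoff_nonneg: "0 \<le> cutoff K c \<rho> x"
  unfolding cutoff_def by (rule prod_nonneg) (simp add: step_le_1)

lemma cutoff_le_1: "cutoff K c \<rho> x \<le> 1"
  unfolding cutoff_def by (rule prod_le_1) (simp add: step_le_1 step_ge_0)

lemma cutoff_eq_1:
  assumes "\<And>k. k \<in> K \<Longrightarrow> cmod (coord k x - c k) \<le> \<rho> k"
  shows "cutoff K c \<rho> x = 1"
  unfolding cutoff_def
proof (rule prod.neutral, intro ballI)
  fix k assume k: "k \<in> K"
  have "(cmod (coord k x - c k))\<^sup>2 / (\<rho> k)\<^sup>2 \<le> 1"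
    using power_mono[OF assms[OF k] norm_ge_zero, of 2] by (simp add: divide_le_eq_1)
  thus "1 - step ((cmod (coord k x - c k))\<^sup>2 / (\<rho> k)\<^sup>2) = 1" by (simp add: step_eq_0)
qed

lemma cutoff_neq_0D:
  assumes "cutoff K c \<rho> x \<noteq> 0" "k \<in> K" "\<rho> k > 0"
  shows "cmod (coord k x - c k) \<le> 2 * \<rho> k"
proof (rule ccontr)
  assume "\<not> cmod (coord k x - c k) \<le> 2 * \<rho> k"
  hence "(2 * \<rho> k)\<^sup>2 \<le> (cmod (coord k x - c k))\<^sup>2" using assms(3) by (intro power_mono) auto
  hence "(cmod (coord k x - c k))\<^sup>2 / (\<rho> k)\<^sup>2 \<ge> 4" using assms(3) by (simp add: pos_le_divide_eq power_mult_distrib)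
  hence "1 - step ((cmod (coord k x - c k))\<^sup>2 / (\<rho> k)\<^sup>2) = 0" by (simp add: step_eq_1)
  hence "cutoff K c \<rho> x = 0" unfolding cutoff_def using assms(2) by (intro prod_zero) auto
  thus False using assms(1) by simp
qed

lemma cutoff_neq_0_polydisc:
  "cutoff UNIV c \<rho> x \<noteq> 0 \<Longrightarrow> (\<And>k. \<rho> k > 0) \<Longrightarrow> x \<in> polydisc c (\<lambda>k. 2 * \<rho> k)"
  unfolding polydisc_def using cutoff_neq_0D by blast

lemma test_function_cutoff: "(\<And>k. \<rho> k > 0) \<Longrightarrow> test_function (\<lambda>x. complex_of_real (cutoff UNIV c \<rho> x))"
  unfolding test_function_def
  using smooth_real_cutoff compact_polydisc cutoff_neq_0_polydisc by (metis of_real_0)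

subsection \<open>Positive currents of bidegree (1,1) as functionals on coefficients\<close>

lemma test_function_smooth: "test_function f \<Longrightarrow> smooth f"
  by (simp add: test_function_def)

lemma test_function_mult:
  "test_function f \<Longrightarrow> smooth g \<Longrightarrow> test_function (\<lambda>x. f x * g x)"
  "test_function f \<Longrightarrow> smooth g \<Longrightarrow> test_function (\<lambda>x. g x * f x)"
  unfolding test_function_def using smooth_mult by (metis mult_zero_left, metis mult_zero_right)

lemma test_function_zero: "test_function (\<lambda>x. 0)"
  unfolding test_function_def using smooth_const compact_empty by blast

lemma test_function_add:
  assumes "test_function f" "test_function g"
  shows "test_function (\<lambda>x. f x + g x)"
proof -
  obtain K L where "compact K" "\<And>x. x \<notin> K \<Longrightarrow> f x = 0" "compact L" "\<And>x. x \<notin> L \<Longrightarrow> g x = 0"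
    using assms unfolding test_function_def by blast
  hence "compact (K \<union> L)" "\<forall>x. x \<notin> K \<union> L \<longrightarrow> f x + g x = 0" by auto
  thus ?thesis using assms smooth_add unfolding test_function_def by blast
qed

lemma dir_deriv_outside:
  assumes "closed K" "\<And>x. x \<notin> K \<Longrightarrow> f x = 0" "x \<notin> K"
  shows "dir_deriv u f x = 0"
proof -
  have "(f has_derivative (\<lambda>_. 0)) (at x)"
    using has_derivative_transform_within_open[of "\<lambda>_. 0" "\<lambda>_. 0" x UNIV "- K" f] assms by auto
  thus ?thesis by (rule dir_deriv_eqI)
qed

lemma test_function_dir_deriv:
  assumes "test_function f"
  shows "test_function (dir_deriv u f)"
proof -
  obtain K where K: "compact K" "\<And>x. x \<notin> K \<Longrightarrow> f x = 0"
    using assms unfolding test_function_def by blast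
  have "dir_deriv u f x = 0" if "x \<notin> K" for x
    by (rule dir_deriv_outside[OF compact_imp_closed[OF K(1)] K(2) that])
  thus ?thesis using K(1) assms smooth_dir_deriv unfolding test_function_def by blast
qed

lemma test_function_wirt:
  assumes "test_function f"
  shows "test_function (wirt s k f)"
proof -
  have "test_function (\<lambda>x. (1 / 2) * (dir_deriv (basis_vec k) f x + (of_real s * \<i>) * dir_deriv (cscale \<i> (basis_vec k)) f x))"
    by (intro test_function_mult(2) test_function_add test_function_dir_deriv assms smooth_const)
  moreover have "wirt s k f = (\<lambda>x. (1 / 2) * (dir_deriv (basis_vec k) f x + (of_real s * \<i>) * dir_deriv (cscale \<i> (basis_vec k)) f x))"
    by (rule ext) (simp add: wirt_def)
  ultimately show ?thesis by simp
qed

lemma test_form_fform: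
  assumes "test_function f" "bidegree p q P"
  shows "test_form p q (fform f P)"
  unfolding test_form_def fform_def supported_in_def
proof (intro conjI allI)
  show "bidegree p q (\<lambda>vs. f x * P vs)" for x by (rule bidegree.scale[OF assms(2)])
  show "smooth (\<lambda>x. f x * P vs)" for vs
    using assms(1) by (intro smooth_mult smooth_const) (rule test_function_smooth)
  show "\<exists>K. compact K \<and> (\<forall>x vs. x \<notin> K \<longrightarrow> f x * P vs = 0)"
    using assms(1) unfolding test_function_def by auto
qed

lemma test_form_add:
  assumes "test_form p q \<phi>" "test_form p q \<psi>"
  shows "test_form p q (form_add \<phi> \<psi>)"
proof -
  obtain K L where "compact K" "supported_in \<phi> K" "compact L" "supported_in \<psi> L"
    using assms unfolding test_form_def by blast
  hence "compact (K \<union> L)" "supported_in (form_add \<phi> \<psi>) (K \<union> L)"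
    by (auto simp: supported_in_def form_add_def)
  moreover have "bidegree p q (form_add \<phi> \<psi> x)" for x
    using bidegree.add assms unfolding test_form_def form_add_def[abs_def] by blast
  moreover have "smooth (\<lambda>x. form_add \<phi> \<psi> x vs)" for vs
    using smooth_add assms unfolding test_form_def form_add_def[abs_def] by blast
  ultimately show ?thesis unfolding test_form_def by blast
qed

lemma test_form_lincomb:
  assumes "\<And>a. a \<in> A \<Longrightarrow> test_function (f a)" "\<And>a. a \<in> A \<Longrightarrow> bidegree p q (P a)"
  shows "test_form p q (\<lambda>x vs. \<Sum>a\<in>A. f a x * P a vs)"
  using assms
proof (induction A rule: infinite_finite_induct)
  case (insert a A)
  have "(\<lambda>x vs. \<Sum>b\<in>insert a A. f b x * P b vs) = form_add (fform (f a) (P a)) (\<lambda>x vs. \<Sum>b\<in>A. f b x * P b vs)"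
    using insert.hyps by (simp add: form_add_def fform_def fun_eq_iff)
  thus ?case using insert by (simp add: test_form_add test_form_fform)
qed (auto simp: test_form_def supported_in_def intro: bidegree.zero smooth_const compact_empty)

text \<open>A repeated covector kills the product. Wedged with the product over
  \<open>- {j, l}\<close>, a Hessian therefore keeps only the entries with both indices in
  \<open>{j, l}\<close>.\<close>

lemma wedge11_Pi_form_mem:
  assumes "a \<in> J \<or> b \<in> J"
  shows "wedge11 (coord a) (coord b) (Pi_form J) = (\<lambda>vs. 0)"
proof -
  have same: "wedge1 l (wedge1 l b) = (\<lambda>vs. 0)" for l and b :: "('a, 'b) covector"
    by (rule ext) (rule wedge1_same)
  have anti: "wedge1 l (wedge1 m b) = (\<lambda>vs. - wedge1 m (wedge1 l b) vs)" for l m and b :: "('a, 'b) covector"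
    by (rule ext) (rule wedge1_anticommute)
  have ann: "wedge1 (coord k) (Pi_form J) = (\<lambda>vs. 0)" "wedge1 (\<lambda>v. cnj (coord k v)) (Pi_form J) = (\<lambda>vs. 0)" if "k \<in> J" for k
  proof -
    have P: "Pi_form J = wedge11 (coord k) (coord k) (Pi_form (J - {k}))"
      using Pi_form_insert[of k "J - {k}"] that by (simp add: insert_absorb)
    show "wedge1 (coord k) (Pi_form J) = (\<lambda>vs. 0)"
      unfolding P wedge11_def wedge1_scale same by simp
    show "wedge1 (\<lambda>v. cnj (coord k v)) (Pi_form J) = (\<lambda>vs. 0)"
      unfolding P wedge11_def wedge1_scale by (subst anti) (simp add: same wedge1_zero)
  qed
  show ?thesis
  proof (cases "b \<in> J")
    case True
    thus ?thesis by (simp add: wedge11_def ann wedge1_zero)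
  next
    case False
    hence "a \<in> J" using assms by simp
    thus ?thesis unfolding wedge11_def by (subst anti) (simp add: ann wedge1_zero)
  qed
qed

lemma cnj_covector1: "cnj (covector1 l vs) = covector1 (\<lambda>v. cnj (l v)) vs"
  by (simp add: covector1_def split: list.split)

lemma positive_wedge_step:
  assumes "\<And>vs. \<alpha> x vs = (\<Sum>p\<in>A. c p * covector1 (coord p) vs)"
  shows "(form_scale \<i> \<alpha> \<and>\<^sub>F form_cnj \<alpha> \<and>\<^sub>F \<omega>) x =
    (\<lambda>vs. \<Sum>p\<in>A. \<Sum>q\<in>A. c p * cnj (c q) * wedge11 (coord p) (coord q) (\<omega> x) vs)"
proof -
  have 1: "form_scale \<i> \<alpha> x = (\<lambda>vs. \<Sum>p\<in>A. (\<i> * c p) * covector1 (coord p) vs)"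
    using assms by (simp add: form_scale_def fun_eq_iff sum_distrib_left mult.assoc)
  have 2: "form_cnj \<alpha> x = (\<lambda>vs. \<Sum>q\<in>A. cnj (c q) * covector1 (\<lambda>v. cnj (coord q v)) vs)"
    using assms by (simp add: form_cnj_def fun_eq_iff cnj_covector1)
  show ?thesis
    unfolding wedge_def 1 2 cwedge_sum_left cwedge_scale_left cwedge_sum_right cwedge_scale_right
    by (simp add: wedge11_def wedge1_def sum_distrib_left mult_ac)
qed

lemma foldr_positive_wedge:
  "foldr (\<lambda>\<alpha> \<omega>. form_scale \<i> \<alpha> \<and>\<^sub>F form_cnj \<alpha> \<and>\<^sub>F \<omega>)
     (map (\<lambda>k. fform \<eta> (covector1 (coord k))) ks) unit_form x
   = (\<lambda>vs. (\<eta> x * cnj (\<eta> x)) ^ length ks * foldr (\<lambda>k. wedge11 (coord k) (coord k)) ks unit_covector vs)"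
proof (induction ks)
  case Nil
  show ?case by (simp add: unit_form_def form0_def[abs_def])
next
  case (Cons k ks)
  have "fform \<eta> (covector1 (coord k)) x vs = (\<Sum>p\<in>{k}. \<eta> x * covector1 (coord p) vs)" for vs
    by (simp add: fform_def)
  from positive_wedge_step[where \<alpha> = "fform \<eta> (covector1 (coord k))" and A = "{k}" and c = "\<lambda>_. \<eta> x", OF this] show ?case
    by (simp add: Cons wedge11_scale mult_ac)
qed

lemma form0_wedge: "form0 f \<and>\<^sub>F \<omega> = (\<lambda>x vs. f x * \<omega> x vs)"
proof (intro ext)
  fix x vs
  have "form0 f x = (\<lambda>vs. f x * unit_covector vs)" by (simp add: form0_def[abs_def])
  thus "(form0 f \<and>\<^sub>F \<omega>) x vs = f x * \<omega> x vs"
    by (simp add: wedge_def cwedge_scale_left cwedge_unit_left)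
qed

lemma bidegree_covector1: "complex_linear l \<Longrightarrow> bidegree 1 0 (covector1 l)"
proof -
  assume "complex_linear l"
  hence "bidegree (Suc 0) 0 (cwedge (covector1 l) unit_covector)" by (intro bidegree.intros)
  moreover have "cwedge (covector1 l) unit_covector = covector1 l"
    by (rule ext) (rule cwedge_unit_right)
  ultimately show ?thesis by simp
qed

lemma card_UNIV_plus: "card (UNIV :: ('n::finite + 'm::finite) set) = CARD('n) + CARD('m)"
  by (simp add: UNIV_Plus_UNIV[symmetric] card_Plus del: UNIV_Plus_UNIV)

section \<open>Coefficients of a current for a pair of coordinates\<close>

locale current11 =
  fixes T :: "('n::finite, 'm::finite) functional"
  assumes current: "current 1 1 T"
begin

lemmas T_add = current[unfolded current_def Let_def, THEN conjunct2, THEN conjunct2, THEN conjunct1, rule_format]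

lemmas T_scale = current[unfolded current_def Let_def, THEN conjunct2, THEN conjunct2, THEN conjunct2,
  THEN conjunct1, rule_format]

lemma T_lincomb:
  assumes "\<And>a. a \<in> A \<Longrightarrow> test_function (f a)" "\<And>a. a \<in> A \<Longrightarrow> bidegree (CARD('n) + CARD('m) - 1) (CARD('n) + CARD('m) - 1) (P a)" "finite A"
  shows "T (\<lambda>x vs. \<Sum>a\<in>A. f a x * P a vs) = (\<Sum>a\<in>A. T (fform (f a) (P a)))"
  using assms(3,1,2)
proof (induction A rule: finite_induct)
  case empty
  have z: "test_form (CARD('n) + CARD('m) - 1) (CARD('n) + CARD('m) - 1) (fform (\<lambda>_. 0) (\<lambda>_. 0))"
    by (intro test_form_fform test_function_zero bidegree.zero)
  have "form_scale 0 (fform (\<lambda>_. 0) (\<lambda>_. 0) :: ('n, 'm) form) = (\<lambda>x vs. 0)" by (simp add: form_scale_def fun_eq_iff)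
  thus ?case using T_scale[OF z, of 0] by simp
next
  case (insert a A)
  have "(\<lambda>x vs. \<Sum>b\<in>insert a A. f b x * P b vs) = form_add (fform (f a) (P a)) (\<lambda>x vs. \<Sum>b\<in>A. f b x * P b vs)"
    using insert.hyps by (simp add: form_add_def fform_def fun_eq_iff)
  thus ?case using insert by (simp add: T_add test_form_fform test_form_lincomb)
qed

text \<open>Wedging with the (1,1)-forms of all other coordinates turns \<open>T\<close> into a 2 by
  2 matrix of functionals, indexed by \<open>p\<close> and \<open>q\<close> in
  \<open>{j, l}\<close>. The two-variable argument takes place in this matrix.\<close>

definition pair_form :: "'n + 'm \<Rightarrow> 'n + 'm \<Rightarrow> 'n + 'm \<Rightarrow> 'n + 'm \<Rightarrow> ('n, 'm) covector" where
  "pair_form j l p q = wedge11 (coord p) (coord q) (Pi_form (- {j, l}))"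

definition pair_functional :: "'n + 'm \<Rightarrow> 'n + 'm \<Rightarrow> 'n + 'm \<Rightarrow> 'n + 'm \<Rightarrow> (('n, 'm) cspace \<Rightarrow> complex) \<Rightarrow> complex" where
  "pair_functional j l p q f = T (fform f (pair_form j l p q))"

definition coefficient :: "'n + 'm \<Rightarrow> (('n, 'm) cspace \<Rightarrow> complex) \<Rightarrow> complex" where
  "coefficient i f = T (fform f (Pi_form (- {i})))"

lemma card_compl_pair: "j \<noteq> l \<Longrightarrow> card (- {j, l} :: ('n + 'm) set) = (CARD('n) + CARD('m) - 1) - 1"
  by (simp add: Compl_eq_Diff_UNIV card_Diff_subset card_UNIV_plus)

lemma codim_pos: "j \<noteq> (l :: 'n + 'm) \<Longrightarrow> (CARD('n) + CARD('m) - 1) \<ge> 1"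
proof -
  assume "j \<noteq> l"
  hence "card {j, l} = 2" by simp
  moreover have "card {j, l} \<le> card (UNIV :: ('n + 'm) set)" by (rule card_mono) auto
  ultimately show ?thesis by (simp add: card_UNIV_plus)
qed

lemma bidegree_pair_form: "j \<noteq> l \<Longrightarrow> bidegree (CARD('n) + CARD('m) - 1) (CARD('n) + CARD('m) - 1) (pair_form j l p q)"
proof -
  assume jl: "j \<noteq> l"
  have "bidegree (Suc (card (- {j, l}))) (Suc (card (- {j, l}))) (pair_form j l p q)"
    unfolding pair_form_def by (intro bidegree_wedge11 complex_linear_coord bidegree_Pi_form)
  moreover have "Suc (card (- {j, l})) = (CARD('n) + CARD('m) - 1)"
    using codim_pos[OF jl] by (simp add: card_compl_pair[OF jl])
  ultimately show ?thesis by simp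
qed

lemma bidegree_Pi_form_compl: "bidegree (CARD('n) + CARD('m) - 1) (CARD('n) + CARD('m) - 1) (Pi_form (- {i}) :: ('n, 'm) covector)"
proof -
  have "card (- {i} :: ('n + 'm) set) = (CARD('n) + CARD('m) - 1)"
    by (simp add: Compl_eq_Diff_UNIV card_Diff_subset card_UNIV_plus)
  thus ?thesis using bidegree_Pi_form[of "- {i}"] by simp
qed

lemma pair_form_diag:
  assumes "j \<noteq> l"
  shows "pair_form j l j j = Pi_form (- {l})" "pair_form j l l l = Pi_form (- {j})"
proof -
  have "insert j (- {j, l}) = - {l}" "insert l (- {j, l}) = - {j}" using assms by auto
  thus "pair_form j l j j = Pi_form (- {l})" "pair_form j l l l = Pi_form (- {j})"
    unfolding pair_form_def using Pi_form_insert[of j "- {j, l}"] Pi_form_insert[of l "- {j, l}"] by auto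
qed

text \<open>The labels cross over: the entry in direction \<open>j\<close> contains the forms of all
  coordinates but \<open>l\<close>, and a coefficient is named by its missing coordinate.\<close>

lemma pair_functional_diag:
  assumes "j \<noteq> l"
  shows "pair_functional j l j j = coefficient l" "pair_functional j l l l = coefficient j"
  by (rule ext, simp add: pair_functional_def coefficient_def pair_form_diag[OF assms])+

lemma fform_add: "fform (\<lambda>x. f x + g x) P = form_add (fform f P) (fform g P)"
  by (simp add: fform_def form_add_def fun_eq_iff algebra_simps)

lemma fform_scale: "fform (\<lambda>x. c * f x) P = form_scale c (fform f P)"
  by (simp add: fform_def form_scale_def fun_eq_iff algebra_simps)

lemma coefficient_add:
  "test_function f \<Longrightarrow> test_function g \<Longrightarrow> coefficient i (\<lambda>x. f x + g x) = coefficient i f + coefficient i g"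
  unfolding coefficient_def fform_add
  by (intro T_add test_form_fform bidegree_Pi_form_compl)

lemma coefficient_scale: "test_function f \<Longrightarrow> coefficient i (\<lambda>x. c * f x) = c * coefficient i f"
  unfolding coefficient_def fform_scale
  by (intro T_scale test_form_fform bidegree_Pi_form_compl)

lemma pair_functional_add:
  "j \<noteq> l \<Longrightarrow> test_function f \<Longrightarrow> test_function g \<Longrightarrow>
    pair_functional j l p q (\<lambda>x. f x + g x) = pair_functional j l p q f + pair_functional j l p q g"
  unfolding pair_functional_def fform_add
  by (intro T_add test_form_fform bidegree_pair_form)

lemma pair_functional_scale:
  "j \<noteq> l \<Longrightarrow> test_function f \<Longrightarrow> pair_functional j l p q (\<lambda>x. c * f x) = c * pair_functional j l p q f"
  unfolding pair_functional_def fform_scale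
  by (intro T_scale test_form_fform bidegree_pair_form)

text \<open>The test form is \<open>\<phi>\<close> times the product over \<open>- {j, l}\<close>.
  This product annihilates the derivatives of \<open>\<phi>\<close> in the remaining coordinates, on
  which \<open>\<phi>\<close> may depend freely.\<close>

lemma pair_functional_ddc:
  assumes ph: "pluriharmonic11 T" and jl: "j \<noteq> l" and \<phi>: "test_function \<phi>"
  shows "(\<Sum>p\<in>{j, l}. \<Sum>q\<in>{j, l}. pair_functional j l p q (wirt (-1) p (wirt 1 q \<phi>))) = 0"
proof -
  let ?P = "Pi_form (- {j, l}) :: ('n, 'm) covector"
  let ?w = "\<lambda>(p, q). wirt (-1) p (wirt 1 q \<phi>)" and ?Q = "\<lambda>(p, q). pair_form j l p q"
  let ?\<Omega> = "\<lambda>x vs. \<Sum>a\<in>{j, l} \<times> {j, l}. ?w a x * ?Q a vs"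
  have w: "test_function (?w a)" for a by (cases a) (simp add: test_function_wirt \<phi>)
  have Q: "bidegree (CARD('n) + CARD('m) - 1) (CARD('n) + CARD('m) - 1) (?Q a)" for a by (cases a) (simp add: bidegree_pair_form[OF jl] del: One_nat_def)
  have "test_form (CARD('n) + CARD('m) - 2) (CARD('n) + CARD('m) - 2) (fform \<phi> ?P)"
    using test_form_fform[OF \<phi> bidegree_Pi_form, of "- {j, l}"] card_compl_pair[OF jl]
    by (simp add: numeral_2_eq_2)
  hence 0: "T (ext_d (ext_dc (fform \<phi> ?P))) = 0" using ph by (simp add: pluriharmonic11_def)
  have z: "wedge11 (coord p) (coord q) ?P vs = 0" if "p \<notin> {j, l} \<or> q \<notin> {j, l}" for p q vs
    using wedge11_Pi_form_mem[of p "- {j, l}" q] that by simp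
  have "(\<Sum>p\<in>UNIV. \<Sum>q\<in>UNIV. wirt (-1) p (wirt 1 q \<phi>) x * wedge11 (coord p) (coord q) ?P vs)
    = (\<Sum>a\<in>{j, l} \<times> {j, l}. ?w a x * ?Q a vs)" for x vs
  proof -
    have "(\<Sum>p\<in>UNIV. \<Sum>q\<in>UNIV. wirt (-1) p (wirt 1 q \<phi>) x * wedge11 (coord p) (coord q) ?P vs)
      = (\<Sum>a\<in>UNIV. ?w a x * ?Q a vs)"
      unfolding sum.cartesian_product by (rule sum.cong) (auto simp: pair_form_def)
    also have "\<dots> = (\<Sum>a\<in>{j, l} \<times> {j, l}. ?w a x * ?Q a vs)"
    proof (rule sum.mono_neutral_right)
      show "\<forall>a\<in>UNIV - {j, l} \<times> {j, l}. ?w a x * ?Q a vs = 0"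
      proof
        fix a assume "a \<in> UNIV - {j, l} \<times> {j, l}"
        hence "fst a \<notin> {j, l} \<or> snd a \<notin> {j, l}" by (cases a) auto
        from z[OF this] show "?w a x * ?Q a vs = 0" by (cases a) (simp add: pair_form_def)
      qed
    qed auto
    finally show ?thesis .
  qed
  hence "ext_d (ext_dc (fform \<phi> ?P)) = form_scale (1 / (2 * of_real pi)) ?\<Omega>"
    unfolding ddc_fform[OF test_function_smooth[OF \<phi>]] by (simp add: form_scale_def fun_eq_iff)
  hence "T ?\<Omega> = 0"
    using 0 T_scale[OF test_form_lincomb[of "{j, l} \<times> {j, l}" ?w "CARD('n) + CARD('m) - 1" "CARD('n) + CARD('m) - 1" ?Q, OF w Q]] by simp
  hence "(\<Sum>a\<in>{j, l} \<times> {j, l}. T (fform (?w a) (?Q a))) = 0"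
    using T_lincomb[of "{j, l} \<times> {j, l}" ?w ?Q, OF w Q] by simp
  moreover have "(\<Sum>a\<in>{j, l} \<times> {j, l}. T (fform (?w a) (?Q a)))
    = (\<Sum>p\<in>{j, l}. \<Sum>q\<in>{j, l}. pair_functional j l p q (wirt (-1) p (wirt 1 q \<phi>)))"
    unfolding sum.cartesian_product by (rule sum.cong) (auto simp: pair_functional_def)
  ultimately show ?thesis by simp
qed

text \<open>Positivity concerns forms of compact support, so every coordinate form carries the
  factor \<open>\<eta>\<close>, and each form times its conjugate contributes one power of
  \<open>|\<eta>|^2\<close>.\<close>

lemma coefficient_represented:
  assumes pos: "positive_current11 T" and \<eta>: "test_function \<eta>"
  shows "\<exists>\<mu>. represents \<mu> (\<lambda>f. coefficient i (\<lambda>x. f x * (\<eta> x * cnj (\<eta> x)) ^ (CARD('n) + CARD('m) - 1)))"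
proof -
  obtain ks where ks: "set ks = - {i}" "distinct ks" using finite_distinct_list[of "- {i}"] by auto
  have len: "length ks = (CARD('n) + CARD('m) - 1)"
    using distinct_card[OF ks(2)] ks(1) by (simp add: Compl_eq_Diff_UNIV card_Diff_subset card_UNIV_plus)
  let ?as = "map (\<lambda>k. fform \<eta> (covector1 (coord k))) ks"
  let ?\<omega> = "foldr (\<lambda>\<alpha> \<omega>. form_scale \<i> \<alpha> \<and>\<^sub>F form_cnj \<alpha> \<and>\<^sub>F \<omega>) ?as unit_form"
  have "test_form 1 0 (fform \<eta> (covector1 (coord k)))" for k
    by (intro test_form_fform \<eta> bidegree_covector1 complex_linear_coord)
  hence "positive_measure (current_wedge T ?\<omega>)"
    by (intro pos[unfolded positive_current11_def, rule_format]) (use len in \<open>auto simp del: One_nat_def\<close>)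
  moreover have "current_wedge T ?\<omega> = (\<lambda>f. coefficient i (\<lambda>x. f x * (\<eta> x * cnj (\<eta> x)) ^ (CARD('n) + CARD('m) - 1)))"
    unfolding current_wedge_def form0_wedge coefficient_def fform_def foldr_positive_wedge[unfolded fform_def]
      foldr_wedge11_Pi_form[OF ks(2)] ks(1) len
    by (simp add: mult.assoc)
  ultimately show ?thesis unfolding positive_measure_def by simp
qed

text \<open>One of the (1,0)-forms is the combination of \<open>coord j\<close> and
  \<open>coord l\<close> with coefficients \<open>P\<close>, the others are the remaining coordinate
  forms. The cutoff \<open>\<eta>\<close> that gives them compact support equals 1 wherever
  \<open>f\<close> is nonzero and so drops out.\<close>

lemma pair_functional_nonneg:
  assumes pos: "positive_current11 T" and jl: "j \<noteq> l"
    and f: "test_function (\<lambda>x. complex_of_real (f x))" "\<And>x. f x \<ge> 0" and P: "\<And>p. smooth (P p)"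
  shows "Re (\<Sum>p\<in>{j, l}. \<Sum>q\<in>{j, l}. pair_functional j l p q (\<lambda>x. of_real (f x) * P p x * cnj (P q x))) \<ge> 0"
proof -
  obtain K where K: "compact K" "\<And>x. x \<notin> K \<Longrightarrow> f x = 0"
    using f(1) unfolding test_function_def by auto
  obtain B where B: "B > 0" "\<And>x. x \<in> K \<Longrightarrow> norm x \<le> B"
    using compact_imp_bounded[OF K(1)] bounded_pos by metis
  define \<eta> :: "('n, 'm) cspace \<Rightarrow> complex" where "\<eta> = (\<lambda>x. of_real (cutoff UNIV (\<lambda>_. 0) (\<lambda>_. B) x))"
  have \<eta>: "test_function \<eta>" unfolding \<eta>_def by (rule test_function_cutoff[OF B(1)])
  have \<eta>1: "\<eta> x = 1" if "f x \<noteq> 0" for x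
  proof -
    have "norm x \<le> B" using that K(2) B(2) by blast
    hence "cmod (coord k x - 0) \<le> B" for k using norm_coord_le[of k x] by simp
    thus ?thesis unfolding \<eta>_def by (subst cutoff_eq_1) auto
  qed
  obtain ks where ks: "set ks = - {j, l}" "distinct ks" using finite_distinct_list[of "- {j, l}"] by auto
  have len: "length ks = (CARD('n) + CARD('m) - 1) - 1"
    using distinct_card[OF ks(2)] ks(1) by (simp add: card_compl_pair[OF jl])
  define \<alpha> :: "('n, 'm) form" where "\<alpha> = (\<lambda>x vs. \<Sum>p\<in>{j, l}. (\<eta> x * P p x) * covector1 (coord p) vs)"
  let ?as = "map (\<lambda>k. fform \<eta> (covector1 (coord k))) ks"
  let ?G = "\<lambda>\<alpha> \<omega>. form_scale \<i> \<alpha> \<and>\<^sub>F form_cnj \<alpha> \<and>\<^sub>F \<omega>"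
  have "test_form 1 0 \<alpha>"
    unfolding \<alpha>_def by (intro test_form_lincomb test_function_mult P \<eta> bidegree_covector1 complex_linear_coord)
  moreover have "test_form 1 0 (fform \<eta> (covector1 (coord k)))" for k
    by (intro test_form_fform \<eta> bidegree_covector1 complex_linear_coord)
  moreover have "length (\<alpha> # ?as) = (CARD('n) + CARD('m) - 1)"
    using len codim_pos[OF jl] by simp
  ultimately have "positive_measure (current_wedge T (foldr ?G (\<alpha> # ?as) unit_form))"
    by (intro pos[unfolded positive_current11_def, rule_format]) (auto simp del: One_nat_def)
  then obtain \<mu> where \<mu>: "represents \<mu> (current_wedge T (foldr ?G (\<alpha> # ?as) unit_form))"
    unfolding positive_measure_def by blast
  have ps: "foldr ?G (\<alpha> # ?as) unit_form x = (\<lambda>vs. \<Sum>p\<in>{j, l}. \<Sum>q\<in>{j, l}.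
      \<eta> x * P p x * cnj (\<eta> x * P q x) * ((\<eta> x * cnj (\<eta> x)) ^ length ks * pair_form j l p q vs))" for x
  proof -
    have base: "foldr ?G ?as unit_form x = (\<lambda>vs. (\<eta> x * cnj (\<eta> x)) ^ length ks * Pi_form (- {j, l}) vs)"
      by (simp only: foldr_positive_wedge foldr_wedge11_Pi_form[OF ks(2)] ks(1))
    have "foldr ?G (\<alpha> # ?as) unit_form x = (form_scale \<i> \<alpha> \<and>\<^sub>F form_cnj \<alpha> \<and>\<^sub>F foldr ?G ?as unit_form) x"
      by (simp only: foldr_Cons o_apply)
    also have "\<dots> = (\<lambda>vs. \<Sum>p\<in>{j, l}. \<Sum>q\<in>{j, l}. \<eta> x * P p x * cnj (\<eta> x * P q x) *
        wedge11 (coord p) (coord q) (foldr ?G ?as unit_form x) vs)"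
      by (rule positive_wedge_step) (simp only: \<alpha>_def)
    finally show ?thesis
      by (simp only: base wedge11_scale pair_form_def)
  qed
  let ?F = "\<lambda>(p, q) x. of_real (f x) * P p x * cnj (P q x)" and ?Q = "\<lambda>(p, q). pair_form j l p q"
  have "form0 (\<lambda>x. of_real (f x)) \<and>\<^sub>F foldr ?G (\<alpha> # ?as) unit_form
     = (\<lambda>x vs. \<Sum>a\<in>{j, l} \<times> {j, l}. ?F a x * ?Q a vs)"
  proof (intro ext)
    fix x vs
    have "(\<Sum>a\<in>{j, l} \<times> {j, l}. ?F a x * ?Q a vs) = (\<Sum>p\<in>{j, l}. \<Sum>q\<in>{j, l}. ?F (p, q) x * ?Q (p, q) vs)"
      unfolding sum.cartesian_product by (rule sum.cong) auto
    also have "\<dots> = of_real (f x) * foldr ?G (\<alpha> # ?as) unit_form x vs"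
    proof (cases "f x = 0")
      case False
      thus ?thesis unfolding ps \<eta>1[OF False] by (simp add: sum_distrib_left mult.assoc)
    qed simp
    finally show "(form0 (\<lambda>x. of_real (f x)) \<and>\<^sub>F foldr ?G (\<alpha> # ?as) unit_form) x vs = (\<Sum>a\<in>{j, l} \<times> {j, l}. ?F a x * ?Q a vs)"
      by (simp only: form0_wedge)
  qed
  hence "current_wedge T (foldr ?G (\<alpha> # ?as) unit_form) (\<lambda>x. of_real (f x))
    = T (\<lambda>x vs. \<Sum>a\<in>{j, l} \<times> {j, l}. ?F a x * ?Q a vs)"
    by (simp only: current_wedge_def)
  also have "\<dots> = (\<Sum>a\<in>{j, l} \<times> {j, l}. T (fform (?F a) (?Q a)))"
  proof (rule T_lincomb)
    show "test_function (?F a)" for a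
      by (cases a) (auto intro!: test_function_mult(1) f P smooth_cnj)
    show "bidegree (CARD('n) + CARD('m) - 1) (CARD('n) + CARD('m) - 1) (?Q a)" for a by (cases a) (simp add: bidegree_pair_form[OF jl] del: One_nat_def)
  qed simp
  also have "\<dots> = (\<Sum>p\<in>{j, l}. \<Sum>q\<in>{j, l}. pair_functional j l p q (\<lambda>x. of_real (f x) * P p x * cnj (P q x)))"
    unfolding sum.cartesian_product by (rule sum.cong) (auto simp: pair_functional_def)
  also have "current_wedge T (foldr ?G (\<alpha> # ?as) unit_form) (\<lambda>x. of_real (f x)) = (LINT x|\<mu>. complex_of_real (f x))"
    using \<mu> f(1) unfolding represents_def by blast
  also have "\<dots> = of_real (LINT x|\<mu>. f x)" by simp
  finally have "Re (\<Sum>p\<in>{j, l}. \<Sum>q\<in>{j, l}. pair_functional j l p q (\<lambda>x. of_real (f x) * P p x * cnj (P q x))) = (LINT x|\<mu>. f x)"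
    by (metis Re_complex_of_real)
  thus ?thesis using f(2) by simp
qed

end

subsection \<open>The basic inequality in two variables\<close>

text \<open>The right-hand side completes squares: the first two lines are squares, and the last two vanish where
  \<open>a\<close> and \<open>b\<close> are locally constant and contain no derivative of \<open>g\<close>.\<close>

lemma ddc_product_square:
  assumes sm: "smooth h" "smooth a" "smooth b" "smooth g"
    and h: "wirt (-1) p h = (\<lambda>x. 0)" "wirt 1 q h = (\<lambda>x. 0)"
  defines "ap \<equiv> wirt (-1) p a" and "aq \<equiv> wirt 1 q a" and "apq \<equiv> wirt (-1) p (wirt 1 q a)"
    and "bp \<equiv> wirt (-1) p b" and "bq \<equiv> wirt 1 q b" and "bpq \<equiv> wirt (-1) p (wirt 1 q b)"
    and "gp \<equiv> wirt (-1) p g" and "gq \<equiv> wirt 1 q g" and "gpq \<equiv> wirt (-1) p (wirt 1 q g)"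
  shows "wirt (-1) p (wirt 1 q (\<lambda>x. (h x * h x) * ((a x * b x * g x) * (a x * b x * g x)))) =
    (\<lambda>x. 2 * (h x * (a x * b x * gp x + 2 * g x * (b x * ap x + a x * bp x)) *
               (h x * (a x * b x * gq x + 2 * g x * (b x * aq x + a x * bq x))))
       + 4 * (h x * g x * (b x * ap x - a x * bp x) * (h x * g x * (b x * aq x - a x * bq x)))
       + 2 * ((h x * a x * b x)\<^sup>2 * g x * gpq x)
       + (-2) * ((h x * g x * b x)\<^sup>2 * (5 * ap x * aq x - a x * apq x))
       + (-2) * ((h x * g x * a x)\<^sup>2 * (5 * bp x * bq x - b x * bpq x)))"
proof -
  \<comment> \<open>Origin of the 5: the two squares contribute 8 and 4 to the coefficient of
    \<open>(h g b)^2 ap aq\<close>, while the product rule gives 2, so that 10 has to be subtracted.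
    In the products of \<open>ap\<close> and \<open>bq\<close> the squares give 8 and -4, which is
    the required 4.\<close>
  have q: "wirt 1 q (\<lambda>x. (h x * h x) * ((a x * b x * g x) * (a x * b x * g x))) =
    (\<lambda>x. (h x * h x) * (2 * ((a x * b x * g x) * (a x * b x * gq x + (a x * bq x + aq x * b x) * g x))))"
    by (simp add: wirt_mult smooth_mult sm h aq_def bq_def gq_def fun_eq_iff algebra_simps)
  have smq: "smooth aq" "smooth bq" "smooth gq"
    unfolding aq_def bq_def gq_def by (intro smooth_wirt sm)+
  have apq: "wirt (-1) p aq = apq" "wirt (-1) p bq = bpq" "wirt (-1) p gq = gpq"
    unfolding apq_def bpq_def gpq_def aq_def bq_def gq_def by simp_all
  show ?thesis unfolding q
    by (simp add: wirt_mult wirt_add wirt_cmult smooth_mult smooth_add smooth_const sm smq apq h wirt_const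
        ap_def[symmetric] bp_def[symmetric] gp_def[symmetric])
       (simp add: fun_eq_iff algebra_simps power2_eq_square)
qed

text \<open>A positive semidefinite 2 by 2 matrix of functionals on all smooth functions. Compact
  support is put into \<open>L\<close> beforehand, which keeps support conditions out of the
  algebra.\<close>

locale positive_pair =
  fixes L :: "'n + 'm \<Rightarrow> 'n + 'm \<Rightarrow> (('n::finite, 'm::finite) cspace \<Rightarrow> complex) \<Rightarrow> complex"
    and j l :: "'n + 'm"
  assumes jl: "j \<noteq> l"
    and L_add: "\<And>p q f g. smooth f \<Longrightarrow> smooth g \<Longrightarrow> L p q (\<lambda>x. f x + g x) = L p q f + L p q g"
    and L_scale: "\<And>p q f c. smooth f \<Longrightarrow> L p q (\<lambda>x. c * f x) = c * L p q f"
    and L_nonneg: "\<And>f P. smooth_real f \<Longrightarrow> (\<And>x. f x \<ge> 0) \<Longrightarrow> (\<And>p. smooth (P p)) \<Longrightarrow>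
      Re (\<Sum>p\<in>{j, l}. \<Sum>q\<in>{j, l}. L p q (\<lambda>x. of_real (f x) * P p x * cnj (P q x))) \<ge> 0"
begin

definition pairing :: "('n + 'm \<Rightarrow> 'n + 'm \<Rightarrow> ('n, 'm) cspace \<Rightarrow> complex) \<Rightarrow> real" where
  "pairing F = Re (\<Sum>p\<in>{j, l}. \<Sum>q\<in>{j, l}. L p q (F p q))"

lemma pairing_add:
  assumes "\<And>p q. smooth (F p q)" "\<And>p q. smooth (G p q)"
  shows "pairing (\<lambda>p q x. F p q x + G p q x) = pairing F + pairing G"
  unfolding pairing_def by (simp add: L_add assms sum.distrib)

lemma pairing_scale:
  assumes "\<And>p q. smooth (F p q)"
  shows "pairing (\<lambda>p q x. of_real c * F p q x) = c * pairing F"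
  unfolding pairing_def by (simp add: L_scale assms sum_distrib_left[symmetric])

lemma pairing_nonneg:
  "smooth_real f \<Longrightarrow> (\<And>x. f x \<ge> 0) \<Longrightarrow> (\<And>p. smooth (P p)) \<Longrightarrow>
    pairing (\<lambda>p q x. of_real (f x) * P p x * cnj (P q x)) \<ge> 0"
  unfolding pairing_def by (rule L_nonneg)

lemma L_zero: "L p q (\<lambda>x. 0) = 0"
  using L_scale[OF smooth_const, of p q 0 0] by simp

lemma pairing_mono:
  assumes "smooth_real f" "smooth_real g" "\<And>x. f x \<le> g x" and P: "\<And>p. smooth (P p)"
  shows "pairing (\<lambda>p q x. of_real (f x) * P p x * cnj (P q x)) \<le> pairing (\<lambda>p q x. of_real (g x) * P p x * cnj (P q x))"
proof -
  have s: "smooth (\<lambda>x. of_real (h x) * P p x * cnj (P q x))" if "smooth_real h" for h p q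
    by (intro smooth_mult smooth_cnj that P)
  have d: "smooth_real (\<lambda>x. g x - f x)" by (intro smooth_real_diff assms)
  have "pairing (\<lambda>p q x. of_real (g x) * P p x * cnj (P q x)) =
    pairing (\<lambda>p q x. of_real (f x) * P p x * cnj (P q x) + of_real (g x - f x) * P p x * cnj (P q x))"
    by (simp add: algebra_simps)
  also have "\<dots> = pairing (\<lambda>p q x. of_real (f x) * P p x * cnj (P q x)) + pairing (\<lambda>p q x. of_real (g x - f x) * P p x * cnj (P q x))"
    by (rule pairing_add) (intro s assms d)+
  finally show ?thesis using pairing_nonneg[OF d, of P] assms(3) P by simp
qed

text \<open>The parallelogram identity, from which the nonnegative term with the sum
  \<open>P + Q\<close> is dropped. It will pass from bounds against two forms \<open>dw\<close> to
  one against their difference.\<close>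

lemma parallelogram:
  assumes f: "smooth_real f" "\<And>x. f x \<ge> 0" and P: "\<And>p. smooth (P p)" and Q: "\<And>p. smooth (Q p)"
  shows "pairing (\<lambda>p q x. of_real (f x) * (P p x - Q p x) * cnj (P q x - Q q x)) \<le>
    2 * pairing (\<lambda>p q x. of_real (f x) * P p x * cnj (P q x)) + 2 * pairing (\<lambda>p q x. of_real (f x) * Q p x * cnj (Q q x))"
proof -
  have s: "smooth (\<lambda>x. of_real (f x) * P p x * cnj (P q x))" if "\<And>p. smooth (P p)" for P :: "'n + 'm \<Rightarrow> ('n, 'm) cspace \<Rightarrow> complex" and p q
    by (intro smooth_mult smooth_cnj that f)
  have PQ: "smooth (\<lambda>x. P p x - Q p x)" "smooth (\<lambda>x. P p x + Q p x)" for p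
    by (intro smooth_diff smooth_add P Q)+
  let ?D = "\<lambda>p q x. of_real (f x) * (P p x - Q p x) * cnj (P q x - Q q x)"
  let ?S = "\<lambda>p q x. of_real (f x) * (P p x + Q p x) * cnj (P q x + Q q x)"
  let ?P = "\<lambda>p q x. of_real (f x) * P p x * cnj (P q x)"
  let ?Q = "\<lambda>p q x. of_real (f x) * Q p x * cnj (Q q x)"
  have "pairing ?D + pairing ?S = pairing (\<lambda>p q x. ?D p q x + ?S p q x)"
    using pairing_add[of ?D ?S] s[of "\<lambda>p x. P p x - Q p x", OF PQ(1)] s[of "\<lambda>p x. P p x + Q p x", OF PQ(2)]
    by simp
  also have "(\<lambda>p q x. ?D p q x + ?S p q x) = (\<lambda>p q x. of_real 2 * ?P p q x + of_real 2 * ?Q p q x)"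
    by (simp add: algebra_simps)
  also have "pairing \<dots> = pairing (\<lambda>p q x. of_real 2 * ?P p q x) + pairing (\<lambda>p q x. of_real 2 * ?Q p q x)"
    by (rule pairing_add) (intro smooth_mult smooth_const s P Q)+
  also have "\<dots> = 2 * pairing ?P + 2 * pairing ?Q"
    using pairing_scale[of ?P 2] pairing_scale[of ?Q 2] s[of P, OF P] s[of Q, OF Q] by simp
  finally show ?thesis
    using pairing_nonneg[of f "\<lambda>p x. P p x + Q p x", OF f PQ(2)] by simp
qed

lemma basic_inequality:
  assumes sm: "smooth h" "smooth_real a" "smooth_real b" "smooth_real g"
    and h: "\<And>x. cnj (h x) = h x" "\<And>s p. p \<in> {j, l} \<Longrightarrow> wirt s p h = (\<lambda>x. 0)"
    and a: "\<And>s. wirt s l (\<lambda>x. complex_of_real (a x)) = (\<lambda>x. 0)"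
    and b: "\<And>s. wirt s j (\<lambda>x. complex_of_real (b x)) = (\<lambda>x. 0)"
    and W: "\<And>p. smooth (W p)" and G: "smooth_real G"
    and g: "\<And>p q. p \<in> {j, l} \<Longrightarrow> q \<in> {j, l} \<Longrightarrow>
      wirt (-1) p (wirt 1 q (\<lambda>x. complex_of_real (g x))) = (\<lambda>x. of_real (G x) * W p x * cnj (W q x))"
    and a_defect: "\<And>x. 5 * wirt (-1) j (\<lambda>x. of_real (a x)) x * wirt 1 j (\<lambda>x. of_real (a x)) x
      - of_real (a x) * wirt (-1) j (wirt 1 j (\<lambda>x. of_real (a x))) x = of_real (A x)"
    and b_defect: "\<And>x. 5 * wirt (-1) l (\<lambda>x. of_real (b x)) x * wirt 1 l (\<lambda>x. of_real (b x)) x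
      - of_real (b x) * wirt (-1) l (wirt 1 l (\<lambda>x. of_real (b x))) x = of_real (B x)"
    and ph: "(\<Sum>p\<in>{j, l}. \<Sum>q\<in>{j, l}. L p q (wirt (-1) p (wirt 1 q
      (\<lambda>x. (h x * h x) * ((of_real (a x) * of_real (b x) * of_real (g x)) * (of_real (a x) * of_real (b x) * of_real (g x))))))) = 0"
  shows "pairing (\<lambda>p q x. ((h x * of_real (a x * b x))\<^sup>2 * of_real (g x * G x)) * W p x * cnj (W q x)) \<le>
    Re (L j j (\<lambda>x. (h x * of_real (g x * b x))\<^sup>2 * of_real (A x))) + Re (L l l (\<lambda>x. (h x * of_real (g x * a x))\<^sup>2 * of_real (B x)))"
proof -
  let ?a = "\<lambda>x. complex_of_real (a x)" and ?b = "\<lambda>x. complex_of_real (b x)" and ?g = "\<lambda>x. complex_of_real (g x)"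
  let ?\<phi> = "\<lambda>x. (h x * h x) * ((?a x * ?b x * ?g x) * (?a x * ?b x * ?g x))"
  \<comment> \<open>Reality of the factors turns the products in \<open>ddc_product_square\<close>
    into the Hermitian squares of \<open>U\<close> and \<open>V\<close>.\<close>
  have real_wirt: "wirt 1 q f x = cnj (wirt (-1) q f x)" if "smooth f" "\<And>x. cnj (f x) = f x" for f q x
    using wirt_cnj[OF that(1), of 1 q] that(2) by simp
  define U where "U = (\<lambda>p x. h x * (?a x * ?b x * wirt (-1) p ?g x + 2 * ?g x * (?b x * wirt (-1) p ?a x + ?a x * wirt (-1) p ?b x)))"
  define V where "V = (\<lambda>p x. h x * ?g x * (?b x * wirt (-1) p ?a x - ?a x * wirt (-1) p ?b x))"
  define M where "M = (\<lambda>p q x. (h x * ?a x * ?b x)\<^sup>2 * ?g x * (of_real (G x) * W p x * cnj (W q x)))"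
  define E where "E = (\<lambda>p q x. (h x * ?g x * ?b x)\<^sup>2 * (5 * wirt (-1) p ?a x * wirt 1 q ?a x - ?a x * wirt (-1) p (wirt 1 q ?a) x))"
  define F where "F = (\<lambda>p q x. (h x * ?g x * ?a x)\<^sup>2 * (5 * wirt (-1) p ?b x * wirt 1 q ?b x - ?b x * wirt (-1) p (wirt 1 q ?b) x))"
  have U: "smooth (U p)" and V: "smooth (V p)" for p
    unfolding U_def V_def by (intro smooth_mult smooth_add smooth_diff smooth_const smooth_wirt sm)+
  have M: "smooth (M p q)" and E: "smooth (E p q)" and F: "smooth (F p q)" for p q
    unfolding M_def E_def F_def power2_eq_square
    by (intro smooth_mult smooth_add smooth_diff smooth_const smooth_wirt smooth_cnj sm W G)+
  have UU: "smooth (\<lambda>x. of_real 1 * U p x * cnj (U q x))" and VV: "smooth (\<lambda>x. of_real 1 * V p x * cnj (V q x))" for p q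
    by (intro smooth_mult smooth_const smooth_cnj U V)+
  have cU: "h x * (?a x * ?b x * wirt 1 q ?g x + 2 * ?g x * (?b x * wirt 1 q ?a x + ?a x * wirt 1 q ?b x)) = cnj (U q x)"
    and cV: "h x * ?g x * (?b x * wirt 1 q ?a x - ?a x * wirt 1 q ?b x) = cnj (V q x)" for q x
    unfolding U_def V_def using sm by (simp_all add: real_wirt h(1))
  have split: "wirt (-1) p (wirt 1 q ?\<phi>) = (\<lambda>x. of_real 2 * (of_real 1 * U p x * cnj (U q x)) + (of_real 4 * (of_real 1 * V p x * cnj (V q x))
      + (of_real 2 * M p q x + (of_real (-2) * E p q x + of_real (-2) * F p q x))))"
    if "p \<in> {j, l}" "q \<in> {j, l}" for p q
    unfolding ddc_product_square[OF sm h(2)[OF that(1)] h(2)[OF that(2)]] cU cV g[OF that]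
    by (simp add: U_def[symmetric] V_def[symmetric] fun_eq_iff M_def E_def F_def add.assoc)
       (simp add: U_def V_def)
  have sc: "smooth (\<lambda>x. of_real c * f x)" if "smooth f" for c and f :: "('n, 'm) cspace \<Rightarrow> complex"
    by (intro smooth_mult smooth_const that)
  have "0 = pairing (\<lambda>p q. wirt (-1) p (wirt 1 q ?\<phi>))"
    unfolding pairing_def ph by simp
  also have "\<dots> = pairing (\<lambda>p q x. of_real 2 * (of_real 1 * U p x * cnj (U q x)) + (of_real 4 * (of_real 1 * V p x * cnj (V q x))
      + (of_real 2 * M p q x + (of_real (-2) * E p q x + of_real (-2) * F p q x))))"
    unfolding pairing_def by (intro arg_cong[where f = Re] sum.cong refl) (simp only: split)
  also have "\<dots> = 2 * pairing (\<lambda>p q x. of_real 1 * U p x * cnj (U q x)) + (4 * pairing (\<lambda>p q x. of_real 1 * V p x * cnj (V q x))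
     + (2 * pairing M + (-2 * pairing E + -2 * pairing F)))"
    by (simp only: pairing_add pairing_scale smooth_add sc UU VV M E F)
  finally have eq: "pairing M = pairing E + pairing F - pairing (\<lambda>p q x. of_real 1 * U p x * cnj (U q x))
      - 2 * pairing (\<lambda>p q x. of_real 1 * V p x * cnj (V q x))" by simp
  have "pairing (\<lambda>p q x. of_real 1 * U p x * cnj (U q x)) \<ge> 0" "pairing (\<lambda>p q x. of_real 1 * V p x * cnj (V q x)) \<ge> 0"
    by (rule pairing_nonneg; (rule smooth_real_const U V | simp))+
  with eq have le: "pairing M \<le> pairing E + pairing F" by linarith
  have a': "wirt s l (wirt t j ?a) = (\<lambda>x. 0)" for s t
    using wirt_commute[OF sm(2), of s l t j] by (simp add: a wirt_const fun_eq_iff)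
  have b': "wirt s j (wirt t l ?b) = (\<lambda>x. 0)" for s t
    using wirt_commute[OF sm(3), of s j t l] by (simp add: b wirt_const fun_eq_iff)
  have "E j l = (\<lambda>x. 0)" "E l j = (\<lambda>x. 0)" "E l l = (\<lambda>x. 0)"
    by (simp_all add: E_def a a' wirt_const)
  hence PE: "pairing E = Re (L j j (E j j))"
    unfolding pairing_def using jl by (simp add: L_zero)
  have "F j l = (\<lambda>x. 0)" "F l j = (\<lambda>x. 0)" "F j j = (\<lambda>x. 0)"
    by (simp_all add: F_def b b' wirt_const)
  hence PF: "pairing F = Re (L l l (F l l))"
    unfolding pairing_def using jl by (simp add: L_zero)
  have "M = (\<lambda>p q x. ((h x * of_real (a x * b x))\<^sup>2 * of_real (g x * G x)) * W p x * cnj (W q x))"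
    by (simp add: M_def fun_eq_iff algebra_simps)
  moreover have "E j j = (\<lambda>x. (h x * of_real (g x * b x))\<^sup>2 * of_real (A x))"
    by (simp add: E_def a_defect fun_eq_iff) (simp add: mult.assoc)
  moreover have "F l l = (\<lambda>x. (h x * of_real (g x * a x))\<^sup>2 * of_real (B x))"
    by (simp add: F_def b_defect fun_eq_iff) (simp add: mult.assoc)
  ultimately show ?thesis using le PE PF by simp
qed

end

subsection \<open>Derivatives of the auxiliary functions\<close>

lemma wirt_coord_diff: "wirt s k (\<lambda>x. coord i x - c) = (\<lambda>x. if k = i then (1 - of_real s) / 2 else 0)"
  by (simp add: wirt_diff smooth_coord smooth_const wirt_coord wirt_const)

lemma smooth_real_norm_coord: "smooth_real (\<lambda>x. (cmod (coord k x - c))\<^sup>2)"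
  by (intro smooth_real_norm_power2 smooth_coord_diff)

lemma smooth_real_scaled_norm_coord: "smooth_real (\<lambda>x. \<mu> * (cmod (coord k x - c))\<^sup>2)"
  by (intro smooth_real_mult smooth_real_const smooth_real_norm_coord)

lemma wirt_norm_coord:
  "wirt s k (\<lambda>x. complex_of_real (\<mu> * (cmod (coord i x - c))\<^sup>2)) =
    (\<lambda>x. if k = i then of_real \<mu> * ((1 + of_real s) / 2 * (coord i x - c) + (1 - of_real s) / 2 * cnj (coord i x - c)) else 0)"
proof -
  have "(\<lambda>x. complex_of_real (\<mu> * (cmod (coord i x - c))\<^sup>2)) = (\<lambda>x. of_real \<mu> * ((coord i x - c) * cnj (coord i x - c)))"
    by (simp only: of_real_mult complex_norm_square)
  moreover have "smooth (\<lambda>x. cnj (coord i x - c))" by (intro smooth_cnj smooth_coord_diff)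
  ultimately show ?thesis
    by (simp only: wirt_cmult smooth_mult smooth_coord_diff wirt_mult wirt_cnj wirt_coord_diff)
       (auto simp: fun_eq_iff field_simps)
qed

definition radial_step :: "'n + 'm \<Rightarrow> complex \<Rightarrow> real \<Rightarrow> ('n::finite, 'm::finite) cspace \<Rightarrow> real" where
  "radial_step k c \<mu> x = step (\<mu> * (cmod (coord k x - c))\<^sup>2)"

lemma smooth_real_radial_step: "smooth_real (radial_step k c \<mu>)"
  unfolding radial_step_def[abs_def]
  by (rule smooth_real_compose[OF smooth_real_step smooth_real_scaled_norm_coord])

lemma wirt_radial:
  assumes "smooth_real \<theta>"
  shows "wirt s k (\<lambda>x. complex_of_real (\<theta> (\<mu> * (cmod (coord i x - c))\<^sup>2))) =
    (\<lambda>x. if k = i then of_real (real_deriv \<theta> (\<mu> * (cmod (coord i x - c))\<^sup>2)) *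
      (of_real \<mu> * ((1 + of_real s) / 2 * (coord i x - c) + (1 - of_real s) / 2 * cnj (coord i x - c))) else 0)"
  unfolding wirt_compose_real[OF assms smooth_real_scaled_norm_coord] dir_deriv_real_deriv[OF assms] wirt_norm_coord
  by auto

lemma wirt_radial_step_other: "k \<noteq> i \<Longrightarrow> wirt s k (\<lambda>x. complex_of_real (radial_step i c \<mu> x)) = (\<lambda>x. 0)"
  unfolding radial_step_def wirt_radial[OF smooth_real_step] by simp

text \<open>In the variable \<open>v = \<mu> |z|^2\<close> both the squared gradient and the mixed
  derivative of the step carry exactly one factor \<open>\<mu>\<close>.\<close>

lemma radial_step_defect:
  "5 * wirt (-1) k (\<lambda>x. of_real (radial_step k c \<mu> x)) x * wirt 1 k (\<lambda>x. of_real (radial_step k c \<mu> x)) x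
    - of_real (radial_step k c \<mu> x) * wirt (-1) k (wirt 1 k (\<lambda>x. of_real (radial_step k c \<mu> x))) x
   = of_real (\<mu> * step_defect (\<mu> * (cmod (coord k x - c))\<^sup>2))"
proof -
  let ?s = "\<lambda>x. \<mu> * (cmod (coord k x - c))\<^sup>2" and ?z = "\<lambda>x. coord k x - c"
  let ?d1 = "real_deriv step" and ?d2 = "real_deriv (real_deriv step)"
  have w1: "wirt 1 k (\<lambda>x. of_real (radial_step k c \<mu> x)) = (\<lambda>x. of_real (?d1 (?s x)) * (of_real \<mu> * ?z x))"
    unfolding radial_step_def wirt_radial[OF smooth_real_step] by simp
  have w0: "wirt (-1) k (\<lambda>x. of_real (radial_step k c \<mu> x)) x = of_real (?d1 (?s x)) * (of_real \<mu> * cnj (?z x))"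
    unfolding radial_step_def wirt_radial[OF smooth_real_step] by simp
  have w2: "wirt (-1) k (\<lambda>x. of_real (?d1 (?s x)) * (of_real \<mu> * ?z x)) x
    = of_real (?d1 (?s x)) * of_real \<mu> + of_real (?d2 (?s x)) * (of_real \<mu> * cnj (?z x)) * (of_real \<mu> * ?z x)"
  proof -
    have d: "smooth_real (\<lambda>x. ?d1 (?s x))"
      by (rule smooth_real_compose[OF smooth_real_deriv[OF smooth_real_step] smooth_real_scaled_norm_coord])
    show ?thesis
      unfolding wirt_mult[OF d smooth_mult[OF smooth_const smooth_coord_diff]] wirt_cmult[OF smooth_coord_diff]
        wirt_coord_diff wirt_radial[OF smooth_real_deriv[OF smooth_real_step]]
      by simp
  qed
  have n: "?z x * cnj (?z x) = of_real ((cmod (?z x))\<^sup>2)"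
    by (simp only: complex_norm_square)
  have "5 * wirt (-1) k (\<lambda>x. of_real (radial_step k c \<mu> x)) x * wirt 1 k (\<lambda>x. of_real (radial_step k c \<mu> x)) x
    - of_real (radial_step k c \<mu> x) * wirt (-1) k (wirt 1 k (\<lambda>x. of_real (radial_step k c \<mu> x))) x
   = 5 * (of_real (?d1 (?s x)) * (of_real \<mu> * cnj (?z x))) * (of_real (?d1 (?s x)) * (of_real \<mu> * ?z x))
     - of_real (step (?s x)) * (of_real (?d1 (?s x)) * of_real \<mu> + of_real (?d2 (?s x)) * (of_real \<mu> * cnj (?z x)) * (of_real \<mu> * ?z x))"
    unfolding w1 w0 w2 unfolding radial_step_def ..
  also have "\<dots> = 5 * of_real (?d1 (?s x)) * of_real \<mu> * of_real (?d1 (?s x)) * of_real \<mu> * (?z x * cnj (?z x))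
     - of_real (step (?s x)) * (of_real (?d1 (?s x)) * of_real \<mu> + of_real (?d2 (?s x)) * of_real \<mu> * of_real \<mu> * (?z x * cnj (?z x)))"
    by (simp only: mult_ac)
  also have "\<dots> = of_real (\<mu> * step_defect (?s x))"
    unfolding n by (simp add: step_defect_def algebra_simps power2_eq_square)
  finally show ?thesis .
qed

text \<open>The bump function is \<open>convex_flat (R / (\<sigma> + |w|\<^sup>2) - 1)\<close>; it vanishes for \<open>|w|\<^sup>2 \<ge> R - \<sigma>\<close>, and its Laplacian
  in \<open>w\<close> is nonnegative for \<open>|w|\<^sup>2 \<ge> \<sigma>\<close> because \<open>convex_flat\<close> is convex and increasing.\<close>

definition bump_arg :: "real \<Rightarrow> real \<Rightarrow> (('n::finite, 'm::finite) cspace \<Rightarrow> complex) \<Rightarrow> ('n, 'm) cspace \<Rightarrow> real" where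
  "bump_arg R \<sigma> w x = R * inverse (\<sigma> + (cmod (w x))\<^sup>2) - 1"

text \<open>Chain rule for \<open>convex_flat\<close> after
  \<open>X = R / (\<sigma> + s) - 1\<close> with \<open>s = |w|^2\<close>: the second derivative
  times the squared gradient of \<open>X\<close>, plus the first derivative times the mixed
  derivative of \<open>X\<close>, which equals
  \<open>R (s - \<sigma>) / (\<sigma> + s)^3\<close>.\<close>

definition bump_laplacian :: "real \<Rightarrow> real \<Rightarrow> (('n::finite, 'm::finite) cspace \<Rightarrow> complex) \<Rightarrow> ('n, 'm) cspace \<Rightarrow> real" where
  "bump_laplacian R \<sigma> w x =
     flat 3 (bump_arg R \<sigma> w x) * (R\<^sup>2 * (cmod (w x))\<^sup>2 * inverse (\<sigma> + (cmod (w x))\<^sup>2) ^ 4)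
   + (flat 0 (bump_arg R \<sigma> w x) + flat 1 (bump_arg R \<sigma> w x))
     * (2 * R * (cmod (w x))\<^sup>2 * inverse (\<sigma> + (cmod (w x))\<^sup>2) ^ 3 - R * inverse (\<sigma> + (cmod (w x))\<^sup>2) ^ 2)"

lemma
  assumes "smooth w" "\<sigma> > 0"
  shows smooth_real_bump_arg: "smooth_real (bump_arg R \<sigma> w)"
    and smooth_real_bump_laplacian: "smooth_real (bump_laplacian R \<sigma> w)"
proof -
  have "\<sigma> + (cmod (w x))\<^sup>2 \<noteq> 0" for x
    using assms(2) zero_le_power2[of "cmod (w x)"] by linarith
  hence i: "smooth_real (\<lambda>x. inverse (\<sigma> + (cmod (w x))\<^sup>2))"
    by (intro smooth_real_inverse smooth_real_add smooth_real_const smooth_real_norm_power2 assms(1))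
  show b: "smooth_real (bump_arg R \<sigma> w)"
    unfolding bump_arg_def by (intro smooth_real_diff smooth_real_mult smooth_real_const i)
  show "smooth_real (bump_laplacian R \<sigma> w)"
    unfolding bump_laplacian_def
    by (intro smooth_real_add smooth_real_diff smooth_real_mult smooth_real_const smooth_real_power i
        smooth_real_norm_power2 assms(1) smooth_real_compose[OF smooth_real_flat b])
qed

text \<open>As \<open>w\<close> and its derivatives are holomorphic, the Hessian of a function of
  \<open>|w|^2\<close> is its Laplacian in \<open>w\<close> times the rank one matrix of products of
  derivatives of \<open>w\<close>.\<close>

lemma ddc_bump:
  assumes w: "smooth w" and \<sigma>: "\<sigma> > 0"
    and hol: "\<And>k. wirt 1 k w = (\<lambda>x. 0)" "\<And>k. wirt 1 k (wirt (-1) q w) = (\<lambda>x. 0)"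
  shows "wirt (-1) p (wirt 1 q (\<lambda>x. complex_of_real (convex_flat (bump_arg R \<sigma> w x)))) =
    (\<lambda>x. of_real (bump_laplacian R \<sigma> w x) * wirt (-1) p w x * cnj (wirt (-1) q w x))"
proof -
  define iy where "iy = (\<lambda>x. complex_of_real (inverse (\<sigma> + (cmod (w x))\<^sup>2)))"
  define wp where "wp = wirt (-1) p w"
  define wq where "wq = wirt (-1) q w"
  have y0: "\<sigma> + (cmod (w x))\<^sup>2 \<noteq> 0" for x
    using \<sigma> zero_le_power2[of "cmod (w x)"] by linarith
  have wc: "smooth (\<lambda>x. cnj (w x))" by (rule smooth_cnj[OF w])
  have wqs: "smooth (\<lambda>x. cnj (wq x))" unfolding wq_def by (intro smooth_cnj smooth_wirt w)
  have iy_eq: "iy = (\<lambda>x. inverse (of_real \<sigma> + w x * cnj (w x)))"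
    by (simp only: iy_def of_real_inverse of_real_add complex_norm_square)
  have sy: "smooth (\<lambda>x. of_real \<sigma> + w x * cnj (w x))"
    by (intro smooth_add smooth_const smooth_mult w wc)
  have ne: "of_real \<sigma> + w x * cnj (w x) \<noteq> 0" for x
  proof -
    have "of_real \<sigma> + w x * cnj (w x) = complex_of_real (\<sigma> + (cmod (w x))\<^sup>2)"
      by (simp only: of_real_add complex_norm_square)
    thus ?thesis using y0[of x] by (metis of_real_eq_0_iff)
  qed
  have siy: "smooth iy" unfolding iy_eq by (rule smooth_inverse[OF sy ne])
  have diy: "wirt s k iy = (\<lambda>x. - (w x * cnj (wirt (- s) k w x) + wirt s k w x * cnj (w x)) * (iy x)\<^sup>2)" for s k
    unfolding iy_eq wirt_inverse[OF sy ne]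
    by (simp add: wirt_add wirt_mult smooth_mult smooth_const w wc wirt_const wirt_cnj)
  let ?X = "bump_arg R \<sigma> w"
  have sX: "smooth_real ?X" by (rule smooth_real_bump_arg[OF w \<sigma>])
  have X: "(\<lambda>x. complex_of_real (?X x)) = (\<lambda>x. of_real R * iy x - 1)"
    by (simp add: bump_arg_def iy_def)
  have dX: "wirt s k (\<lambda>x. complex_of_real (?X x)) = (\<lambda>x. of_real R * wirt s k iy x)" for s k
    unfolding X by (simp add: wirt_diff wirt_cmult wirt_const smooth_mult smooth_const siy)
  have dXq: "wirt 1 q (\<lambda>x. complex_of_real (?X x)) = (\<lambda>x. - of_real R * (w x * cnj (wq x) * (iy x * iy x)))"
    unfolding dX diy by (simp add: hol wq_def fun_eq_iff power2_eq_square)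
  have dXp: "wirt (-1) p (\<lambda>x. complex_of_real (?X x)) = (\<lambda>x. - of_real R * (wp x * cnj (w x) * (iy x * iy x)))"
    unfolding dX diy by (simp add: hol wp_def fun_eq_iff power2_eq_square)
  have diyp: "wirt (-1) p iy = (\<lambda>x. - (wp x * cnj (w x)) * (iy x)\<^sup>2)"
    unfolding diy by (simp add: hol wp_def)
  have dwq: "wirt (-1) p (\<lambda>x. cnj (wq x)) = (\<lambda>x. 0)"
    unfolding wq_def by (simp add: wirt_cnj smooth_wirt w hol)
  have dXpq: "wirt (-1) p (\<lambda>x. - of_real R * (w x * cnj (wq x) * (iy x * iy x))) =
    (\<lambda>x. (2 * of_real R * (w x * cnj (w x)) * iy x ^ 3 - of_real R * (iy x)\<^sup>2) * (wp x * cnj (wq x)))"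
    by (simp add: wirt_cmult wirt_mult wirt_uminus smooth_mult smooth_const w wqs siy dwq diyp wp_def[symmetric])
       (simp add: fun_eq_iff algebra_simps power2_eq_square power3_eq_cube)
  have d1: "dir_deriv 1 (\<lambda>x. complex_of_real (convex_flat x)) t = of_real (flat 0 t + flat 1 t)" for t
    using dir_deriv_of_real[OF DERIV_convex_flat, of 1 t] by simp
  have d2: "dir_deriv 1 (\<lambda>x. complex_of_real (flat 0 x + flat 1 x)) t = of_real (flat 3 t)" for t
    using dir_deriv_of_real[OF DERIV_convex_flat', of 1 t] by simp
  have s01: "smooth_real (\<lambda>x. flat 0 x + flat 1 x)" by (intro smooth_real_add smooth_real_flat)
  have s01X: "smooth_real (\<lambda>x. flat 0 (?X x) + flat 1 (?X x))"
    by (rule smooth_real_compose[OF s01 sX])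
  have "wirt 1 q (\<lambda>x. complex_of_real (convex_flat (?X x))) =
    (\<lambda>x. of_real (flat 0 (?X x) + flat 1 (?X x)) * (- of_real R * (w x * cnj (wq x) * (iy x * iy x))))"
    unfolding wirt_compose_real[OF smooth_real_convex_flat sX] d1 dXq ..
  moreover have "smooth (\<lambda>x. - of_real R * (w x * cnj (wq x) * (iy x * iy x)))"
    by (intro smooth_mult smooth_const w wqs siy)
  moreover have "wirt (-1) p (\<lambda>x. complex_of_real (flat 0 (?X x) + flat 1 (?X x))) =
    (\<lambda>x. of_real (flat 3 (?X x)) * (- of_real R * (wp x * cnj (w x) * (iy x * iy x))))"
    using wirt_compose_real[OF s01 sX, of "-1" p] unfolding d2 dXp .
  ultimately have "wirt (-1) p (wirt 1 q (\<lambda>x. complex_of_real (convex_flat (?X x)))) =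
    (\<lambda>x. of_real (flat 0 (?X x) + flat 1 (?X x)) * ((2 * of_real R * (w x * cnj (w x)) * iy x ^ 3 - of_real R * (iy x)\<^sup>2) * (wp x * cnj (wq x)))
      + of_real (flat 3 (?X x)) * (- of_real R * (wp x * cnj (w x) * (iy x * iy x))) * (- of_real R * (w x * cnj (wq x) * (iy x * iy x))))"
    by (simp only: wirt_mult[OF s01X] dXpq)
  also have "\<dots> = (\<lambda>x. of_real (bump_laplacian R \<sigma> w x) * wp x * cnj (wq x))"
  proof
    fix x
    have n: "w x * cnj (w x) = of_real ((cmod (w x))\<^sup>2)" by (simp only: complex_norm_square)
    have "(- of_real R * (wp x * cnj (w x) * (iy x * iy x))) * (- of_real R * (w x * cnj (wq x) * (iy x * iy x)))
      = (of_real R)\<^sup>2 * (w x * cnj (w x)) * iy x ^ 4 * (wp x * cnj (wq x))"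
      by (simp add: power2_eq_square power4_eq_xxxx)
    hence "of_real (flat 3 (?X x)) * (- of_real R * (wp x * cnj (w x) * (iy x * iy x))) * (- of_real R * (w x * cnj (wq x) * (iy x * iy x)))
      = of_real (flat 3 (?X x)) * ((of_real R)\<^sup>2 * (w x * cnj (w x)) * iy x ^ 4) * (wp x * cnj (wq x))"
      by (simp only: mult.assoc)
    thus "of_real (flat 0 (?X x) + flat 1 (?X x)) * ((2 * of_real R * (w x * cnj (w x)) * iy x ^ 3 - of_real R * (iy x)\<^sup>2) * (wp x * cnj (wq x)))
      + of_real (flat 3 (?X x)) * (- of_real R * (wp x * cnj (w x) * (iy x * iy x))) * (- of_real R * (w x * cnj (wq x) * (iy x * iy x)))
      = of_real (bump_laplacian R \<sigma> w x) * wp x * cnj (wq x)"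
      unfolding n bump_laplacian_def iy_def by (simp add: algebra_simps)
  qed
  finally show ?thesis by (simp add: wp_def wq_def)
qed

subsection \<open>The mass estimate\<close>

lemma bump_arg_le:
  assumes "R \<ge> 0" "\<sigma> > 0"
  shows "convex_flat (bump_arg R \<sigma> w x) \<le> R / \<sigma>"
proof (cases "bump_arg R \<sigma> w x \<ge> 0")
  case True
  have "R / (\<sigma> + (cmod (w x))\<^sup>2) \<le> R / \<sigma>"
    using assms by (intro divide_left_mono mult_pos_pos add_pos_nonneg) auto
  thus ?thesis using convex_flat_le[OF True] by (simp add: bump_arg_def divide_inverse)
next
  case False
  thus ?thesis using assms convex_flat_eq_0[of "bump_arg R \<sigma> w x"] by simp
qed

lemma convex_flat_bump_arg_neq_0D:
  assumes "convex_flat (bump_arg R \<sigma> w x) \<noteq> 0" "\<sigma> > 0"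
  shows "(cmod (w x))\<^sup>2 < R"
proof -
  have "bump_arg R \<sigma> w x > 0" using assms(1) convex_flat_eq_0 by (meson not_le)
  hence "1 < R / (\<sigma> + (cmod (w x))\<^sup>2)" by (simp add: bump_arg_def divide_inverse)
  moreover have "\<sigma> + (cmod (w x))\<^sup>2 > 0" using assms(2) by (simp add: add_pos_nonneg)
  ultimately have "\<sigma> + (cmod (w x))\<^sup>2 < R" by (simp add: less_divide_eq)
  thus ?thesis using assms(2) by linarith
qed

text \<open>For \<open>s \<ge> 2 * \<sigma>\<close> one has
  \<open>s - \<sigma> \<ge> (\<sigma> + s) / 3\<close>. The distance from
  \<open>s = \<sigma>\<close>, where positivity begins, makes the bound quantitative.\<close>

lemma bump_laplacian_factor:
  fixes \<sigma> s R :: real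
  assumes "\<sigma> > 0" "2 * \<sigma> \<le> s" "R \<ge> 0"
  shows "2 * R * s * inverse (\<sigma> + s) ^ 3 - R * inverse (\<sigma> + s) ^ 2 \<ge> R / (3 * (\<sigma> + s)\<^sup>2)"
proof -
  define y where "y = \<sigma> + s"
  have y: "y > 0" "3 * (2 * s - y) \<ge> y" using assms by (auto simp: y_def)
  have "R / (3 * y\<^sup>2) = R * y / (3 * y ^ 3)"
    using y by (simp add: power2_eq_square power3_eq_cube)
  also have "\<dots> \<le> R * (3 * (2 * s - y)) / (3 * y ^ 3)"
    using y assms(3) by (intro divide_right_mono mult_left_mono) auto
  also have "\<dots> = 2 * R * s * inverse y ^ 3 - R * inverse y ^ 2"
    using y by (simp add: field_simps power2_eq_square power3_eq_cube)
  finally show ?thesis by (simp add: y_def)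
qed

lemma bump_laplacian_nonneg:
  assumes "\<sigma> > 0" "2 * \<sigma> \<le> (cmod (w x))\<^sup>2" "R \<ge> 0"
  shows "bump_laplacian R \<sigma> w x \<ge> 0"
proof -
  have "0 \<le> R / (3 * (\<sigma> + (cmod (w x))\<^sup>2)\<^sup>2)" using assms by simp
  hence "2 * R * (cmod (w x))\<^sup>2 * inverse (\<sigma> + (cmod (w x))\<^sup>2) ^ 3 - R * inverse (\<sigma> + (cmod (w x))\<^sup>2) ^ 2 \<ge> 0"
    using bump_laplacian_factor[OF assms] by linarith
  thus ?thesis unfolding bump_laplacian_def
    using assms by (intro add_nonneg_nonneg mult_nonneg_nonneg flat_nonneg) (auto simp: add_nonneg_nonneg)
qed

text \<open>With \<open>s = |w|^2\<close>, the assumptions give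
  \<open>\<sigma> + s \<le> 3 * R / 8\<close> and hence \<open>X \<ge> 1\<close>, where both
  \<open>convex_flat\<close> and its first derivative are at least \<open>exp (-1)\<close>. These
  two factors make up \<open>exp (-2)\<close>; the rest comes from
  \<open>bump_laplacian_factor\<close>.\<close>

lemma bump_lower_bound:
  assumes \<sigma>: "\<sigma> > 0" "2 * \<sigma> \<le> (cmod (w x))\<^sup>2" and R: "(cmod (w x))\<^sup>2 \<le> R / 4"
  shows "convex_flat (bump_arg R \<sigma> w x) * bump_laplacian R \<sigma> w x \<ge> 2 * exp (-2) / R"
proof -
  define s where "s = (cmod (w x))\<^sup>2"
  define y where "y = \<sigma> + s"
  define X where "X = bump_arg R \<sigma> w x"
  have s: "2 * \<sigma> \<le> s" "s \<le> R / 4" using \<sigma> R by (auto simp: s_def)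
  hence R0: "R > 0" using \<sigma>(1) by linarith
  have y: "y > 0" "y \<le> 3 * R / 8" using s \<sigma>(1) by (auto simp: y_def)
  have "X = R / y - 1" by (simp add: X_def bump_arg_def y_def s_def divide_inverse)
  moreover have "2 \<le> R / y" using y R0 by (simp add: pos_le_divide_eq)
  ultimately have X: "X \<ge> 1" by linarith
  have f0: "flat 0 X \<ge> exp (-1)" using X by (simp add: flat_def)
  have e: "exp (-1::real) \<ge> 0" by simp
  have "1 * exp (-1) \<le> X * flat 0 X" using X f0 by (intro mult_mono) auto
  hence cf: "convex_flat X \<ge> exp (-1)" by (simp add: convex_flat_def)
  have "2 / R \<le> R / (3 * y\<^sup>2)"
  proof -
    have "y\<^sup>2 \<le> (3 * R / 8)\<^sup>2" using y by (intro power_mono) auto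
    hence "64 * y\<^sup>2 \<le> 9 * R\<^sup>2" by (simp add: power2_eq_square)
    hence "6 * y\<^sup>2 \<le> R\<^sup>2" using zero_le_power2[of R] by linarith
    thus ?thesis using y R0 by (simp add: field_simps power2_eq_square)
  qed
  hence fac: "2 / R \<le> 2 * R * s * inverse y ^ 3 - R * inverse y ^ 2"
    using bump_laplacian_factor[of \<sigma> s R] \<sigma>(1) s(1) R0 by (simp add: y_def)
  have "exp (-1) * (2 / R) \<le> (flat 0 X + flat 1 X) * (2 * R * s * inverse y ^ 3 - R * inverse y ^ 2)"
  proof (rule mult_mono)
    show "exp (-1) \<le> flat 0 X + flat 1 X" using f0 flat_nonneg[of 1 X] by linarith
    show "0 \<le> flat 0 X + flat 1 X" by (intro add_nonneg_nonneg flat_nonneg)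
  qed (use fac R0 in auto)
  also have "\<dots> \<le> bump_laplacian R \<sigma> w x"
    unfolding bump_laplacian_def X_def[symmetric] s_def[symmetric] y_def[symmetric]
    using y s \<sigma>(1) by (simp add: flat_nonneg)
  finally have "exp (-1) * (exp (-1) * (2 / R)) \<le> convex_flat X * bump_laplacian R \<sigma> w x"
    using cf R0 by (intro mult_mono) (auto simp: convex_flat_nonneg)
  thus ?thesis by (simp add: X_def exp_add[symmetric] mult.assoc[symmetric] mult.commute[of 2])
qed

lemma wirt_outside:
  "closed K \<Longrightarrow> (\<And>x. x \<notin> K \<Longrightarrow> f x = 0) \<Longrightarrow> x \<notin> K \<Longrightarrow> wirt s k f x = 0"
  by (simp add: wirt_def dir_deriv_outside)

abbreviation test_real :: "('a::real_normed_vector \<Rightarrow> real) \<Rightarrow> bool" where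
  "test_real f \<equiv> test_function (\<lambda>x. complex_of_real (f x))"

lemma test_real_mult: "test_real f \<Longrightarrow> smooth_real g \<Longrightarrow> test_real (\<lambda>x. f x * g x)"
  using test_function_mult(1) by fastforce

section \<open>Masses of a positive pluriharmonic current\<close>

locale ph_current = current11 T for T :: "('n::finite, 'm::finite) functional" +
  assumes positive: "positive_current11 T" and pluriharmonic: "pluriharmonic11 T"
begin

definition mass :: "'n + 'm \<Rightarrow> (('n, 'm) cspace \<Rightarrow> real) \<Rightarrow> real" where
  "mass i f = Re (coefficient i (\<lambda>x. complex_of_real (f x)))"

lemma mass_add: "test_real f \<Longrightarrow> test_real g \<Longrightarrow> mass i (\<lambda>x. f x + g x) = mass i f + mass i g"
  by (simp add: mass_def coefficient_add)

lemma mass_scale: "test_real f \<Longrightarrow> mass i (\<lambda>x. c * f x) = c * mass i f"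
  by (simp add: mass_def coefficient_scale)

lemma mass_nonneg:
  assumes "test_real f" "\<And>x. f x \<ge> 0"
  shows "mass i f \<ge> 0"
proof -
  \<comment> \<open>Neither factor has dimension 0, so a second coordinate exists in the other
    factor.\<close>
  obtain j :: "'n + 'm" where j: "j \<noteq> i"
    by (cases i) (use sum.disc in blast)+
  have "Re (\<Sum>p\<in>{j, i}. \<Sum>q\<in>{j, i}. pair_functional j i p q
      (\<lambda>x. of_real (f x) * (if p = j then 1 else 0) * cnj (if q = j then 1 else 0))) \<ge> 0"
    by (rule pair_functional_nonneg[OF positive j assms]) (rule smooth_const)
  moreover have "pair_functional j i p q (\<lambda>x. 0) = 0" for p q
    using pair_functional_scale[OF j test_function_zero, of p q 0] by simp
  ultimately show ?thesis
    using j by (simp add: pair_functional_diag mass_def)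
qed

lemma mass_mono:
  assumes "test_real f" "test_real g" "\<And>x. f x \<le> g x"
  shows "mass i f \<le> mass i g"
proof -
  have "test_real (\<lambda>x. (-1) * f x)"
    using test_function_mult(2)[OF assms(1) smooth_const, of "-1"] by simp
  from mass_add[OF assms(2) this] have "mass i (\<lambda>x. g x - f x) = mass i g - mass i f"
    using mass_scale[OF assms(1), of i "-1"] by simp
  moreover have "test_real (\<lambda>x. g x - f x)"
    using test_function_add[OF assms(2) \<open>test_real (\<lambda>x. (-1) * f x)\<close>] by simp
  ultimately show ?thesis using mass_nonneg[of "\<lambda>x. g x - f x" i] assms(3) by simp
qed

text \<open>The estimates are phrased in masses of standard cutoffs instead of measures of sets;
  this domination brings every error term to that form.\<close>

lemma mass_le_cutoff:
  assumes f: "test_real f" "\<And>x. f x \<le> M" "M \<ge> 0" and \<rho>: "\<And>k. \<rho> k > 0"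
    and supp: "\<And>x. f x \<noteq> 0 \<Longrightarrow> x \<in> polydisc c \<rho>"
  shows "mass i f \<le> M * mass i (cutoff UNIV c \<rho>)"
proof -
  have t: "test_real (cutoff UNIV c \<rho>)" by (rule test_function_cutoff[OF \<rho>])
  have "f x \<le> M * cutoff UNIV c \<rho> x" for x
  proof (cases "f x = 0")
    case True thus ?thesis using f(3) cutoff_nonneg[of UNIV c \<rho> x] by simp
  next
    case False
    hence "cutoff UNIV c \<rho> x = 1" using supp[OF False] by (intro cutoff_eq_1) (auto simp: polydisc_def)
    thus ?thesis using f(2) by simp
  qed
  moreover have "test_real (\<lambda>x. M * cutoff UNIV c \<rho> x)"
    using test_function_mult(2)[OF t smooth_const, of "of_real M"] by simp
  ultimately have "mass i f \<le> mass i (\<lambda>x. M * cutoff UNIV c \<rho> x)" by (intro mass_mono f)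
  thus ?thesis by (simp add: mass_scale[OF t])
qed

end

section \<open>The two-variable estimate with explicit constants\<close>

locale mass_setting = ph_current T for T :: "('n::finite, 'm::finite) functional" +
  fixes j l :: "'n + 'm" and c :: "'n + 'm \<Rightarrow> complex" and \<tau> :: "'n + 'm \<Rightarrow> real" and \<rho> r M :: real
  assumes jl: "j \<noteq> l" and \<tau>: "\<And>k. \<tau> k > 0" and \<rho>: "0 < \<rho>" "\<rho> \<le> 1" and r: "1 \<le> r"
    and M: "0 < M" "\<And>v. step_defect v \<le> M"
begin

text \<open>On the support of \<open>a * b\<close> one has \<open>|w|\<^sup>2 \<ge> 2 * \<sigma>\<close>, and there \<open>|w|\<^sup>2 < R\<close> confines both coordinates to discs of
  radius \<open>r'\<close>. The cutoff \<open>\<kappa>\<close> is 1 on the support of the test function; it makes \<open>L\<close> act on all smooth functions.\<close>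

definition "R = 256 * r ^ 4"
definition "\<sigma> = \<rho> ^ 4 / 32"
definition "\<mu> = 4 / \<rho>\<^sup>2"
definition "r' = 40 * r\<^sup>2 / \<rho>"
definition "\<kappa> = cutoff UNIV c (\<lambda>k. if k = j \<or> k = l then r' else 2 * \<tau> k)"
definition "h = cutoff (- {j, l}) c \<tau>"
definition "L p q f = pair_functional j l p q (\<lambda>x. of_real (\<kappa> x) * f x)"
text \<open>These radii enclose the supports of the errors near \<open>u = c\<close> and near
  \<open>v = d\<close>. The factor 3 in \<open>\<rho>\<^sub>2\<close> covers
  \<open>|v - d| \<le> \<rho>\<close> for every centre \<open>d\<close> within
  \<open>2 * \<rho>\<close> of \<open>c l\<close>.\<close>

definition "\<rho>\<^sub>1 k = (if k = j then \<rho> else if k = l then r' else 2 * \<tau> k)"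
definition "\<rho>\<^sub>2 k = (if k = l then 3 * \<rho> else if k = j then r' else 2 * \<tau> k)"
definition "a = radial_step j (c j) \<mu>"
definition "b d = radial_step l d \<mu>"
definition "w d x = (coord j x - c j) * (coord l x - d)"
definition "g d x = convex_flat (bump_arg R \<sigma> (w d) x)"
text \<open>The coefficients of \<open>dw\<close>. Only the \<open>j\<close> entry depends on
  \<open>d\<close>, so the difference for two centres is a constant multiple of
  \<open>du\<close>.\<close>

definition "W d p x = (if p = j then coord l x - d else if p = l then coord j x - c j else 0)"

lemma pos: "R > 0" "\<sigma> > 0" "\<mu> > 0" "r' > 0"
  using \<rho> r by (auto simp: R_def \<sigma>_def \<mu>_def r'_def)

lemma test_\<kappa>: "test_real \<kappa>"
  unfolding \<kappa>_def by (rule test_function_cutoff) (use \<tau> pos in auto)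

sublocale pair: positive_pair L j l
proof
  show "L p q (\<lambda>x. f x + g x) = L p q f + L p q g" if "smooth f" "smooth g" for p q f g
    unfolding L_def using pair_functional_add[OF jl test_function_mult(1)[OF test_\<kappa> that(1)] test_function_mult(1)[OF test_\<kappa> that(2)]]
    by (simp add: algebra_simps)
  show "L p q (\<lambda>x. k * f x) = k * L p q f" if "smooth f" for p q f k
    unfolding L_def using pair_functional_scale[OF jl test_function_mult(1)[OF test_\<kappa> that]]
    by (simp add: algebra_simps)
  show "0 \<le> Re (\<Sum>p\<in>{j, l}. \<Sum>q\<in>{j, l}. L p q (\<lambda>x. of_real (f x) * P p x * cnj (P q x)))"
    if "smooth_real f" "\<And>x. f x \<ge> 0" "\<And>p. smooth (P p)" for f P
  proof -
    have "\<kappa> x * f x \<ge> 0" for x unfolding \<kappa>_def by (intro mult_nonneg_nonneg cutoff_nonneg that(2))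
    from pair_functional_nonneg[OF positive jl test_real_mult[OF test_\<kappa> that(1)] this that(3)]
    show ?thesis by (simp add: L_def mult.assoc)
  qed
qed (rule jl)

lemma L_diag: "Re (L j j (\<lambda>x. of_real (f x))) = mass l (\<lambda>x. \<kappa> x * f x)" "Re (L l l (\<lambda>x. of_real (f x))) = mass j (\<lambda>x. \<kappa> x * f x)"
  unfolding L_def mass_def by (simp_all add: pair_functional_diag[OF jl])

lemma smooth_w: "smooth (w d)"
  unfolding w_def by (intro smooth_mult smooth_coord_diff)

lemma smooth_W: "smooth (W d p)"
  unfolding W_def by (cases "p = j"; cases "p = l") (simp_all add: smooth_coord_diff smooth_const)

lemma wirt_w:
  shows "p \<in> {j, l} \<Longrightarrow> wirt (-1) p (w d) = W d p" "wirt 1 k (w d) = (\<lambda>x. 0)"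
    "p \<in> {j, l} \<Longrightarrow> wirt 1 k (wirt (-1) p (w d)) = (\<lambda>x. 0)"
proof -
  have m: "wirt s k (w d) = (\<lambda>x. (coord j x - c j) * wirt s k (\<lambda>x. coord l x - d) x + wirt s k (\<lambda>x. coord j x - c j) x * (coord l x - d))" for s k
    unfolding w_def by (rule wirt_mult[OF smooth_coord_diff smooth_coord_diff])
  show p: "wirt (-1) p (w d) = W d p" if "p \<in> {j, l}" for p
    using that jl unfolding m wirt_coord_diff by (auto simp: W_def fun_eq_iff)
  show "wirt 1 k (w d) = (\<lambda>x. 0)" unfolding m wirt_coord_diff by auto
  show "wirt 1 k (wirt (-1) p (w d)) = (\<lambda>x. 0)" if "p \<in> {j, l}"
    unfolding p[OF that] W_def using that jl by (auto simp: wirt_coord_diff)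
qed

lemma smooth_real_h: "smooth_real h"
  unfolding h_def by (rule smooth_real_cutoff)

lemma wirt_h:
  assumes "p \<in> {j, l}"
  shows "wirt s p (\<lambda>x. complex_of_real (h x)) = (\<lambda>x. 0)"
proof -
  have "wirt s p (\<lambda>x. complex_of_real (cutoff K c \<tau> x)) = (\<lambda>x. 0)" if "finite K" "p \<notin> K" for K
    using that
  proof (induction K rule: finite_induct)
    case empty
    show ?case by (simp add: cutoff_def wirt_const)
  next
    case (insert k K)
    let ?f = "\<lambda>x. complex_of_real (1 - radial_step k (c k) (inverse ((\<tau> k)\<^sup>2)) x)"
    have f: "smooth ?f" using smooth_real_diff[OF smooth_real_const smooth_real_radial_step] by blast
    have "wirt s p ?f = (\<lambda>x. 0)"
      using wirt_diff[OF smooth_const smooth_real_radial_step, of s p 1 k "c k" "inverse ((\<tau> k)\<^sup>2)"] insert.prems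
      by (simp add: wirt_const wirt_radial_step_other)
    moreover have "(\<lambda>x. complex_of_real (cutoff (insert k K) c \<tau> x)) = (\<lambda>x. ?f x * of_real (cutoff K c \<tau> x))"
      using insert.hyps by (simp add: cutoff_def radial_step_def divide_inverse mult.commute fun_eq_iff)
    ultimately show ?case using insert f smooth_real_cutoff[of K c \<tau>] by (simp add: wirt_mult)
  qed
  thus ?thesis unfolding h_def using assms by simp
qed

lemma h_bounds: "0 \<le> h x" "h x \<le> 1"
  unfolding h_def by (rule cutoff_nonneg cutoff_le_1)+

lemma h_neq_0D: "h x \<noteq> 0 \<Longrightarrow> k \<noteq> j \<Longrightarrow> k \<noteq> l \<Longrightarrow> cmod (coord k x - c k) \<le> 2 * \<tau> k"
  unfolding h_def using cutoff_neq_0D[of "- {j, l}" c \<tau> x k] \<tau> by simp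

lemma radial_step_bounds: "0 \<le> radial_step k e \<mu> x" "radial_step k e \<mu> x \<le> 1"
  by (simp_all add: radial_step_def step_ge_0 step_le_1)

lemma scaled_norm_gt_1D: "\<mu> * t\<^sup>2 \<ge> 1 \<Longrightarrow> t \<ge> 0 \<Longrightarrow> \<rho> / 2 \<le> t"
proof -
  assume "\<mu> * t\<^sup>2 \<ge> 1" "t \<ge> 0"
  hence "(\<rho> / 2)\<^sup>2 \<le> t\<^sup>2" using \<rho> by (simp add: \<mu>_def field_simps power2_eq_square)
  thus ?thesis using \<open>t \<ge> 0\<close> by (rule power2_le_imp_le)
qed

lemma scaled_norm_le_4D: "\<mu> * t\<^sup>2 \<le> 4 \<Longrightarrow> t \<le> \<rho>"
proof -
  assume "\<mu> * t\<^sup>2 \<le> 4"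
  hence "t\<^sup>2 \<le> \<rho>\<^sup>2" using \<rho> by (simp add: \<mu>_def field_simps)
  thus ?thesis by (rule power2_le_imp_le) (use \<rho>(1) in simp)
qed

lemma radial_step_neq_0D: "radial_step k e \<mu> x \<noteq> 0 \<Longrightarrow> \<rho> / 2 \<le> cmod (coord k x - e)"
  using scaled_norm_gt_1D[of "cmod (coord k x - e)"] step_eq_0[of "\<mu> * (cmod (coord k x - e))\<^sup>2"]
  by (force simp: radial_step_def)

lemma radial_step_eq_1: "\<rho> \<le> cmod (coord k x - e) \<Longrightarrow> radial_step k e \<mu> x = 1"
proof -
  assume "\<rho> \<le> cmod (coord k x - e)"
  hence "\<rho>\<^sup>2 \<le> (cmod (coord k x - e))\<^sup>2" using \<rho> by (intro power_mono) auto
  hence "4 \<le> \<mu> * (cmod (coord k x - e))\<^sup>2" using \<rho> by (simp add: \<mu>_def field_simps)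
  thus ?thesis by (simp add: radial_step_def step_eq_1)
qed

lemma step_defect_neq_0D:
  assumes "step_defect (\<mu> * t\<^sup>2) \<noteq> 0" "t \<ge> 0"
  shows "\<rho> / 2 \<le> t" "t \<le> \<rho>"
proof -
  have "1 \<le> \<mu> * t\<^sup>2" "\<mu> * t\<^sup>2 \<le> 4" using assms(1) step_defect_eq_0 by (meson not_le)+
  thus "\<rho> / 2 \<le> t" "t \<le> \<rho>" using scaled_norm_gt_1D[OF _ assms(2)] scaled_norm_le_4D by blast+
qed

text \<open>The product of the two distances is below \<open>16 * r\<^sup>2\<close>, the root of
  \<open>R\<close>, so if one is at least \<open>\<rho> / 2\<close> the other is at most
  \<open>32 * r\<^sup>2 / \<rho>\<close>. The constant 40 in \<open>r'\<close> leaves room for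
  moving the centre from \<open>d\<close> to \<open>c l\<close>.\<close>

lemma g_neq_0D:
  assumes "g d x \<noteq> 0"
  shows "\<rho> / 2 \<le> cmod (coord l x - d) \<Longrightarrow> cmod (coord j x - c j) \<le> r'"
    and "\<rho> / 2 \<le> cmod (coord j x - c j) \<Longrightarrow> cmod (d - c l) \<le> 2 * \<rho> \<Longrightarrow> cmod (coord l x - c l) \<le> r'"
proof -
  let ?u = "cmod (coord j x - c j)" and ?v = "cmod (coord l x - d)"
  have "(cmod (w d x))\<^sup>2 < R" by (rule convex_flat_bump_arg_neq_0D[OF assms[unfolded g_def] pos(2)])
  also have "R = (16 * r\<^sup>2)\<^sup>2" by (simp add: R_def power2_eq_square power4_eq_xxxx)
  finally have "cmod (w d x) < 16 * r\<^sup>2" by (rule power2_less_imp_less) simp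
  hence uv: "?u * ?v < 16 * r\<^sup>2" by (simp add: w_def norm_mult)
  have r2: "r\<^sup>2 \<ge> 1" using r by (rule one_le_power)
  show "?u \<le> r'" if "\<rho> / 2 \<le> ?v"
  proof -
    have "?u * (\<rho> / 2) \<le> ?u * ?v" using that by (intro mult_left_mono) auto
    hence "?u * \<rho> \<le> 40 * r\<^sup>2" using uv r2 by linarith
    thus ?thesis using \<rho> by (simp add: r'_def pos_le_divide_eq)
  qed
  show "cmod (coord l x - c l) \<le> r'" if "\<rho> / 2 \<le> ?u" "cmod (d - c l) \<le> 2 * \<rho>"
  proof -
    have "(\<rho> / 2) * ?v \<le> ?u * ?v" using that by (intro mult_right_mono) auto
    hence v: "?v * \<rho> \<le> 32 * r\<^sup>2" using uv by (simp add: mult.commute)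
    have "cmod (coord l x - c l) \<le> ?v + cmod (d - c l)"
      using norm_triangle_ineq[of "coord l x - d" "d - c l"] by simp
    hence "cmod (coord l x - c l) * \<rho> \<le> (?v + 2 * \<rho>) * \<rho>"
      using that \<rho> by (intro mult_right_mono) auto
    also have "\<dots> \<le> 32 * r\<^sup>2 + 2 * (\<rho> * \<rho>)" using v by (simp add: algebra_simps)
    also have "\<dots> \<le> 40 * r\<^sup>2" using r2 mult_le_one[of \<rho> \<rho>] \<rho> by simp
    finally show ?thesis using \<rho> by (simp add: r'_def pos_le_divide_eq)
  qed
qed

lemma g_bounds: "0 \<le> g d x" "g d x \<le> R / \<sigma>"
  unfolding g_def using convex_flat_nonneg bump_arg_le[of R \<sigma> "w d" x] pos by auto

lemma smooth_real_g: "smooth_real (g d)"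
  unfolding g_def[abs_def] by (rule smooth_real_compose[OF smooth_real_convex_flat smooth_real_bump_arg[OF smooth_w pos(2)]])

lemma smooth_real_ab: "smooth_real a" "smooth_real (b d)"
  unfolding a_def b_def by (rule smooth_real_radial_step)+

lemma \<rho>12: "\<rho>\<^sub>1 k > 0" "\<rho>\<^sub>2 k > 0"
  using \<rho> pos \<tau> by (auto simp: \<rho>\<^sub>1_def \<rho>\<^sub>2_def)

text \<open>\<open>h\<close> and \<open>e\<close> lie between 0 and 1 and \<open>g\<close> is at
  most \<open>R / \<sigma>\<close>, so the nonnegative weight of \<open>D\<close> is at most
  \<open>(R / \<sigma>)\<^sup>2\<close>; the one-sided bound on \<open>D\<close> then
  suffices.\<close>

lemma error_bound:
  assumes "smooth_real e" "\<And>x. 0 \<le> e x" "\<And>x. e x \<le> 1" and D: "smooth_real D" "\<And>x. D x \<le> M * \<mu>"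
    and \<rho>': "\<And>k. \<rho>' k > 0" and supp: "\<And>x. h x \<noteq> 0 \<Longrightarrow> g d x \<noteq> 0 \<Longrightarrow> D x \<noteq> 0 \<Longrightarrow> x \<in> polydisc c \<rho>'"
  shows "mass i (\<lambda>x. \<kappa> x * ((h x * (g d x * e x))\<^sup>2 * D x)) \<le> M * \<mu> * (R / \<sigma>)\<^sup>2 * mass i (cutoff UNIV c \<rho>')"
proof (rule mass_le_cutoff)
  show "test_real (\<lambda>x. \<kappa> x * ((h x * (g d x * e x))\<^sup>2 * D x))"
    by (rule test_real_mult[OF test_\<kappa>])
       (intro smooth_real_mult smooth_real_power smooth_real_h smooth_real_g assms)
  show "0 \<le> M * \<mu> * (R / \<sigma>)\<^sup>2" using M pos by simp
  show "\<kappa> x * ((h x * (g d x * e x))\<^sup>2 * D x) \<le> M * \<mu> * (R / \<sigma>)\<^sup>2" for x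
  proof -
    have \<kappa>: "0 \<le> \<kappa> x" "\<kappa> x \<le> 1" unfolding \<kappa>_def by (rule cutoff_nonneg cutoff_le_1)+
    have "h x * (g d x * e x) \<le> 1 * (R / \<sigma> * 1)"
      using h_bounds g_bounds assms(2,3) pos by (intro mult_mono) (auto intro: mult_nonneg_nonneg)
    moreover have "0 \<le> h x * (g d x * e x)" using h_bounds g_bounds assms(2) by simp
    ultimately have sq: "(h x * (g d x * e x))\<^sup>2 \<le> (R / \<sigma>)\<^sup>2" by (intro power_mono) auto
    have "\<kappa> x * ((h x * (g d x * e x))\<^sup>2 * D x) = (\<kappa> x * (h x * (g d x * e x))\<^sup>2) * D x" by simp
    also have "\<dots> \<le> (\<kappa> x * (h x * (g d x * e x))\<^sup>2) * (M * \<mu>)"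
      using D(2) \<kappa> by (intro mult_left_mono) auto
    also have "\<dots> \<le> (1 * (R / \<sigma>)\<^sup>2) * (M * \<mu>)"
      using \<kappa> sq M pos by (intro mult_right_mono mult_mono) auto
    finally show ?thesis by (simp add: mult_ac)
  qed
  show "x \<in> polydisc c \<rho>'" if "\<kappa> x * ((h x * (g d x * e x))\<^sup>2 * D x) \<noteq> 0" for x
    using that supp by auto
qed (rule \<rho>')

text \<open>Up to the constant of \<open>bump_lower_bound\<close>, \<open>F\<close> lies below the
  weight on the left of \<open>basic_inequality\<close>. Positivity of the matrix carries this
  comparison of weights over to the pairings.\<close>

lemma pairing_bound:
  assumes d: "cmod (d - c l) \<le> 2 * \<rho>"
    and F: "smooth_real F" "\<And>x. F x \<le> (h x * (a x * b d x))\<^sup>2"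
      "\<And>x. F x > 0 \<Longrightarrow> cmod (coord j x - c j) \<le> 2 * r \<and> cmod (coord l x - d) \<le> 4 * r"
  shows "pair.pairing (\<lambda>p q x. of_real (F x) * W d p x * cnj (W d q x)) \<le>
    (R / (2 * exp (-2))) * (M * \<mu> * (R / \<sigma>)\<^sup>2) * (mass l (cutoff UNIV c \<rho>\<^sub>1) + mass j (cutoff UNIV c \<rho>\<^sub>2))"
proof -
  let ?G = "bump_laplacian R \<sigma> (w d)"
  let ?m = "2 * exp (-2) / R"
  let ?A = "\<lambda>x. \<mu> * step_defect (\<mu> * (cmod (coord j x - c j))\<^sup>2)" and ?B = "\<lambda>x. \<mu> * step_defect (\<mu> * (cmod (coord l x - d))\<^sup>2)"
  let ?\<phi> = "\<lambda>x. (complex_of_real (h x) * of_real (h x)) * ((of_real (a x) * of_real (b d x) * of_real (g d x)) * (of_real (a x) * of_real (b d x) * of_real (g d x)))"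
  let ?K = "polydisc c (\<lambda>k. if k = j \<or> k = l then r' else 2 * \<tau> k)"
  have m: "?m > 0" using pos by simp
  have sG: "smooth_real ?G" by (rule smooth_real_bump_laplacian[OF smooth_w pos(2)])
  have sD: "smooth_real step_defect"
    unfolding step_defect_def[abs_def]
    by (intro smooth_real_diff smooth_real_mult smooth_real_add smooth_real_const smooth_real_power
        smooth_real_ident smooth_real_deriv smooth_real_step)
  have sA: "smooth_real ?A" "smooth_real ?B"
    by (intro smooth_real_mult smooth_real_const smooth_real_compose[OF sD] smooth_real_norm_coord)+
  \<comment> \<open>The support of \<open>g\<close> alone is unbounded, as it contains the axes
    \<open>w = 0\<close>; the factors \<open>a\<close> and \<open>b\<close> cut the axes
    away.\<close>
  have \<phi>0: "?\<phi> x = 0" if "x \<notin> ?K" for x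
  proof (rule ccontr)
    assume "?\<phi> x \<noteq> 0"
    hence nz: "h x \<noteq> 0" "a x \<noteq> 0" "b d x \<noteq> 0" "g d x \<noteq> 0" by auto
    have "\<rho> / 2 \<le> cmod (coord j x - c j)" "\<rho> / 2 \<le> cmod (coord l x - d)"
      using nz radial_step_neq_0D unfolding a_def b_def by blast+
    hence "x \<in> ?K" using g_neq_0D[OF nz(4)] h_neq_0D[OF nz(1)] d by (auto simp: polydisc_def)
    thus False using that by simp
  qed
  have s\<phi>: "smooth ?\<phi>"
    by (intro smooth_mult smooth_real_h smooth_real_ab smooth_real_g)
  have t\<phi>: "test_function ?\<phi>"
    unfolding test_function_def using s\<phi> \<phi>0 compact_polydisc by blast
  \<comment> \<open>Inside the support of the test function \<open>\<kappa>\<close> is 1 and outside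
    it the derivatives vanish, so inserting \<open>\<kappa>\<close> changes nothing and
    pluriharmonicity passes to \<open>L\<close>.\<close>
  have "L p q (wirt (-1) p (wirt 1 q ?\<phi>)) = pair_functional j l p q (wirt (-1) p (wirt 1 q ?\<phi>))" for p q
  proof -
    have cl: "closed ?K" by (rule compact_imp_closed[OF compact_polydisc])
    have out: "wirt (-1) p (wirt 1 q ?\<phi>) x = 0" if "x \<notin> ?K" for x
      by (rule wirt_outside[OF cl wirt_outside[OF cl \<phi>0] that])
    have ins: "\<kappa> x = 1" if "x \<in> ?K" for x
      unfolding \<kappa>_def using that by (intro cutoff_eq_1) (auto simp: polydisc_def)
    have "(\<lambda>x. of_real (\<kappa> x) * wirt (-1) p (wirt 1 q ?\<phi>) x) = wirt (-1) p (wirt 1 q ?\<phi>)"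
    proof
      fix x
      show "of_real (\<kappa> x) * wirt (-1) p (wirt 1 q ?\<phi>) x = wirt (-1) p (wirt 1 q ?\<phi>) x"
      proof (cases "x \<in> ?K")
        case True
        show ?thesis by (simp only: ins[OF True] of_real_1 mult_1)
      next
        case False
        show ?thesis by (simp only: out[OF False] mult_zero_right)
      qed
    qed
    thus ?thesis unfolding L_def by simp
  qed
  hence ph: "(\<Sum>p\<in>{j, l}. \<Sum>q\<in>{j, l}. L p q (wirt (-1) p (wirt 1 q ?\<phi>))) = 0"
    using pair_functional_ddc[OF pluriharmonic jl t\<phi>] by simp
  have gd: "wirt (-1) p (wirt 1 q (\<lambda>x. complex_of_real (g d x))) = (\<lambda>x. of_real (?G x) * W d p x * cnj (W d q x))"
    if "p \<in> {j, l}" "q \<in> {j, l}" for p q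
    unfolding g_def ddc_bump[OF smooth_w pos(2) wirt_w(2) wirt_w(3)[OF that(2)]]
      wirt_w(1)[OF that(1)] wirt_w(1)[OF that(2)] ..
  have "pair.pairing (\<lambda>p q x. (((of_real (h x)) * of_real (a x * b d x))\<^sup>2 * of_real (g d x * ?G x)) * W d p x * cnj (W d q x)) \<le>
    Re (L j j (\<lambda>x. (of_real (h x) * of_real (g d x * b d x))\<^sup>2 * of_real (?A x))) + Re (L l l (\<lambda>x. (of_real (h x) * of_real (g d x * a x))\<^sup>2 * of_real (?B x)))"
  proof (rule pair.basic_inequality[OF smooth_real_h smooth_real_ab smooth_real_g _ wirt_h _ _ smooth_W sG gd _ _ ph])
    show "wirt s l (\<lambda>x. complex_of_real (a x)) = (\<lambda>x. 0)" "wirt s j (\<lambda>x. complex_of_real (b d x)) = (\<lambda>x. 0)" for s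
      unfolding a_def b_def using jl by (auto intro!: wirt_radial_step_other)
  qed (simp_all only: a_def b_def radial_step_defect complex_cnj_complex_of_real)
  also have "Re (L j j (\<lambda>x. (of_real (h x) * of_real (g d x * b d x))\<^sup>2 * of_real (?A x))) = mass l (\<lambda>x. \<kappa> x * ((h x * (g d x * b d x))\<^sup>2 * ?A x))"
    using L_diag(1)[of "\<lambda>x. (h x * (g d x * b d x))\<^sup>2 * ?A x"] by simp
  also have "\<dots> \<le> M * \<mu> * (R / \<sigma>)\<^sup>2 * mass l (cutoff UNIV c \<rho>\<^sub>1)"
  proof (rule error_bound[OF smooth_real_ab(2) _ _ sA(1) _ \<rho>12(1)])
    show "?A x \<le> M * \<mu>" for x using M(2) pos by (simp add: mult.commute)
    show "x \<in> polydisc c \<rho>\<^sub>1" if "h x \<noteq> 0" "g d x \<noteq> 0" "?A x \<noteq> 0" for x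
    proof -
      have "step_defect (\<mu> * (cmod (coord j x - c j))\<^sup>2) \<noteq> 0" using that by auto
      from step_defect_neq_0D[OF this norm_ge_zero] show ?thesis
        using g_neq_0D(2)[OF that(2) _ d] h_neq_0D[OF that(1)] by (auto simp: polydisc_def \<rho>\<^sub>1_def)
    qed
  qed (simp_all add: b_def radial_step_bounds)
  also have "Re (L l l (\<lambda>x. (of_real (h x) * of_real (g d x * a x))\<^sup>2 * of_real (?B x))) = mass j (\<lambda>x. \<kappa> x * ((h x * (g d x * a x))\<^sup>2 * ?B x))"
    using L_diag(2)[of "\<lambda>x. (h x * (g d x * a x))\<^sup>2 * ?B x"] by simp
  also have "\<dots> \<le> M * \<mu> * (R / \<sigma>)\<^sup>2 * mass j (cutoff UNIV c \<rho>\<^sub>2)"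
  proof (rule error_bound[OF smooth_real_ab(1) _ _ sA(2) _ \<rho>12(2)])
    show "?B x \<le> M * \<mu>" for x using M(2) pos by (simp add: mult.commute)
    show "x \<in> polydisc c \<rho>\<^sub>2" if "h x \<noteq> 0" "g d x \<noteq> 0" "?B x \<noteq> 0" for x
    proof -
      have "step_defect (\<mu> * (cmod (coord l x - d))\<^sup>2) \<noteq> 0" using that by auto
      note v = step_defect_neq_0D[OF this norm_ge_zero]
      have "cmod (coord l x - c l) \<le> cmod (coord l x - d) + cmod (d - c l)"
        using norm_triangle_ineq[of "coord l x - d" "d - c l"] by simp
      hence "cmod (coord l x - c l) \<le> 3 * \<rho>" using v d by linarith
      thus ?thesis
        using g_neq_0D(1)[OF that(2) v(1)] h_neq_0D[OF that(1)] by (auto simp: polydisc_def \<rho>\<^sub>2_def)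
    qed
  qed (simp_all add: a_def radial_step_bounds)
  finally have main: "pair.pairing (\<lambda>p q x. (((of_real (h x)) * of_real (a x * b d x))\<^sup>2 * of_real (g d x * ?G x)) * W d p x * cnj (W d q x)) \<le>
    M * \<mu> * (R / \<sigma>)\<^sup>2 * (mass l (cutoff UNIV c \<rho>\<^sub>1) + mass j (cutoff UNIV c \<rho>\<^sub>2))"
    by (simp add: algebra_simps)
  \<comment> \<open>Near the axes the Laplacian may be negative, but there the weight is 0 and
    \<open>F\<close> is not positive. Away from them its sign settles the points with
    \<open>F x \<le> 0\<close>, and the quantitative bound is called for only where \<open>F\<close>
    is positive.\<close>
  have lower: "?m * F x \<le> (h x * (a x * b d x))\<^sup>2 * (g d x * ?G x)" for x
  proof (cases "a x = 0 \<or> b d x = 0")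
    case True
    hence "F x \<le> 0" using F(2)[of x] by auto
    hence "?m * F x \<le> 0" by (rule mult_nonneg_nonpos[OF less_imp_le[OF m]])
    thus ?thesis using True by auto
  next
    case False
    hence uv: "\<rho> / 2 \<le> cmod (coord j x - c j)" "\<rho> / 2 \<le> cmod (coord l x - d)"
      using radial_step_neq_0D unfolding a_def b_def by blast+
    \<comment> \<open>Both distances are at least \<open>\<rho> / 2\<close>, hence
      \<open>|w|^2 \<ge> \<rho>^4 / 16\<close>; \<open>\<sigma>\<close> is chosen as half of
      this.\<close>
    have "(\<rho> / 2) * (\<rho> / 2) \<le> cmod (coord j x - c j) * cmod (coord l x - d)"
      using uv \<rho> by (intro mult_mono) auto
    hence "((\<rho> / 2) * (\<rho> / 2))\<^sup>2 \<le> (cmod (w d x))\<^sup>2"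
      by (intro power_mono) (auto simp: w_def norm_mult)
    hence s: "2 * \<sigma> \<le> (cmod (w d x))\<^sup>2" by (simp add: \<sigma>_def power2_eq_square power4_eq_xxxx)
    have G0: "0 \<le> ?G x" by (rule bump_laplacian_nonneg[where w = "w d", OF pos(2) s]) (use pos in simp)
    show ?thesis
    proof (cases "F x > 0")
      case True
      \<comment> \<open>Here \<open>|w|^2\<close> is at most \<open>64 * r ^ 4\<close>, and
        \<open>R\<close> is four times this value, as \<open>bump_lower_bound\<close>
        requires.\<close>
      from F(3)[OF this] have "cmod (w d x) \<le> (2 * r) * (4 * r)"
        unfolding w_def norm_mult using r by (intro mult_mono) auto
      hence "(cmod (w d x))\<^sup>2 \<le> ((2 * r) * (4 * r))\<^sup>2" by (intro power_mono) auto
      also have "\<dots> = R / 4" by (simp add: R_def power2_eq_square power4_eq_xxxx)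
      finally have "?m \<le> g d x * ?G x"
        unfolding g_def by (rule bump_lower_bound[where w = "w d" and x = x, OF pos(2) s])
      hence "F x * ?m \<le> (h x * (a x * b d x))\<^sup>2 * (g d x * ?G x)"
        using F(2)[of x] m True by (intro mult_mono) auto
      thus ?thesis by (simp only: mult.commute)
    next
      case False
      hence "F x \<le> 0" by simp
      hence "?m * F x \<le> 0" by (rule mult_nonneg_nonpos[OF less_imp_le[OF m]])
      also have "0 \<le> (h x * (a x * b d x))\<^sup>2 * (g d x * ?G x)" using G0 g_bounds by simp
      finally show ?thesis .
    qed
  qed
  have "?m * pair.pairing (\<lambda>p q x. of_real (F x) * W d p x * cnj (W d q x)) =
    pair.pairing (\<lambda>p q x. of_real ?m * (of_real (F x) * W d p x * cnj (W d q x)))"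
    by (rule pair.pairing_scale[symmetric]) (intro smooth_mult smooth_cnj smooth_W F(1))
  also have "\<dots> = pair.pairing (\<lambda>p q x. of_real (?m * F x) * W d p x * cnj (W d q x))"
    by (simp add: mult.assoc)
  also have "\<dots> \<le> pair.pairing (\<lambda>p q x. of_real ((h x * (a x * b d x))\<^sup>2 * (g d x * ?G x)) * W d p x * cnj (W d q x))"
    by (rule pair.pairing_mono[OF _ _ lower smooth_W])
       (intro smooth_real_mult smooth_real_const F(1) smooth_real_power smooth_real_h smooth_real_ab smooth_real_g sG)+
  also have "\<dots> \<le> M * \<mu> * (R / \<sigma>)\<^sup>2 * (mass l (cutoff UNIV c \<rho>\<^sub>1) + mass j (cutoff UNIV c \<rho>\<^sub>2))"
    using main by (simp add: mult.assoc)
  finally show ?thesis using m pos by (simp add: field_simps)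
qed

definition "K = (R / (2 * exp (-2))) * (M * \<mu> * (R / \<sigma>)\<^sup>2)"

lemma rr': "2 * r \<le> r'"
proof -
  have "2 * r * \<rho> \<le> 2 * r * 1" using r \<rho> by (intro mult_left_mono) auto
  also have "\<dots> \<le> 40 * r\<^sup>2" using r self_le_power[of r 2] by simp
  finally show ?thesis using \<rho> by (simp add: r'_def pos_le_divide_eq)
qed

text \<open>The forms \<open>dw\<close> for the two centres differ by \<open>(d' - d) du\<close>, so
  \<open>parallelogram\<close> converts two bounds against \<open>dw\<close> into one against
  \<open>du\<close>, which is the mass with missing coordinate \<open>l\<close>. The separation of
  the centres keeps the factor \<open>|d' - d|^2\<close> away from 0.\<close>

lemma mass_pair_bound:
  assumes d: "cmod (d - c l) \<le> 2 * \<rho>" "cmod (d' - c l) \<le> 2 * \<rho>" "2 * \<rho> \<le> cmod (d - d')"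
    and F: "smooth_real F" "\<And>x. 0 \<le> F x" "\<And>x. F x \<le> (h x * (a x * b d x))\<^sup>2" "\<And>x. F x \<le> (h x * (a x * b d' x))\<^sup>2"
      "\<And>x. F x > 0 \<Longrightarrow> cmod (coord j x - c j) \<le> 2 * r \<and> cmod (coord l x - c l) \<le> 2 * r"
  shows "test_real F"
    and "mass l F \<le> K / \<rho>\<^sup>2 * (mass l (cutoff UNIV c \<rho>\<^sub>1) + mass j (cutoff UNIV c \<rho>\<^sub>2))"
proof -
  let ?E = "mass l (cutoff UNIV c \<rho>\<^sub>1) + mass j (cutoff UNIV c \<rho>\<^sub>2)"
  have F\<kappa>: "\<kappa> x * F x = F x" for x
  proof (cases "F x > 0")
    case True
    hence "h x \<noteq> 0" using F(3)[of x] by auto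
    hence "\<kappa> x = 1" unfolding \<kappa>_def using F(5)[OF True] h_neq_0D[of x] rr'
      by (intro cutoff_eq_1) (auto intro: order_trans)
    thus ?thesis by simp
  next
    case False
    thus ?thesis using F(2)[of x] by simp
  qed
  show t: "test_real F"
    using test_real_mult[OF test_\<kappa> F(1)] by (simp only: F\<kappa>)
  have near: "cmod (coord l x - e) \<le> 4 * r" if "cmod (coord l x - c l) \<le> 2 * r" "cmod (e - c l) \<le> 2 * \<rho>" for x e
  proof -
    have "cmod (coord l x - e) \<le> cmod (coord l x - c l) + cmod (e - c l)"
      using norm_triangle_ineq4[of "coord l x - c l" "e - c l"] by simp
    thus ?thesis using that \<rho> r by linarith
  qed
  have P: "pair.pairing (\<lambda>p q x. of_real (F x) * W e p x * cnj (W e q x)) \<le> K * ?E"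
    if "cmod (e - c l) \<le> 2 * \<rho>" "\<And>x. F x \<le> (h x * (a x * b e x))\<^sup>2" for e
    unfolding K_def using near[OF _ that(1)] F(5) by (intro pairing_bound[OF that(1) F(1) that(2)]) blast
  let ?\<Delta> = "(cmod (d' - d))\<^sup>2"
  let ?D = "\<lambda>p q x. of_real (F x) * (W d p x - W d' p x) * cnj (W d q x - W d' q x)"
  have s: "smooth (\<lambda>x. W e p x)" for e p using smooth_W .
  have "pair.pairing ?D \<le> 2 * pair.pairing (\<lambda>p q x. of_real (F x) * W d p x * cnj (W d q x))
      + 2 * pair.pairing (\<lambda>p q x. of_real (F x) * W d' p x * cnj (W d' q x))"
    by (rule pair.parallelogram[OF F(1,2) s s])
  also have "\<dots> \<le> 4 * (K * ?E)" using P[OF d(1) F(3)] P[OF d(2) F(4)] by linarith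
  finally have "pair.pairing ?D \<le> 4 * (K * ?E)" .
  moreover have "pair.pairing ?D = ?\<Delta> * mass l F"
  proof -
    have jj: "?D j j = (\<lambda>x. of_real ?\<Delta> * of_real (F x))"
    proof
      fix x
      have "W d j x - W d' j x = d' - d" by (simp add: W_def)
      thus "?D j j x = of_real ?\<Delta> * of_real (F x)"
        by (simp only: complex_norm_square mult_ac)
    qed
    have "pair.pairing ?D = Re (L j j (?D j j))"
      unfolding pair.pairing_def using jl jl[symmetric] by (simp add: W_def pair.L_zero)
    also have "\<dots> = ?\<Delta> * Re (L j j (\<lambda>x. of_real (F x)))"
      unfolding jj using pair.L_scale[OF F(1), of j j "of_real ?\<Delta>"] by (simp only: Re_complex_of_real) simp
    also have "\<dots> = ?\<Delta> * mass l F" by (simp only: L_diag F\<kappa>)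
    finally show ?thesis .
  qed
  moreover have "(2 * \<rho>)\<^sup>2 * mass l F \<le> ?\<Delta> * mass l F"
    using d(3) \<rho> mass_nonneg[OF t F(2)]
    by (intro mult_right_mono power_mono) (auto simp: norm_minus_commute)
  ultimately have "\<rho>\<^sup>2 * mass l F \<le> K * ?E" by (simp add: power_mult_distrib)
  thus "mass l F \<le> K / \<rho>\<^sup>2 * ?E" using \<rho> by (simp add: field_simps)
qed

text \<open>One pair of centres gives no information near either of them. Among three centres every
  point keeps away from both members of some pair; the part near \<open>u = c\<close> is dominated
  directly by the cutoff with radii \<open>\<rho>\<^sub>1\<close>.\<close>

lemma mass_step:
  defines "f \<equiv> cutoff UNIV c (\<lambda>k. if k = j \<or> k = l then r else \<tau> k / 2)"
  shows "mass l f \<le> mass l (cutoff UNIV c \<rho>\<^sub>1) + 3 * (K / \<rho>\<^sup>2 * (mass l (cutoff UNIV c \<rho>\<^sub>1) + mass j (cutoff UNIV c \<rho>\<^sub>2)))"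
proof -
  \<comment> \<open>For indices 0, 1 and -1 these centres are within \<open>2 * \<rho>\<close> of
    \<open>c l\<close> and at least \<open>2 * \<rho>\<close> apart, the two conditions of
    \<open>mass_pair_bound\<close>.\<close>
  define e where "e i = c l + of_real (2 * \<rho> * i)" for i :: real
  have test_f: "test_real f" unfolding f_def by (rule test_function_cutoff) (use r \<tau> in auto)
  hence smooth_f: "smooth_real f" by (rule test_function_smooth)
  have f01: "0 \<le> f x" "f x \<le> 1" for x unfolding f_def by (rule cutoff_nonneg cutoff_le_1)+
  have f_supp: "cmod (coord j x - c j) \<le> 2 * r" "cmod (coord l x - c l) \<le> 2 * r"
    "k \<noteq> j \<Longrightarrow> k \<noteq> l \<Longrightarrow> cmod (coord k x - c k) \<le> \<tau> k" if "f x \<noteq> 0" for x k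
  proof -
    let ?\<rho> = "\<lambda>k. if k = j \<or> k = l then r else \<tau> k / 2"
    have "cmod (coord k x - c k) \<le> 2 * ?\<rho> k" for k
      by (rule cutoff_neq_0D[OF that[unfolded f_def]]) (use r \<tau> in auto)
    from this[of j] this[of l] this[of k] show "cmod (coord j x - c j) \<le> 2 * r" "cmod (coord l x - c l) \<le> 2 * r"
      "k \<noteq> j \<Longrightarrow> k \<noteq> l \<Longrightarrow> cmod (coord k x - c k) \<le> \<tau> k" by auto
  qed
  have h1: "h x = 1" if "f x \<noteq> 0" for x
    unfolding h_def using f_supp(3)[OF that] by (intro cutoff_eq_1) auto
  have ab: "0 \<le> a x" "a x \<le> 1" "0 \<le> b d x" "b d x \<le> 1" for x d
    unfolding a_def b_def by (rule radial_step_bounds)+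
  \<comment> \<open>All factors lie between 0 and 1, and \<open>h\<close> is 1 on the support of
    \<open>f\<close>, so the product is below the weights of both centres; unlike a minimum it stays
    smooth.\<close>
  define F where "F s t x = f x * (a x)\<^sup>2 * ((b (e s) x)\<^sup>2 * (b (e t) x)\<^sup>2)" for s t x
  have F: "smooth_real (F s t)" for s t
    unfolding F_def[abs_def] by (intro smooth_real_mult smooth_real_power smooth_f smooth_real_ab)
  have F0: "0 \<le> F s t x" for s t x unfolding F_def using f01 by simp
  have Fle: "F s t x \<le> (h x * (a x * b (e s) x))\<^sup>2" for s t x
  proof (cases "f x = 0")
    case False
    have "F s t x = f x * (b (e t) x)\<^sup>2 * ((a x)\<^sup>2 * (b (e s) x)\<^sup>2)" by (simp add: F_def mult_ac)
    also have "\<dots> \<le> 1 * 1 * ((a x)\<^sup>2 * (b (e s) x)\<^sup>2)"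
      using f01 ab by (intro mult_right_mono mult_mono) (auto simp: power_le_one)
    finally show ?thesis by (simp add: h1[OF False] power_mult_distrib)
  qed (simp add: F_def)
  have Fcomm: "F s t = F t s" for s t by (simp add: F_def fun_eq_iff mult_ac)
  have Fle': "F s t x \<le> (h x * (a x * b (e t) x))\<^sup>2" for s t x
    using Fle[of t s x] by (simp add: Fcomm[of s t])
  have dist_e: "cmod (e s - e t) = 2 * \<rho> * \<bar>s - t\<bar>" for s t
  proof -
    have "e s - e t = of_real (2 * \<rho> * (s - t))" by (simp add: e_def algebra_simps)
    thus ?thesis using \<rho> by (simp only: norm_of_real) (simp add: abs_mult)
  qed
  have e_near: "cmod (e s - c l) = 2 * \<rho> * \<bar>s\<bar>" for s
  proof -
    have "e s - c l = of_real (2 * \<rho> * s)" by (simp add: e_def)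
    thus ?thesis using \<rho> by (simp only: norm_of_real) (simp add: abs_mult)
  qed
  let ?E = "K / \<rho>\<^sup>2 * (mass l (cutoff UNIV c \<rho>\<^sub>1) + mass j (cutoff UNIV c \<rho>\<^sub>2))"
  have FE: "test_real (F s t)" "mass l (F s t) \<le> ?E" if "\<bar>s\<bar> \<le> 1" "\<bar>t\<bar> \<le> 1" "\<bar>s - t\<bar> \<ge> 1" for s t
  proof -
    have e: "cmod (e s - c l) \<le> 2 * \<rho>" "cmod (e t - c l) \<le> 2 * \<rho>" "2 * \<rho> \<le> cmod (e s - e t)"
      unfolding dist_e e_near using that \<rho> by (simp_all add: mult_left_le)
    have supp: "cmod (coord j x - c j) \<le> 2 * r \<and> cmod (coord l x - c l) \<le> 2 * r" if "F s t x > 0" for x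
    proof -
      have "f x \<noteq> 0" using that by (auto simp: F_def)
      thus ?thesis using f_supp by blast
    qed
    show "test_real (F s t)" "mass l (F s t) \<le> ?E"
      using mass_pair_bound[OF e F F0 Fle Fle' supp] by auto
  qed
  define f0 where "f0 x = f x * (1 - (a x)\<^sup>2)" for x
  have test_f0: "test_real f0"
    unfolding f0_def[abs_def]
    by (intro test_real_mult test_f smooth_real_diff smooth_real_const smooth_real_power smooth_real_ab)
  have f0: "mass l f0 \<le> 1 * mass l (cutoff UNIV c \<rho>\<^sub>1)"
  proof (rule mass_le_cutoff[OF test_f0 _ _ \<rho>12(1)])
    show "f0 x \<le> 1" for x
      unfolding f0_def using f01[of x] ab(1,2)[of x] by (intro mult_le_one) (auto simp: power_le_one)
    show "x \<in> polydisc c \<rho>\<^sub>1" if "f0 x \<noteq> 0" for x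
    proof -
      have nz: "f x \<noteq> 0" "a x \<noteq> 1" using that by (auto simp: f0_def)
      have "cmod (coord j x - c j) \<le> \<rho>"
        using radial_step_eq_1[where k = j and x = x and e = "c j"] nz(2) unfolding a_def by (meson linear)
      moreover note rr'
      moreover have "cmod (coord k x - c k) \<le> 2 * \<tau> k" if "k \<noteq> j" "k \<noteq> l" for k
        using f_supp(3)[OF nz(1) that] \<tau>[of k] by linarith
      ultimately show ?thesis
        using f_supp(2)[OF nz(1)] jl by (auto simp: polydisc_def \<rho>\<^sub>1_def)
    qed
  qed simp
  \<comment> \<open>The three discs around the centres \<open>e 0\<close>, \<open>e 1\<close>, \<open>e (-1)\<close> are disjoint, so at most one \<open>b\<close> differs from 1.\<close>
  have fle: "f x \<le> f0 x + F 0 1 x + F 0 (-1) x + F 1 (-1) x" for x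
  proof -
    have b1: "b (e s) x = 1 \<or> b (e t) x = 1" if "\<bar>s - t\<bar> \<ge> 1" for s t
    proof (rule ccontr)
      assume "\<not> (b (e s) x = 1 \<or> b (e t) x = 1)"
      hence "cmod (coord l x - e s) < \<rho>" "cmod (coord l x - e t) < \<rho>"
        unfolding b_def using radial_step_eq_1 by (meson not_le)+
      moreover have "cmod (e s - e t) \<le> cmod (coord l x - e t) + cmod (coord l x - e s)"
        using norm_triangle_ineq4[of "coord l x - e t" "coord l x - e s"] by simp
      ultimately have "2 * \<rho> * \<bar>s - t\<bar> < 2 * \<rho> * 1" unfolding dist_e by linarith
      thus False using that \<rho> by simp
    qed
    have "b (e 0) x = 1 \<and> b (e 1) x = 1 \<or> b (e 0) x = 1 \<and> b (e (-1)) x = 1 \<or> b (e 1) x = 1 \<and> b (e (-1)) x = 1"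
      using b1[of 0 1] b1[of 0 "-1"] b1[of 1 "-1"] by auto
    hence "F 0 1 x = f x * (a x)\<^sup>2 \<or> F 0 (-1) x = f x * (a x)\<^sup>2 \<or> F 1 (-1) x = f x * (a x)\<^sup>2"
      by (auto simp: F_def)
    moreover have "f x = f0 x + f x * (a x)\<^sup>2" by (simp add: f0_def algebra_simps)
    ultimately show ?thesis using F0[of 0 1 x] F0[of 0 "-1" x] F0[of 1 "-1" x] by auto
  qed
  have t1: "test_real (F 0 1)" "test_real (F 0 (-1))" "test_real (F 1 (-1))" by (intro FE(1); simp)+
  have t2: "test_real (\<lambda>x. f0 x + F 0 1 x)" using test_function_add[OF test_f0 t1(1)] by simp
  have t3: "test_real (\<lambda>x. f0 x + F 0 1 x + F 0 (-1) x)" using test_function_add[OF t2 t1(2)] by simp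
  have t4: "test_real (\<lambda>x. f0 x + F 0 1 x + F 0 (-1) x + F 1 (-1) x)" using test_function_add[OF t3 t1(3)] by simp
  have "mass l f \<le> mass l (\<lambda>x. f0 x + F 0 1 x + F 0 (-1) x + F 1 (-1) x)"
    by (rule mass_mono[OF test_f t4 fle])
  also have "\<dots> = mass l f0 + mass l (F 0 1) + mass l (F 0 (-1)) + mass l (F 1 (-1))"
    using mass_add[OF t3 t1(3)] mass_add[OF t2 t1(2)] mass_add[OF test_f0 t1(1)] by simp
  also have "\<dots> \<le> mass l (cutoff UNIV c \<rho>\<^sub>1) + ?E + ?E + ?E"
    using f0 FE(2)[of 0 1] FE(2)[of 0 "-1"] FE(2)[of 1 "-1"] by (intro add_mono) auto
  finally show ?thesis by simp
qed

end

subsection \<open>Propagation of polynomial growth\<close>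

context ph_current
begin

definition radii :: "('n + 'm) set \<Rightarrow> real \<Rightarrow> real \<Rightarrow> 'n + 'm \<Rightarrow> real" where
  "radii W \<delta> r k = (if k \<in> W then r else \<delta>)"

text \<open>Coordinates in \<open>W\<close> run over growing discs, the others over a fixed small
  one. The width \<open>\<delta>\<close> is existential because every propagation step returns a
  smaller one.\<close>

definition poly_mass :: "('n + 'm \<Rightarrow> complex) \<Rightarrow> ('n + 'm) set \<Rightarrow> 'n + 'm \<Rightarrow> bool" where
  "poly_mass c W i \<longleftrightarrow> (\<exists>\<delta>>0. \<exists>C n. \<forall>r\<ge>1. mass i (cutoff UNIV c (radii W \<delta> r)) \<le> C * r ^ n)"

lemma cutoff_supp_polydisc:
  assumes "\<And>k. \<rho> k > 0" "\<And>k. 2 * \<rho> k \<le> \<rho>' k" "cutoff UNIV c \<rho> x \<noteq> 0"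
  shows "x \<in> polydisc c \<rho>'"
  using cutoff_neq_0D[OF assms(3) UNIV_I assms(1)] assms(2) unfolding polydisc_def by (auto intro: order_trans)

lemma mass_cutoff_mono:
  assumes "\<And>k. \<rho> k > 0" "\<And>k. 2 * \<rho> k \<le> \<rho>' k"
  shows "mass i (cutoff UNIV c \<rho>) \<le> mass i (cutoff UNIV c \<rho>')"
proof -
  have \<rho>': "\<rho>' k > 0" for k using assms[of k] by linarith
  have "mass i (cutoff UNIV c \<rho>) \<le> 1 * mass i (cutoff UNIV c \<rho>')"
    by (rule mass_le_cutoff[OF test_function_cutoff[OF assms(1)] cutoff_le_1 _ \<rho>' cutoff_supp_polydisc[OF assms]]) simp_all
  thus ?thesis by simp
qed

text \<open>\<open>mass_step\<close> with \<open>\<rho>\<close> fixed and \<open>r\<close> growing.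
  Passing to radii of order \<open>r' = 40 * r\<^sup>2 / \<rho>\<close> doubles the degrees of the
  known bounds, and the constant contains \<open>R ^ 3\<close>, which adds degree 12.\<close>

lemma poly_mass_step:
  assumes jl: "j \<noteq> l" "j \<in> W" "l \<in> W"
    and l: "poly_mass c (W - {j}) l" and j: "poly_mass c (W - {l}) j"
  shows "poly_mass c W l"
proof -
  obtain \<delta>1 C1 n1 where 1: "\<delta>1 > 0" "\<And>r. r \<ge> 1 \<Longrightarrow> mass l (cutoff UNIV c (radii (W - {j}) \<delta>1 r)) \<le> C1 * r ^ n1"
    using l unfolding poly_mass_def by blast
  obtain \<delta>2 C2 n2 where 2: "\<delta>2 > 0" "\<And>r. r \<ge> 1 \<Longrightarrow> mass j (cutoff UNIV c (radii (W - {l}) \<delta>2 r)) \<le> C2 * r ^ n2"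
    using j unfolding poly_mass_def by blast
  obtain M where M: "M > 0" "\<And>v. step_defect v \<le> M" using step_defect_bounded by blast
  \<comment> \<open>The largest fixed radius to be covered is \<open>3 * \<rho>\<close>, and
    \<open>mass_cutoff_mono\<close> costs another factor 2.\<close>
  define \<rho> where "\<rho> = min 1 (min \<delta>1 \<delta>2) / 6"
  have \<rho>: "0 < \<rho>" "\<rho> \<le> 1" "6 * \<rho> \<le> \<delta>1" "6 * \<rho> \<le> \<delta>2" using 1(1) 2(1) by (auto simp: \<rho>_def)
  define k1 where "k1 = \<bar>C1\<bar> * (80 / \<rho>) ^ n1"
  define k2 where "k2 = \<bar>C2\<bar> * (80 / \<rho>) ^ n2"
  define A where "A = 3 * (256 ^ 3 / (2 * exp (-2)) * (M * (4 / \<rho>\<^sup>2)) / (\<rho> ^ 4 / 32)\<^sup>2 / \<rho>\<^sup>2)"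
  have nn: "k1 \<ge> 0" "k2 \<ge> 0" "A \<ge> 0" using \<rho> M by (auto simp: k1_def k2_def A_def)
  have "mass l (cutoff UNIV c (radii W (\<rho> / 4) r)) \<le> (k1 + A * (k1 + k2)) * r ^ (12 + 2 * n1 + 2 * n2)"
    if r: "r \<ge> 1" for r
  proof -
    \<comment> \<open>Doubled because the cutoff bounded in \<open>mass_step\<close> has radii
      \<open>\<tau> k / 2\<close> in the remaining coordinates.\<close>
    define \<tau> where "\<tau> k = 2 * radii W (\<rho> / 4) r k" for k
    have \<tau>: "\<tau> k > 0" for k using r \<rho> by (simp add: \<tau>_def radii_def)
    interpret S: mass_setting T j l c \<tau> \<rho> r M
      by unfold_locales (use jl \<tau> \<rho> r M in auto)
    let ?r = "2 * S.r'"
    have r2: "r \<le> r\<^sup>2" using self_le_power[of r 2] r by simp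
    have "r * \<rho> \<le> r * 1" using r \<rho> by (intro mult_left_mono) auto
    also have "40 * (r * 1) \<le> 40 * r\<^sup>2" using r2 by simp
    finally have r': "40 * r \<le> S.r'" using \<rho> unfolding S.r'_def by (simp add: pos_le_divide_eq)
    have r1: "?r \<ge> 1" using r r' by linarith
    have f: "(\<lambda>k. if k = j \<or> k = l then r else \<tau> k / 2) = radii W (\<rho> / 4) r"
      using jl by (auto simp: radii_def \<tau>_def fun_eq_iff)
    have m1: "mass l (cutoff UNIV c S.\<rho>\<^sub>1) \<le> k1 * r ^ (2 * n1)"
    proof -
      have "mass l (cutoff UNIV c S.\<rho>\<^sub>1) \<le> mass l (cutoff UNIV c (radii (W - {j}) \<delta>1 ?r))"
        by (rule mass_cutoff_mono[OF S.\<rho>12(1)])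
           (use \<rho> r r' jl in \<open>auto simp: S.\<rho>\<^sub>1_def radii_def \<tau>_def\<close>)
      also have "\<dots> \<le> C1 * ?r ^ n1" by (rule 1(2)[OF r1])
      also have "\<dots> \<le> \<bar>C1\<bar> * ?r ^ n1" using r1 by (intro mult_right_mono) auto
      also have "\<dots> = k1 * r ^ (2 * n1)"
        by (simp add: k1_def S.r'_def power_mult_distrib power_divide power_mult)
      finally show ?thesis .
    qed
    have m2: "mass j (cutoff UNIV c S.\<rho>\<^sub>2) \<le> k2 * r ^ (2 * n2)"
    proof -
      have "mass j (cutoff UNIV c S.\<rho>\<^sub>2) \<le> mass j (cutoff UNIV c (radii (W - {l}) \<delta>2 ?r))"
        by (rule mass_cutoff_mono[OF S.\<rho>12(2)])
           (use \<rho> r r' jl in \<open>auto simp: S.\<rho>\<^sub>2_def radii_def \<tau>_def\<close>)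
      also have "\<dots> \<le> C2 * ?r ^ n2" by (rule 2(2)[OF r1])
      also have "\<dots> \<le> \<bar>C2\<bar> * ?r ^ n2" using r1 by (intro mult_right_mono) auto
      also have "\<dots> = k2 * r ^ (2 * n2)"
        by (simp add: k2_def S.r'_def power_mult_distrib power_divide power_mult)
      finally show ?thesis .
    qed
    have K: "3 * (S.K / \<rho>\<^sup>2) = A * r ^ 12"
    proof -
      have "S.R ^ 3 = 256 ^ 3 * r ^ 12"
        by (simp only: S.R_def power_mult_distrib power_mult[symmetric]) simp
      moreover have "S.K = S.R ^ 3 / (2 * exp (-2)) * (M * (4 / \<rho>\<^sup>2)) / (\<rho> ^ 4 / 32)\<^sup>2"
        by (simp add: S.K_def S.\<mu>_def S.\<sigma>_def power2_eq_square power3_eq_cube)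
      ultimately show ?thesis by (simp add: A_def)
    qed
    have mono: "r ^ p \<le> r ^ (12 + 2 * n1 + 2 * n2)" if "p \<le> 12 + 2 * n1 + 2 * n2" for p
      using r that by (rule power_increasing[rotated])
    have "mass l (cutoff UNIV c (radii W (\<rho> / 4) r)) \<le> mass l (cutoff UNIV c S.\<rho>\<^sub>1)
        + 3 * (S.K / \<rho>\<^sup>2 * (mass l (cutoff UNIV c S.\<rho>\<^sub>1) + mass j (cutoff UNIV c S.\<rho>\<^sub>2)))"
      using S.mass_step unfolding f .
    also have "\<dots> = mass l (cutoff UNIV c S.\<rho>\<^sub>1)
        + A * r ^ 12 * (mass l (cutoff UNIV c S.\<rho>\<^sub>1) + mass j (cutoff UNIV c S.\<rho>\<^sub>2))"
      unfolding K[symmetric] by simp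
    also have "\<dots> \<le> k1 * r ^ (2 * n1) + A * r ^ 12 * (k1 * r ^ (2 * n1) + k2 * r ^ (2 * n2))"
      using m1 m2 nn r by (intro add_mono mult_left_mono) auto
    also have "\<dots> = k1 * r ^ (2 * n1) + (A * k1 * r ^ (12 + 2 * n1) + A * k2 * r ^ (12 + 2 * n2))"
      by (simp add: algebra_simps power_add)
    also have "\<dots> \<le> k1 * r ^ (12 + 2 * n1 + 2 * n2) + (A * k1 * r ^ (12 + 2 * n1 + 2 * n2) + A * k2 * r ^ (12 + 2 * n1 + 2 * n2))"
      using nn mono[of "2 * n1"] mono[of "12 + 2 * n1"] mono[of "12 + 2 * n2"]
      by (intro add_mono mult_left_mono) auto
    finally show ?thesis by (simp add: algebra_simps)
  qed
  thus ?thesis unfolding poly_mass_def using \<rho>(1) by (metis zero_less_divide_iff zero_less_numeral)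
qed

text \<open>A set not contained in one factor meets both, hence has an element \<open>j\<close>
  besides \<open>i\<close>. The two masses that \<open>poly_mass_step\<close> asks for live on
  \<open>W\<close> with one of the pair removed and are indexed by the other, so the condition
  \<open>i \<in> W\<close> survives the induction on \<open>card W\<close>.\<close>

lemma poly_mass_all:
  assumes "\<And>W i. W \<subseteq> range Inl \<Longrightarrow> i \<in> W \<Longrightarrow> poly_mass c W i"
    and "\<And>W i. W \<subseteq> range Inr \<Longrightarrow> i \<in> W \<Longrightarrow> poly_mass c W i"
  shows "i \<in> W \<Longrightarrow> poly_mass c W i"
proof (induction "card W" arbitrary: W i rule: less_induct)
  case less
  show ?case
  proof (cases "W \<subseteq> range Inl \<or> W \<subseteq> range Inr")
    case True
    thus ?thesis using assms less.prems by blast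
  next
    case False
    obtain j where j: "j \<in> W" "j \<noteq> i"
    proof -
      obtain p q where "p \<in> W" "p \<notin> range Inl" "q \<in> W" "q \<notin> range Inr" using False by blast
      hence "p \<noteq> q" by (cases p) auto
      thus ?thesis using that \<open>p \<in> W\<close> \<open>q \<in> W\<close> by blast
    qed
    have "card (W - {k}) < card W" if "k \<in> W" for k
      using that by (intro psubset_card_mono) auto
    thus ?thesis using less.hyps less.prems j by (intro poly_mass_step[OF j(2) j(1)]) auto
  qed
qed

end

subsection \<open>Orders of growth\<close>

lemma growth_order_finiteD:
  assumes "growth_order F < \<infinity>"
  shows "\<exists>n r\<^sub>0. \<forall>r\<ge>r\<^sub>0. F r \<le> r ^ n"
proof -
  obtain n :: nat where "growth_order F < ereal (real n)"
    using assms less_PInf_Ex_of_nat[of "growth_order F"] by auto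
  hence "eventually (\<lambda>r. ln_ext (F r) / ereal (ln r) < ereal (real n)) at_top"
    unfolding growth_order_def by (rule Limsup_lessD)
  then obtain r0 where r0: "\<And>r. r \<ge> r0 \<Longrightarrow> ln_ext (F r) / ereal (ln r) < ereal (real n)"
    unfolding eventually_at_top_linorder by blast
  \<comment> \<open>From 2 on \<open>ln r\<close> is positive, so the quotient of logarithms can be
    cleared.\<close>
  have "F r \<le> r ^ n" if "r \<ge> max r0 2" for r
  proof (cases "F r \<le> 0")
    case True
    have "(0::real) \<le> r ^ n" using that by (intro zero_le_power) simp
    thus ?thesis using True by simp
  next
    case False
    have l: "ln r > 0" using that by simp
    have "ereal (ln (F r)) / ereal (ln r) < ereal (real n)" using r0[of r] that False by (simp add: ln_ext_def)
    hence "ln (F r) / ln r < real n" using l by simp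
    hence "ln (F r) < real n * ln r" using l by (simp add: pos_divide_less_eq)
    hence "exp (ln (F r)) < exp (real n * ln r)" by simp
    hence "F r < exp (real n * ln r)" using False by simp
    also have "\<dots> = r ^ n" using that by (simp add: exp_of_nat_mult)
    finally show ?thesis by simp
  qed
  thus ?thesis by blast
qed

lemma growth_order_finiteI:
  assumes "\<And>r. r \<ge> r\<^sub>0 \<Longrightarrow> F r \<le> C * r ^ n"
  shows "growth_order F < \<infinity>"
proof -
  \<comment> \<open>Makes \<open>ln C'\<close> nonnegative, so that it is at most
    \<open>ln C' * ln r\<close> once \<open>r \<ge> exp 1\<close>.\<close>
  define C' where "C' = max 1 C"
  have C': "C' \<ge> 1" "C \<le> C'" by (auto simp: C'_def)
  have "ln_ext (F r) / ereal (ln r) \<le> ereal (ln C' + real n)" if r: "r \<ge> max r\<^sub>0 (exp 1)" for r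
  proof -
    have rp: "r > 0" using r exp_gt_zero[of "1::real"] by linarith
    have l: "ln r \<ge> 1" using r rp by (simp add: ln_ge_iff)
    show ?thesis
    proof (cases "F r \<le> 0")
      case True
      thus ?thesis using l by (simp add: ln_ext_def)
    next
      case False
      have "F r \<le> C * r ^ n" using assms r by simp
      also have "\<dots> \<le> C' * r ^ n" using C'(2) rp by (intro mult_right_mono) auto
      finally have "F r \<le> C' * r ^ n" .
      hence "ln (F r) \<le> ln (C' * r ^ n)" using False by simp
      also have "\<dots> = ln C' + real n * ln r" using C' rp by (simp add: ln_mult ln_realpow)
      also have "\<dots> \<le> ln C' * ln r + real n * ln r"
        using C' l mult_left_mono[of 1 "ln r" "ln C'"] by simp
      finally have "ln (F r) / ln r \<le> ln C' + real n" using l by (simp add: pos_divide_le_eq distrib_right)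
      thus ?thesis using False l by (simp add: ln_ext_def)
    qed
  qed
  hence "eventually (\<lambda>r. ln_ext (F r) / ereal (ln r) \<le> ereal (ln C' + real n)) at_top"
    using eventually_ge_at_top by (rule eventually_mono[rotated])
  hence "growth_order F \<le> ereal (ln C' + real n)"
    unfolding growth_order_def by (rule Limsup_bounded)
  thus ?thesis by (rule le_less_trans) simp
qed

subsection \<open>Locally finite sums of measures\<close>

text \<open>The sum is an integral over the index against counting measure. Countable additivity is
  then an exchange of nonnegative sum and integral, and the formula extends from indicators by
  monotone convergence.\<close>

lemma sum_measure_exists:
  fixes \<nu> :: "'i \<Rightarrow> 'a::topological_space measure"
  assumes \<nu>: "\<And>\<iota>. sets (\<nu> \<iota>) = sets borel"
  shows "\<exists>\<mu>. sets \<mu> = sets borel \<and>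
    (\<forall>f\<in>borel_measurable borel. (\<integral>\<^sup>+x. f x \<partial>\<mu>) = (\<integral>\<^sup>+\<iota>. (\<integral>\<^sup>+x. f x \<partial>\<nu> \<iota>) \<partial>count_space UNIV))"
proof -
  define E where "E = (\<lambda>A. \<integral>\<^sup>+\<iota>. emeasure (\<nu> \<iota>) A \<partial>count_space UNIV)"
  define \<mu> where "\<mu> = measure_of UNIV (sets (borel :: 'a measure)) E"
  have sp: "space (borel :: 'a measure) = UNIV" by simp
  have sets: "sets \<mu> = sets borel"
    unfolding \<mu>_def using sets.sigma_sets_eq[of borel] sets.space_closed[of borel] by (simp add: sp)
  have em: "emeasure \<mu> A = E A" if A: "A \<in> sets borel" for A
  proof (rule emeasure_measure_of[OF \<mu>_def])
    show "positive (sets \<mu>) E" by (simp add: positive_def E_def)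
    show "countably_additive (sets \<mu>) E"
    proof (rule countably_additiveI)
      fix B :: "nat \<Rightarrow> 'a set" assume B: "range B \<subseteq> sets \<mu>" "disjoint_family B" "(\<Union>i. B i) \<in> sets \<mu>"
      have "(\<Sum>i. E (B i)) = (\<integral>\<^sup>+\<iota>. (\<Sum>i. emeasure (\<nu> \<iota>) (B i)) \<partial>count_space UNIV)"
        unfolding E_def by (rule nn_integral_suminf[symmetric]) simp
      also have "\<dots> = E (\<Union>i. B i)"
        unfolding E_def using B sets \<nu> by (intro nn_integral_cong suminf_emeasure) auto
      finally show "(\<Sum>i. E (B i)) = E (\<Union>i. B i)" .
    qed
  qed (use A sets in auto)
  have mb: "borel_measurable \<mu> = (borel_measurable borel :: ('a \<Rightarrow> ennreal) set)"
    "borel_measurable (\<nu> \<iota>) = (borel_measurable borel :: ('a \<Rightarrow> ennreal) set)" for \<iota>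
    by (rule measurable_cong_sets[OF sets refl], rule measurable_cong_sets[OF \<nu> refl])
  have "(\<integral>\<^sup>+x. f x \<partial>\<mu>) = (\<integral>\<^sup>+\<iota>. (\<integral>\<^sup>+x. f x \<partial>\<nu> \<iota>) \<partial>count_space UNIV)" if "f \<in> borel_measurable borel" for f
    using that
  proof (induction rule: borel_measurable_induct)
    case (cong f g)
    have "f = g" using cong by (auto simp: fun_eq_iff)
    thus ?case using cong by simp
  next
    case (set A)
    thus ?case using em[OF set] by (simp add: nn_integral_indicator sets \<nu> E_def)
  next
    case (mult u c)
    have m: "u \<in> borel_measurable \<mu>" "\<And>\<iota>. u \<in> borel_measurable (\<nu> \<iota>)"
      by (simp_all only: mb mult)
    show ?case using mult by (simp add: nn_integral_cmult m)
  next
    case (add u v)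
    have m: "u \<in> borel_measurable \<mu>" "\<And>\<iota>. u \<in> borel_measurable (\<nu> \<iota>)" "v \<in> borel_measurable \<mu>" "\<And>\<iota>. v \<in> borel_measurable (\<nu> \<iota>)"
      by (simp_all only: mb add.hyps)
    show ?case using add by (simp add: nn_integral_add m)
  next
    case (seq U)
    have m: "U i \<in> borel_measurable \<mu>" "\<And>\<iota>. U i \<in> borel_measurable (\<nu> \<iota>)" for i
      by (simp_all only: mb seq.hyps)
    have "(\<integral>\<^sup>+x. (SUP i. U i x) \<partial>\<mu>) = (SUP i. \<integral>\<^sup>+x. U i x \<partial>\<mu>)"
      by (rule nn_integral_monotone_convergence_SUP[OF seq(3) m(1)])
    also have "\<dots> = (SUP i. \<integral>\<^sup>+\<iota>. (\<integral>\<^sup>+x. U i x \<partial>\<nu> \<iota>) \<partial>count_space UNIV)"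
      by (simp add: seq)
    also have "\<dots> = (\<integral>\<^sup>+\<iota>. (SUP i. \<integral>\<^sup>+x. U i x \<partial>\<nu> \<iota>) \<partial>count_space UNIV)"
      using seq(3) by (intro nn_integral_monotone_convergence_SUP[symmetric])
        (auto simp: incseq_def le_fun_def intro!: nn_integral_mono)
    also have "\<dots> = (\<integral>\<^sup>+\<iota>. (\<integral>\<^sup>+x. (SUP i. U i x) \<partial>\<nu> \<iota>) \<partial>count_space UNIV)"
      by (intro nn_integral_cong nn_integral_monotone_convergence_SUP[symmetric] seq(3) m(2))
    finally show ?case by (simp add: image_image)
  qed
  thus ?thesis using sets by blast
qed

lemma integrable_compact_support:
  fixes f :: "'a::euclidean_space \<Rightarrow> 'b::{banach, second_countable_topology}"
  assumes "sets M = sets borel" "compact K" "emeasure M K < \<infinity>" "continuous_on UNIV f" "\<And>x. x \<notin> K \<Longrightarrow> f x = 0"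
  shows "integrable M f"
proof -
  have "compact (f ` K)" using assms by (intro compact_continuous_image continuous_on_subset[OF assms(4)]) auto
  then obtain B where B: "\<And>x. x \<in> K \<Longrightarrow> norm (f x) \<le> B"
    using compact_imp_bounded bounded_iff by (metis imageI)
  have "f \<in> borel_measurable M"
    using borel_measurable_continuous_onI[OF assms(4)] measurable_cong_sets[OF assms(1) refl] by blast
  moreover have "K \<in> sets M" using assms(1) borel_compact[OF assms(2)] by simp
  ultimately show ?thesis
    by (intro integrableI_bounded_set[where A = K and B = B]) (use assms B in auto)
qed

text \<open>Over a compact set only finitely many densities \<open>h\<close> are nonzero, so the
  mass there is finite and the integral is a finite sum. Nonnegative functions come first; complex
  ones follow through positive and negative parts of the real and imaginary part.\<close>

lemma locally_finite_sum_measure: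
  fixes m :: "'i \<Rightarrow> 'a::euclidean_space measure" and h :: "'i \<Rightarrow> 'a \<Rightarrow> real"
  assumes m: "\<And>\<iota>. sets (m \<iota>) = sets borel" "\<And>\<iota> K. compact K \<Longrightarrow> emeasure (m \<iota>) K < \<infinity>"
    and h: "\<And>\<iota>. continuous_on UNIV (h \<iota>)" "\<And>\<iota> x. h \<iota> x \<ge> 0"
    and loc: "\<And>K. compact K \<Longrightarrow> \<exists>S. finite S \<and> (\<forall>\<iota> x. \<iota> \<notin> S \<longrightarrow> x \<in> K \<longrightarrow> h \<iota> x = 0)"
  shows "\<exists>\<mu>. sets \<mu> = sets borel \<and> (\<forall>K. compact K \<longrightarrow> emeasure \<mu> K < \<infinity>) \<and>
    (\<forall>f :: 'a \<Rightarrow> complex. \<forall>K S. continuous_on UNIV f \<longrightarrow> compact K \<longrightarrow> (\<forall>x. x \<notin> K \<longrightarrow> f x = 0) \<longrightarrow> finite S \<longrightarrow>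
      (\<forall>\<iota> x. \<iota> \<notin> S \<longrightarrow> x \<in> K \<longrightarrow> h \<iota> x = 0) \<longrightarrow>
      (LINT x|\<mu>. f x) = (\<Sum>\<iota>\<in>S. LINT x|m \<iota>. of_real (h \<iota> x) * f x))"
proof -
  have hm: "h \<iota> \<in> borel_measurable borel" for \<iota> by (rule borel_measurable_continuous_onI[OF h(1)])
  have hm': "h \<iota> \<in> borel_measurable (m \<iota>)" for \<iota> using hm measurable_cong_sets[OF m(1) refl] by blast
  define \<nu> where "\<nu> \<iota> = density (m \<iota>) (\<lambda>x. ennreal (h \<iota> x))" for \<iota>
  have "sets (\<nu> \<iota>) = sets borel" for \<iota> by (simp add: \<nu>_def m)
  then obtain \<mu> where \<mu>: "sets \<mu> = sets borel"
    "\<And>f. f \<in> borel_measurable borel \<Longrightarrow> (\<integral>\<^sup>+x. f x \<partial>\<mu>) = (\<integral>\<^sup>+\<iota>. (\<integral>\<^sup>+x. f x \<partial>\<nu> \<iota>) \<partial>count_space UNIV)"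
    using sum_measure_exists by metis
  have nn: "(\<integral>\<^sup>+x. f x \<partial>\<mu>) = (\<Sum>\<iota>\<in>S. \<integral>\<^sup>+x. ennreal (h \<iota> x) * f x \<partial>m \<iota>)"
    if f: "f \<in> borel_measurable borel" "\<And>x. x \<notin> K \<Longrightarrow> f x = 0" and S: "finite S" "\<And>\<iota> x. \<iota> \<notin> S \<Longrightarrow> x \<in> K \<Longrightarrow> h \<iota> x = 0"
    for f :: "'a \<Rightarrow> ennreal" and K S
  proof -
    have fm: "f \<in> borel_measurable (m \<iota>)" for \<iota> using f(1) measurable_cong_sets[OF m(1) refl] by blast
    have eq: "(\<integral>\<^sup>+x. f x \<partial>\<nu> \<iota>) = (\<integral>\<^sup>+x. ennreal (h \<iota> x) * f x \<partial>m \<iota>)" for \<iota>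
      unfolding \<nu>_def by (rule nn_integral_density) (use hm' fm in auto)
    have z: "(\<integral>\<^sup>+x. f x \<partial>\<nu> \<iota>) = 0" if "\<iota> \<notin> S" for \<iota>
    proof -
      have "ennreal (h \<iota> x) * f x = 0" for x using S(2)[OF that, of x] f(2)[of x] by (cases "x \<in> K") auto
      thus ?thesis by (simp only: eq) simp
    qed
    have "(\<integral>\<^sup>+\<iota>. (\<integral>\<^sup>+x. f x \<partial>\<nu> \<iota>) \<partial>count_space UNIV) = (\<Sum>\<iota>\<in>S. \<integral>\<^sup>+x. f x \<partial>\<nu> \<iota>)"
      by (rule nn_integral_count_space'[OF S(1)]) (use z in auto)
    thus ?thesis unfolding \<mu>(2)[OF f(1)] by (simp add: eq)
  qed
  have fin: "emeasure \<mu> K < \<infinity>" if K: "compact K" for K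
  proof -
    obtain S where S: "finite S" "\<And>\<iota> x. \<iota> \<notin> S \<Longrightarrow> x \<in> K \<Longrightarrow> h \<iota> x = 0" using loc[OF K] by blast
    have Kb: "K \<in> sets borel" by (rule borel_compact[OF K])
    have "emeasure \<mu> K = (\<integral>\<^sup>+x. indicator K x \<partial>\<mu>)" using Kb \<mu>(1) by (simp add: nn_integral_indicator)
    also have "\<dots> = (\<Sum>\<iota>\<in>S. \<integral>\<^sup>+x. ennreal (h \<iota> x) * indicator K x \<partial>m \<iota>)"
      by (rule nn[where K = K]) (use S Kb in auto)
    also have "\<dots> < \<infinity>"
    proof -
      have "(\<integral>\<^sup>+x. ennreal (h \<iota> x) * indicator K x \<partial>m \<iota>) < \<infinity>" for \<iota>
      proof -
        have "compact (h \<iota> ` K)" by (intro compact_continuous_image continuous_on_subset[OF h(1)] K) auto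
        hence "bounded (h \<iota> ` K)" by (rule compact_imp_bounded)
        then obtain B where B: "\<forall>y\<in>h \<iota> ` K. norm y \<le> B"
          unfolding bounded_iff by blast
        have le: "ennreal (h \<iota> x) * indicator K x \<le> ennreal B * indicator K x" for x
        proof (cases "x \<in> K")
          case True
          hence "h \<iota> x \<le> B" using B by force
          thus ?thesis using True by (simp add: ennreal_leI)
        qed simp
        have "(\<integral>\<^sup>+x. ennreal (h \<iota> x) * indicator K x \<partial>m \<iota>) \<le> (\<integral>\<^sup>+x. ennreal B * indicator K x \<partial>m \<iota>)"
          by (rule nn_integral_mono) (rule le)
        also have "\<dots> = ennreal B * emeasure (m \<iota>) K" using Kb m(1) by (simp add: nn_integral_cmult_indicator)
        also have "\<dots> < \<infinity>" using m(2)[OF K] by (simp add: ennreal_mult_less_top)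
        finally show ?thesis .
      qed
      thus ?thesis using S(1) by simp
    qed
    finally show ?thesis .
  qed
  have pos: "(LINT x|\<mu>. f x) = (\<Sum>\<iota>\<in>S. LINT x|m \<iota>. h \<iota> x * f x)"
    if f: "continuous_on UNIV f" "\<And>x. f x \<ge> 0" "\<And>x. x \<notin> K \<Longrightarrow> f x = 0" and K: "compact K"
      and S: "finite S" "\<And>\<iota> x. \<iota> \<notin> S \<Longrightarrow> x \<in> K \<Longrightarrow> h \<iota> x = 0"
    for f :: "'a \<Rightarrow> real" and K S
  proof -
    have fb: "f \<in> borel_measurable borel" by (rule borel_measurable_continuous_onI[OF f(1)])
    have int\<mu>: "integrable \<mu> f" by (rule integrable_compact_support[OF \<mu>(1) K fin[OF K] f(1,3)])
    have int: "integrable (m \<iota>) (\<lambda>x. h \<iota> x * f x)" for \<iota>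
      by (rule integrable_compact_support[OF m(1) K m(2)[OF K]])
         (use f h(1) in \<open>auto intro!: continuous_intros\<close>)
    have "ennreal (LINT x|\<mu>. f x) = (\<integral>\<^sup>+x. ennreal (f x) \<partial>\<mu>)"
      using nn_integral_eq_integral[OF int\<mu>] f(2) by simp
    also have "\<dots> = (\<Sum>\<iota>\<in>S. \<integral>\<^sup>+x. ennreal (h \<iota> x) * ennreal (f x) \<partial>m \<iota>)"
      by (rule nn[where K = K]) (use fb f S in auto)
    also have "\<dots> = (\<Sum>\<iota>\<in>S. ennreal (LINT x|m \<iota>. h \<iota> x * f x))"
      using nn_integral_eq_integral[OF int] f(2) h(2) by (intro sum.cong refl) (simp add: ennreal_mult)
    also have "\<dots> = ennreal (\<Sum>\<iota>\<in>S. LINT x|m \<iota>. h \<iota> x * f x)"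
      using f(2) h(2) by (intro sum_ennreal) (auto intro!: integral_nonneg_AE)
    finally show ?thesis
      using f(2) h(2) by (subst (asm) ennreal_inj) (auto intro!: integral_nonneg_AE sum_nonneg)
  qed
  have "(LINT x|\<mu>. f x) = (\<Sum>\<iota>\<in>S. LINT x|m \<iota>. of_real (h \<iota> x) * f x)"
    if f: "continuous_on UNIV f" "\<And>x. x \<notin> K \<Longrightarrow> f x = 0" and K: "compact K"
      and S: "finite S" "\<And>\<iota> x. \<iota> \<notin> S \<Longrightarrow> x \<in> K \<Longrightarrow> h \<iota> x = 0"
    for f :: "'a \<Rightarrow> complex" and K S
  proof -
    have real: "(LINT x|\<mu>. g x) = (\<Sum>\<iota>\<in>S. LINT x|m \<iota>. h \<iota> x * g x)"
      if g: "continuous_on UNIV g" "\<And>x. x \<notin> K \<Longrightarrow> g x = 0" for g :: "'a \<Rightarrow> real"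
    proof -
      let ?p = "\<lambda>x. max 0 (g x)" and ?n = "\<lambda>x. max 0 (- g x)"
      have c: "continuous_on UNIV ?p" "continuous_on UNIV ?n" by (intro continuous_intros g(1))+
      have z: "?p x = 0" "?n x = 0" if "x \<notin> K" for x using g(2)[OF that] by auto
      have i: "integrable \<mu> ?p" "integrable \<mu> ?n"
        by (rule integrable_compact_support[OF \<mu>(1) K fin[OF K]], use c z in auto)+
      have i': "integrable (m \<iota>) (\<lambda>x. h \<iota> x * ?p x)" "integrable (m \<iota>) (\<lambda>x. h \<iota> x * ?n x)" for \<iota>
        by (rule integrable_compact_support[OF m(1) K m(2)[OF K]], use c z h(1) in \<open>auto intro!: continuous_intros\<close>)+
      have gpn: "g x = ?p x - ?n x" for x by auto
      have "(LINT x|\<mu>. g x) = (LINT x|\<mu>. ?p x) - (LINT x|\<mu>. ?n x)"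
        by (subst gpn, rule Bochner_Integration.integral_diff[OF i])
      also have "\<dots> = (\<Sum>\<iota>\<in>S. LINT x|m \<iota>. h \<iota> x * ?p x) - (\<Sum>\<iota>\<in>S. LINT x|m \<iota>. h \<iota> x * ?n x)"
        using pos[OF c(1) _ z(1) K S] pos[OF c(2) _ z(2) K S] by simp
      also have "\<dots> = (\<Sum>\<iota>\<in>S. LINT x|m \<iota>. h \<iota> x * ?p x - h \<iota> x * ?n x)"
        by (simp only: sum_subtractf[symmetric] Bochner_Integration.integral_diff[OF i'])
      also have "(\<lambda>\<iota> x. h \<iota> x * ?p x - h \<iota> x * ?n x) = (\<lambda>\<iota> x. h \<iota> x * g x)"
        by (simp only: right_diff_distrib[symmetric] gpn[symmetric])
      finally show ?thesis .
    qed
    have int: "integrable \<mu> f" by (rule integrable_compact_support[OF \<mu>(1) K fin[OF K] f])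
    have int': "integrable (m \<iota>) (\<lambda>x. of_real (h \<iota> x) * f x)" for \<iota>
      by (rule integrable_compact_support[OF m(1) K m(2)[OF K]])
         (use f h(1) in \<open>auto intro!: continuous_intros\<close>)
    have "Re (LINT x|\<mu>. f x) = Re (\<Sum>\<iota>\<in>S. LINT x|m \<iota>. of_real (h \<iota> x) * f x)"
      using real[of "\<lambda>x. Re (f x)"] f by (simp add: integral_Re[OF int, symmetric] integral_Re[OF int', symmetric] continuous_on_Re)
    moreover have "Im (LINT x|\<mu>. f x) = Im (\<Sum>\<iota>\<in>S. LINT x|m \<iota>. of_real (h \<iota> x) * f x)"
      using real[of "\<lambda>x. Im (f x)"] f by (simp add: integral_Im[OF int, symmetric] integral_Im[OF int', symmetric] continuous_on_Im)
    ultimately show ?thesis by (simp add: complex_eq_iff)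
  qed
  thus ?thesis using \<mu>(1) fin by blast
qed

subsection \<open>Representing measures\<close>

text \<open>The terms of a partition of unity: each cutoff is multiplied by what the earlier ones
  leave uncovered. As soon as one \<open>\<xi> i\<close> is 1 the product on the right vanishes and
  the sum is 1.\<close>

lemma sum_prod_complement:
  fixes \<xi> :: "nat \<Rightarrow> real"
  shows "(\<Sum>k<n. \<xi> k * (\<Prod>i<k. 1 - \<xi> i)) = 1 - (\<Prod>i<n. 1 - \<xi> i)"
  by (induction n) (simp_all add: algebra_simps)

context ph_current
begin

lemma coefficient_sum:
  assumes "finite A" "\<And>a. a \<in> A \<Longrightarrow> test_function (F a)"
  shows "test_function (\<lambda>x. \<Sum>a\<in>A. F a x) \<and> coefficient i (\<lambda>x. \<Sum>a\<in>A. F a x) = (\<Sum>a\<in>A. coefficient i (F a))"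
  using assms
proof (induction A rule: finite_induct)
  case empty
  show ?case using coefficient_scale[OF test_function_zero, of i 0] test_function_zero by simp
next
  case (insert a A)
  thus ?case by (simp add: test_function_add coefficient_add)
qed

text \<open>Positivity of \<open>T\<close> yields measures only after multiplication with compactly supported forms; the
  partition of unity \<open>\<psi>\<close> glues them.\<close>

lemma coefficient_sum_represented:
  assumes "r \<ge> 0"
  shows "\<exists>\<mu>. represents \<mu> (\<lambda>f. of_real r * (\<Sum>i\<in>I. coefficient i f))"
proof -
  define \<xi> where "\<xi> = (\<lambda>k::nat. cutoff UNIV (\<lambda>_ :: 'n + 'm. 0) (\<lambda>_. real k + 1))"
  \<comment> \<open>Twice the radii of \<open>\<xi> k\<close>, so that \<open>\<eta> k\<close> is 1
    on the support of \<open>\<psi> k\<close>.\<close>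
  define \<eta> where "\<eta> = (\<lambda>k x. complex_of_real (cutoff UNIV (\<lambda>_ :: 'n + 'm. 0) (\<lambda>_. 2 * (real k + 1)) x))"
  define \<psi> where "\<psi> = (\<lambda>k x. \<xi> k x * (\<Prod>i<k. 1 - \<xi> i x))"
  let ?c = "CARD('n) + CARD('m) - 1"
  \<comment> \<open>Indexed by the piece \<open>k\<close> and the coordinate \<open>i\<close>
    together, so that the sum over \<open>I\<close> is formed by the same gluing.\<close>
  define m where "m = (\<lambda>(k, i). SOME \<mu>. represents \<mu> (\<lambda>f. coefficient i (\<lambda>x. f x * (\<eta> k x * cnj (\<eta> k x)) ^ ?c)))"
  define h where "h = (\<lambda>(k, i) x. if i \<in> I then r * \<psi> k x else 0)"
  have test_\<eta>: "test_function (\<eta> k)" for k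
    unfolding \<eta>_def by (rule test_function_cutoff) simp
  have m: "represents (m (k, i)) (\<lambda>f. coefficient i (\<lambda>x. f x * (\<eta> k x * cnj (\<eta> k x)) ^ ?c))" for k i
    unfolding m_def prod.case by (rule someI_ex) (rule coefficient_represented[OF positive test_\<eta>])
  have \<xi>01: "0 \<le> \<xi> k x" "\<xi> k x \<le> 1" for k x unfolding \<xi>_def by (rule cutoff_nonneg cutoff_le_1)+
  have s\<psi>: "smooth_real (\<psi> k)" for k
  proof -
    have "smooth_real (\<lambda>x. 1 - \<xi> i x)" for i
      unfolding \<xi>_def by (intro smooth_real_diff smooth_real_const smooth_real_cutoff)
    hence "smooth_real (\<lambda>x. \<Prod>i<k. 1 - \<xi> i x)"
      using smooth_prod[of "{..<k}" "\<lambda>i x. complex_of_real (1 - \<xi> i x)"] by simp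
    thus ?thesis unfolding \<psi>_def \<xi>_def by (intro smooth_real_mult smooth_real_cutoff)
  qed
  have \<psi>0: "\<psi> k x \<ge> 0" for k x
    unfolding \<psi>_def using \<xi>01 by (intro mult_nonneg_nonneg prod_nonneg) auto
  have \<eta>1: "\<eta> k x = 1" if "\<psi> k x \<noteq> 0" for k x
  proof -
    have "cutoff UNIV (\<lambda>_ :: 'n + 'm. 0) (\<lambda>_. real k + 1) x \<noteq> 0" using that by (auto simp: \<psi>_def \<xi>_def)
    hence "cmod (coord i x - 0) \<le> 2 * (real k + 1)" for i
      using cutoff_neq_0D[of UNIV "\<lambda>_. 0" "\<lambda>_. real k + 1" x i] by simp
    thus ?thesis unfolding \<eta>_def by (subst cutoff_eq_1) auto
  qed
  have sm_h: "smooth_real (h \<iota>)" for \<iota>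
    using smooth_real_mult[OF smooth_real_const s\<psi>, of r "fst \<iota>"] smooth_real_const[of 0]
    unfolding h_def by (cases \<iota>; cases "snd \<iota> \<in> I") auto
  have bounded_index: "\<exists>n. \<forall>x\<in>K. \<xi> n x = 1" if K: "compact K" for K
  proof -
    obtain B where B: "\<And>x. x \<in> K \<Longrightarrow> norm x \<le> B"
      using compact_imp_bounded[OF K] unfolding bounded_iff by blast
    obtain n :: nat where n: "B \<le> real n" using real_arch_simple by blast
    have "\<xi> n x = 1" if "x \<in> K" for x
      unfolding \<xi>_def
    proof (rule cutoff_eq_1)
      fix k :: "'n + 'm"
      show "cmod (coord k x - 0) \<le> real n + 1" using norm_coord_le[of k x] B[OF that] n by simp
    qed
    thus ?thesis by blast
  qed
  have \<psi>_vanish: "\<psi> k x = 0" if "\<xi> n x = 1" "\<not> k < Suc n" for k n x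
    unfolding \<psi>_def using that by (auto intro!: prod_zero)
  have loc: "\<exists>S. finite S \<and> (\<forall>\<iota> x. \<iota> \<notin> S \<longrightarrow> x \<in> K \<longrightarrow> h \<iota> x = 0)" if K: "compact K" for K
  proof -
    obtain n where n: "\<forall>x\<in>K. \<xi> n x = 1" using bounded_index[OF K] by blast
    have "\<forall>\<iota> x. \<iota> \<notin> {..<Suc n} \<times> (UNIV :: ('n + 'm) set) \<longrightarrow> x \<in> K \<longrightarrow> h \<iota> x = 0"
      using n \<psi>_vanish by (auto simp: h_def)
    thus ?thesis by (intro exI[of _ "{..<Suc n} \<times> UNIV"]) simp
  qed
  have sets_m: "sets (m \<iota>) = sets borel" for \<iota>
    using m[of "fst \<iota>" "snd \<iota>"] by (simp add: represents_def)
  have fin_m: "emeasure (m \<iota>) K < \<infinity>" if "compact K" for \<iota> K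
    using m[of "fst \<iota>" "snd \<iota>"] that by (simp add: represents_def)
  have h_nonneg: "h \<iota> x \<ge> 0" for \<iota> x
    using assms \<psi>0 by (cases \<iota>) (auto simp: h_def)
  obtain \<mu> where \<mu>: "sets \<mu> = sets borel" "\<forall>K. compact K \<longrightarrow> emeasure \<mu> K < \<infinity>"
    "\<forall>f :: ('n, 'm) cspace \<Rightarrow> complex. \<forall>K S. continuous_on UNIV f \<longrightarrow> compact K \<longrightarrow> (\<forall>x. x \<notin> K \<longrightarrow> f x = 0) \<longrightarrow> finite S \<longrightarrow>
      (\<forall>\<iota> x. \<iota> \<notin> S \<longrightarrow> x \<in> K \<longrightarrow> h \<iota> x = 0) \<longrightarrow>
      (LINT x|\<mu>. f x) = (\<Sum>\<iota>\<in>S. LINT x|m \<iota>. of_real (h \<iota> x) * f x)"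
    by (rule exE[OF locally_finite_sum_measure[of m h, OF sets_m fin_m smooth_real_continuous[OF sm_h] h_nonneg loc]],
        assumption, assumption, elim conjE, rule that)
  have "of_real r * (\<Sum>i\<in>I. coefficient i f) = (LINT x|\<mu>. f x)" if f: "test_function f" for f
  proof -
    obtain K where K: "compact K" "\<forall>x. x \<notin> K \<longrightarrow> f x = 0" using f unfolding test_function_def by blast
    obtain n where n: "\<forall>x\<in>K. \<xi> n x = 1" using bounded_index[OF K(1)] by blast
    have tf: "test_function (\<lambda>x. of_real (\<psi> k x) * f x)" for k
      by (rule test_function_mult(2)[OF f s\<psi>])
    have summand: "(LINT x|m (k, i). complex_of_real (h (k, i) x) * f x) =
        (if i \<in> I then of_real r * coefficient i (\<lambda>x. of_real (\<psi> k x) * f x) else 0)" for k i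
    proof (cases "i \<in> I")
      case True
      have t: "test_function (\<lambda>x. of_real r * (of_real (\<psi> k x) * f x))"
        by (rule test_function_mult(2)[OF tf smooth_const])
      have "(LINT x|m (k, i). complex_of_real (h (k, i) x) * f x) = (LINT x|m (k, i). of_real r * (of_real (\<psi> k x) * f x))"
        using True by (simp add: h_def mult.assoc)
      also have "\<dots> = coefficient i (\<lambda>x. of_real r * (of_real (\<psi> k x) * f x) * (\<eta> k x * cnj (\<eta> k x)) ^ ?c)"
        by (rule m[of k i, unfolded represents_def, THEN conjunct2, THEN conjunct2, THEN spec, THEN mp, OF t, symmetric])
      also have "(\<lambda>x. of_real r * (of_real (\<psi> k x) * f x) * (\<eta> k x * cnj (\<eta> k x)) ^ ?c) = (\<lambda>x. of_real r * (of_real (\<psi> k x) * f x))"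
      proof
        fix x
        show "of_real r * (of_real (\<psi> k x) * f x) * (\<eta> k x * cnj (\<eta> k x)) ^ ?c = of_real r * (of_real (\<psi> k x) * f x)"
          using \<eta>1[of k x] by (cases "\<psi> k x = 0") simp_all
      qed
      also have "coefficient i \<dots> = of_real r * coefficient i (\<lambda>x. of_real (\<psi> k x) * f x)"
        by (rule coefficient_scale[OF tf])
      finally show ?thesis using True by simp
    qed (simp add: h_def)
    have vanish: "\<forall>\<iota> x. \<iota> \<notin> {..<Suc n} \<times> (UNIV :: ('n + 'm) set) \<longrightarrow> x \<in> K \<longrightarrow> h \<iota> x = 0"
      using n \<psi>_vanish by (auto simp: h_def)
    have fin: "finite ({..<Suc n} \<times> (UNIV :: ('n + 'm) set))" by simp
    have whole: "(\<Sum>k<Suc n. coefficient i (\<lambda>x. of_real (\<psi> k x) * f x)) = coefficient i f" for i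
    proof -
      have "(\<Sum>k<Suc n. of_real (\<psi> k x) * f x) = f x" for x
      proof (cases "x \<in> K")
        case True
        have "(\<Sum>k<Suc n. \<psi> k x) = 1"
          unfolding \<psi>_def sum_prod_complement using n True by simp
        hence "(\<Sum>k<Suc n. complex_of_real (\<psi> k x)) = 1" by (simp only: of_real_sum[symmetric] of_real_1)
        thus ?thesis by (simp only: sum_distrib_right[symmetric] mult_1)
      next
        case False
        hence "f x = 0" using K(2) by blast
        thus ?thesis by simp
      qed
      thus ?thesis
        using coefficient_sum[of "{..<Suc n}" "\<lambda>k x. of_real (\<psi> k x) * f x" i] tf by simp
    qed
    have "(LINT x|\<mu>. f x) = (\<Sum>\<iota>\<in>{..<Suc n} \<times> UNIV. LINT x|m \<iota>. complex_of_real (h \<iota> x) * f x)"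
      by (rule \<mu>(3)[THEN spec, THEN spec, THEN spec, THEN mp, OF smooth_continuous[OF test_function_smooth[OF f]],
          THEN mp, OF K(1), THEN mp, OF K(2), THEN mp, OF fin, THEN mp, OF vanish])
    also have "\<dots> = (\<Sum>k<Suc n. \<Sum>i\<in>UNIV. if i \<in> I then of_real r * coefficient i (\<lambda>x. of_real (\<psi> k x) * f x) else 0)"
      unfolding sum.cartesian_product by (intro sum.cong refl) (auto simp: summand)
    also have "\<dots> = (\<Sum>k<Suc n. \<Sum>i\<in>I. of_real r * coefficient i (\<lambda>x. of_real (\<psi> k x) * f x))"
      by (intro sum.cong refl sum.mono_neutral_cong_right) auto
    also have "\<dots> = of_real r * (\<Sum>i\<in>I. \<Sum>k<Suc n. coefficient i (\<lambda>x. of_real (\<psi> k x) * f x))"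
      by (subst sum.swap) (simp add: sum_distrib_left del: sum.lessThan_Suc)
    also have "\<dots> = of_real r * (\<Sum>i\<in>I. coefficient i f)" by (simp only: whole)
    finally show ?thesis by (rule sym)
  qed
  thus ?thesis using \<mu>(1,2) unfolding represents_def by blast
qed

lemma current_wedge_Pi_sum:
  assumes "test_function f"
  shows "current_wedge T (\<lambda>x vs. of_real r * (\<Sum>i\<in>I. Pi_form (- {i}) vs)) f = of_real r * (\<Sum>i\<in>I. coefficient i f)"
proof -
  have t: "test_function (\<lambda>x. of_real r * f x)" by (rule test_function_mult(2)[OF assms smooth_const])
  have "current_wedge T (\<lambda>x vs. of_real r * (\<Sum>i\<in>I. Pi_form (- {i}) vs)) f
    = T (\<lambda>x vs. \<Sum>i\<in>I. (of_real r * f x) * Pi_form (- {i}) vs)"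
    unfolding current_wedge_def form0_wedge by (simp add: sum_distrib_left mult_ac)
  also have "\<dots> = (\<Sum>i\<in>I. T (fform (\<lambda>x. of_real r * f x) (Pi_form (- {i}))))"
    by (rule T_lincomb[OF t bidegree_Pi_form_compl]) simp
  also have "\<dots> = (\<Sum>i\<in>I. of_real r * coefficient i f)"
    using coefficient_scale[OF assms, of _ "of_real r"] by (simp add: coefficient_def)
  finally show ?thesis by (simp add: sum_distrib_left)
qed

text \<open>\<open>current_integral\<close> selects a measure by \<open>SOME\<close>, which says
  something only once a representing measure is known to exist. Afterwards its values on test
  functions carry all estimates.\<close>

lemma current_integral_measure:
  assumes \<omega>: "\<omega> = (\<lambda>x vs. of_real r * (\<Sum>i\<in>I. Pi_form (- {i}) vs))" and r: "r \<ge> 0"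
  shows "\<exists>\<mu>. sets \<mu> = sets borel \<and> (\<forall>K. compact K \<longrightarrow> emeasure \<mu> K < \<infinity>) \<and>
    (\<forall>A. current_integral T \<omega> A = measure \<mu> A) \<and>
    (\<forall>f. test_real f \<longrightarrow> (LINT x|\<mu>. f x) = r * (\<Sum>i\<in>I. mass i f))"
proof -
  define \<mu> where "\<mu> = (SOME \<mu>. represents \<mu> (current_wedge T \<omega>))"
  obtain \<mu>' where "represents \<mu>' (\<lambda>f. of_real r * (\<Sum>i\<in>I. coefficient i f))"
    using coefficient_sum_represented[OF r] by blast
  hence "represents \<mu>' (current_wedge T \<omega>)"
    unfolding represents_def \<omega> using current_wedge_Pi_sum by simp
  hence rep: "represents \<mu> (current_wedge T \<omega>)" unfolding \<mu>_def by (rule someI)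
  have "(LINT x|\<mu>. f x) = r * (\<Sum>i\<in>I. mass i f)" if f: "test_real f" for f
  proof -
    have "complex_of_real (LINT x|\<mu>. f x) = (LINT x|\<mu>. complex_of_real (f x))" by simp
    also have "\<dots> = of_real r * (\<Sum>i\<in>I. coefficient i (\<lambda>x. of_real (f x)))"
      using rep f current_wedge_Pi_sum[OF f, of r I] unfolding represents_def \<omega> by simp
    finally have "Re (complex_of_real (LINT x|\<mu>. f x)) = Re (of_real r * (\<Sum>i\<in>I. coefficient i (\<lambda>x. of_real (f x))))"
      by (rule arg_cong)
    thus ?thesis by (simp add: mass_def)
  qed
  moreover have "current_integral T \<omega> A = measure \<mu> A" for A
    by (simp add: current_integral_def \<mu>_def)
  ultimately show ?thesis using rep unfolding represents_def by blast
qed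

lemma current_integral_lower:
  assumes \<omega>: "\<omega> = (\<lambda>x vs. of_real r * (\<Sum>i\<in>I. Pi_form (- {i}) vs))" and r: "r \<ge> 0"
    and f: "test_real f" "\<And>x. 0 \<le> f x" "\<And>x. f x \<le> indicator A x"
    and A: "A \<in> sets borel" "bounded A" and i: "i \<in> I"
  shows "r * mass i f \<le> current_integral T \<omega> A"
proof -
  obtain \<mu> where \<mu>: "sets \<mu> = sets borel" "\<And>K. compact K \<Longrightarrow> emeasure \<mu> K < \<infinity>"
    "\<And>A. current_integral T \<omega> A = measure \<mu> A" "\<And>f. test_real f \<Longrightarrow> (LINT x|\<mu>. f x) = r * (\<Sum>i\<in>I. mass i f)"
    using current_integral_measure[OF \<omega> r] by blast
  \<comment> \<open>Finiteness is essential for a lower bound, because \<open>measure\<close>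
    returns 0 on sets of infinite mass.\<close>
  have "emeasure \<mu> A \<le> emeasure \<mu> (closure A)"
    using \<mu>(1) closure_subset by (intro emeasure_mono) auto
  also have "\<dots> < \<infinity>" using A(2) by (intro \<mu>(2)) (simp add: compact_closure)
  finally have int: "integrable \<mu> (indicator A :: _ \<Rightarrow> real)"
    using A(1) \<mu>(1) by (simp add: integrable_indicator_iff)
  have "mass i f \<le> (\<Sum>i\<in>I. mass i f)"
    using i mass_nonneg[OF f(1,2)] by (intro member_le_sum) auto
  hence "r * mass i f \<le> (LINT x|\<mu>. f x)" unfolding \<mu>(4)[OF f(1)] using r by (rule mult_left_mono)
  also have "\<dots> \<le> (LINT x|\<mu>. indicator A x)"
    by (rule integral_mono'[OF int f(3)]) simp
  also have "\<dots> = measure \<mu> A" using A(1) \<mu>(1) sets_eq_imp_space_eq[OF \<mu>(1)] by simp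
  finally show ?thesis by (simp add: \<mu>(3))
qed

lemma current_integral_upper:
  assumes \<omega>: "\<omega> = (\<lambda>x vs. of_real r * (\<Sum>i\<in>I. Pi_form (- {i}) vs))" and r: "r \<ge> 0"
    and f: "test_real f" "\<And>x. indicator A x \<le> f x" and A: "A \<in> sets borel"
  shows "current_integral T \<omega> A \<le> r * (\<Sum>i\<in>I. mass i f)"
proof -
  obtain \<mu> where \<mu>: "sets \<mu> = sets borel" "\<And>K. compact K \<Longrightarrow> emeasure \<mu> K < \<infinity>"
    "\<And>A. current_integral T \<omega> A = measure \<mu> A" "\<And>f. test_real f \<Longrightarrow> (LINT x|\<mu>. f x) = r * (\<Sum>i\<in>I. mass i f)"
    using current_integral_measure[OF \<omega> r] by blast
  obtain K where K: "compact K" "\<And>x. x \<notin> K \<Longrightarrow> f x = 0"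
    using f(1) unfolding test_function_def by auto
  have int: "integrable \<mu> f"
    by (rule integrable_compact_support[OF \<mu>(1) K(1) \<mu>(2)[OF K(1)] smooth_real_continuous[OF test_function_smooth[OF f(1)]] K(2)])
  have "measure \<mu> A = (LINT x|\<mu>. indicator A x)"
    using A(1) \<mu>(1) sets_eq_imp_space_eq[OF \<mu>(1)] by simp
  also have "\<dots> \<le> (LINT x|\<mu>. f x)"
    by (rule integral_mono'[OF int f(2)]) (rule order_trans[OF indicator_pos_le f(2)])
  finally show ?thesis by (simp add: \<mu>(3) \<mu>(4)[OF f(1)])
qed

end

subsection \<open>Powers of the Kaehler forms\<close>

lemma ddc_norm_square:
  fixes S :: "('n::finite + 'm::finite) set"
  shows "ext_d (ext_dc (form0 (\<lambda>x. \<Sum>k\<in>S. coord k x * cnj (coord k x)))) x =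
    (\<lambda>vs. 1 / (2 * of_real pi) * (\<Sum>k\<in>S. wedge11 (coord k) (coord k) unit_covector vs))"
proof -
  let ?\<phi> = "\<lambda>x. \<Sum>k\<in>S. coord k x * cnj (coord k x)"
  have sm: "smooth (\<lambda>x. coord k x * cnj (coord k x))" for k :: "'n + 'm"
    by (intro smooth_mult smooth_cnj smooth_coord)
  have f0: "form0 ?\<phi> = fform ?\<phi> unit_covector" by (simp add: fun_eq_iff form0_def fform_def)
  have "wirt 1 k (\<lambda>x. coord i x * cnj (coord i x)) = (\<lambda>x. if i = k then coord i x else 0)" for i k :: "'n + 'm"
    unfolding wirt_mult[OF smooth_coord smooth_cnj[OF smooth_coord]] wirt_cnj[OF smooth_coord] wirt_coord
    by auto
  hence w1: "wirt 1 k ?\<phi> = (\<lambda>x. if k \<in> S then coord k x else 0)" for k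
    by (simp add: wirt_sum[OF sm])
  have w2: "wirt (-1) l (wirt 1 k ?\<phi>) x = (if l = k then if k \<in> S then 1 else 0 else 0)" for l k x
    unfolding w1 by (cases "k \<in> S") (simp_all add: wirt_coord wirt_const)
  have "(\<Sum>l\<in>UNIV. \<Sum>k\<in>UNIV. wirt (-1) l (wirt 1 k ?\<phi>) x * wedge11 (coord l) (coord k) unit_covector vs)
    = (\<Sum>k\<in>S. wedge11 (coord k) (coord k) unit_covector vs)" for vs
  proof -
    have "(\<Sum>k\<in>UNIV. wirt (-1) l (wirt 1 k ?\<phi>) x * wedge11 (coord l) (coord k) unit_covector vs)
      = (if l \<in> S then wedge11 (coord l) (coord l) unit_covector vs else 0)" for l
    proof -
      have "(\<Sum>k\<in>UNIV. wirt (-1) l (wirt 1 k ?\<phi>) x * wedge11 (coord l) (coord k) unit_covector vs)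
        = (\<Sum>k\<in>UNIV. if l = k then (if k \<in> S then 1 else 0) * wedge11 (coord l) (coord k) unit_covector vs else 0)"
        unfolding w2 by (intro sum.cong refl) simp
      thus ?thesis by simp
    qed
    thus ?thesis by (simp add: sum.If_cases)
  qed
  thus ?thesis unfolding f0 ddc_fform[OF smooth_sum[OF sm]] by simp
qed

lemma norm_square_eq_sum: "complex_of_real ((norm v)\<^sup>2) = (\<Sum>i\<in>UNIV. v $ i * cnj (v $ i))" for v :: "complex ^ 'a::finite"
  by (simp only: norm_vec_def L2_set_def real_sqrt_pow2[OF sum_nonneg[OF zero_le_power2]] of_real_sum complex_norm_square)

lemma beta_z_eq: "beta_z x = (\<lambda>vs. 1 / (2 * of_real pi) * (\<Sum>k\<in>range Inl. wedge11 (coord k) (coord k) unit_covector vs))"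
proof -
  have "(\<lambda>x. complex_of_real ((norm (fst x))\<^sup>2)) = (\<lambda>x :: ('a, 'b) cspace. \<Sum>k\<in>range Inl. coord k x * cnj (coord k x))"
    unfolding norm_square_eq_sum by (simp add: sum.reindex coord_def)
  thus ?thesis unfolding beta_z_def by (simp only: ddc_norm_square)
qed

lemma beta_t_eq: "beta_t x = (\<lambda>vs. 1 / (2 * of_real pi) * (\<Sum>k\<in>range Inr. wedge11 (coord k) (coord k) unit_covector vs))"
proof -
  have "(\<lambda>x. complex_of_real ((norm (snd x))\<^sup>2)) = (\<lambda>x :: ('a, 'b) cspace. \<Sum>k\<in>range Inr. coord k x * cnj (coord k x))"
    unfolding norm_square_eq_sum by (simp add: sum.reindex coord_def)
  thus ?thesis unfolding beta_t_def by (simp only: ddc_norm_square)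
qed

lemma beta_sum_eq: "form_add beta_z beta_t x = (\<lambda>vs. 1 / (2 * of_real pi) * (\<Sum>k\<in>UNIV. wedge11 (coord k) (coord k) unit_covector vs))"
proof -
  have "(\<Sum>k\<in>UNIV. g k) = (\<Sum>k\<in>range Inl. g k) + (\<Sum>k\<in>range Inr. g k)" for g :: "'a + 'b \<Rightarrow> complex"
    unfolding UNIV_sum by (rule sum.union_disjoint) auto
  thus ?thesis unfolding form_add_def beta_z_eq beta_t_eq by (simp add: distrib_left fun_eq_iff)
qed

definition power_const :: "nat \<Rightarrow> real" where
  "power_const p = (1 / (2 * pi)) ^ p * fact p"

lemma power_const_pos: "power_const p > 0"
  by (simp add: power_const_def)

lemma of_real_power_const: "(1 / (2 * complex_of_real pi)) ^ p * fact p = of_real (power_const p)"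
  by (simp add: power_const_def)

lemma subsets_of_card_all: "finite I \<Longrightarrow> subsets_of_card I (card I) = {I}"
  unfolding subsets_of_card_def using card_subset_eq by blast

lemma nu_form_eq:
  "wedge_power (form_add beta_z beta_t) (CARD('n) + CARD('m) - 1) =
    (\<lambda>x vs. of_real (power_const (CARD('n) + CARD('m) - 1)) *
      (\<Sum>i\<in>UNIV. Pi_form (- {i} :: ('n::finite + 'm::finite) set) vs))"
proof
  fix x :: "('n, 'm) cspace"
  have "subsets_of_card (UNIV :: ('n + 'm) set) (CARD('n) + CARD('m) - 1) = subsets_of_card UNIV (card (UNIV :: ('n + 'm) set) - 1)"
    by (simp only: card_UNIV_plus)
  thus "wedge_power (form_add beta_z beta_t) (CARD('n) + CARD('m) - 1) x =
    (\<lambda>vs. of_real (power_const (CARD('n) + CARD('m) - 1)) * (\<Sum>i\<in>UNIV. Pi_form (- {i}) vs))"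
    unfolding wedge_power_sum[OF beta_sum_eq] of_real_power_const
    by (simp only: subsets_of_card_pred[OF finite UNIV_not_empty] Compl_eq_Diff_UNIV)
qed

text \<open>The full power of \<open>beta_t\<close> uses up all coordinates of the second factor, so
  the missing coordinate belongs to the first. The directional mass thus controls exactly the masses
  with index in \<open>range Inl\<close>, which matches the base case of the induction.\<close>

lemma N_form_eq:
  "wedge_power beta_z (CARD('n) - 1) \<and>\<^sub>F wedge_power beta_t CARD('m) =
    (\<lambda>x vs. of_real (power_const (CARD('n) - 1) * power_const CARD('m)) *
      (\<Sum>i\<in>range Inl. Pi_form (- {i} :: ('n::finite + 'm::finite) set) vs))"
proof
  fix x :: "('n, 'm) cspace"
  have cl: "card (range Inl :: ('n + 'm) set) = CARD('n)" and cr: "card (range Inr :: ('n + 'm) set) = CARD('m)"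
    by (simp_all add: card_image)
  have zs: "(\<Sum>J\<in>subsets_of_card (range Inl :: ('n + 'm) set) (CARD('n) - 1). Pi_form J vs) = (\<Sum>i\<in>range Inl. Pi_form (range Inl - {i}) vs)" for vs
    using subsets_of_card_pred[of "range Inl :: ('n + 'm) set" "\<lambda>J. Pi_form J vs"] by (simp only: cl) simp
  have ts: "(\<Sum>J\<in>subsets_of_card (range Inr :: ('n + 'm) set) CARD('m). Pi_form J vs) = Pi_form (range Inr) vs" for vs
    using subsets_of_card_all[of "range Inr :: ('n + 'm) set"] by (simp only: cr) simp
  have p: "cwedge (Pi_form (range Inl - {i})) (Pi_form (range Inr)) = Pi_form (- {i})" if "i \<in> range Inl" for i :: "'n + 'm"
  proof -
    have "range Inl - {i} \<union> range Inr = - {i}" using that UNIV_sum[where 'a='n and 'b='m] by auto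
    thus ?thesis by (subst cwedge_Pi_form) auto
  qed
  show "(wedge_power beta_z (CARD('n) - 1) \<and>\<^sub>F wedge_power beta_t CARD('m)) x =
    (\<lambda>vs. of_real (power_const (CARD('n) - 1) * power_const CARD('m)) * (\<Sum>i\<in>range Inl. Pi_form (- {i}) vs))"
    unfolding wedge_def wedge_power_sum[OF beta_z_eq] wedge_power_sum[OF beta_t_eq] of_real_power_const
      zs ts cwedge_scale_left cwedge_scale_right cwedge_sum_left
    by (simp add: p mult.assoc)
qed

lemma M_form_eq:
  "wedge_power beta_z CARD('n) \<and>\<^sub>F wedge_power beta_t (CARD('m) - 1) =
    (\<lambda>x vs. of_real (power_const CARD('n) * power_const (CARD('m) - 1)) *
      (\<Sum>i\<in>range Inr. Pi_form (- {i} :: ('n::finite + 'm::finite) set) vs))"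
proof
  fix x :: "('n, 'm) cspace"
  have cl: "card (range Inl :: ('n + 'm) set) = CARD('n)" and cr: "card (range Inr :: ('n + 'm) set) = CARD('m)"
    by (simp_all add: card_image)
  have ts: "(\<Sum>J\<in>subsets_of_card (range Inr :: ('n + 'm) set) (CARD('m) - 1). Pi_form J vs) = (\<Sum>i\<in>range Inr. Pi_form (range Inr - {i}) vs)" for vs
    using subsets_of_card_pred[of "range Inr :: ('n + 'm) set" "\<lambda>J. Pi_form J vs"] by (simp only: cr) simp
  have zs: "(\<Sum>J\<in>subsets_of_card (range Inl :: ('n + 'm) set) CARD('n). Pi_form J vs) = Pi_form (range Inl) vs" for vs
    using subsets_of_card_all[of "range Inl :: ('n + 'm) set"] by (simp only: cl) simp
  have p: "cwedge (Pi_form (range Inl)) (Pi_form (range Inr - {i})) = Pi_form (- {i})" if "i \<in> range Inr" for i :: "'n + 'm"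
  proof -
    have "range Inl \<union> (range Inr - {i}) = - {i}" using that UNIV_sum[where 'a='n and 'b='m] by auto
    thus ?thesis by (subst cwedge_Pi_form) auto
  qed
  show "(wedge_power beta_z CARD('n) \<and>\<^sub>F wedge_power beta_t (CARD('m) - 1)) x =
    (\<lambda>vs. of_real (power_const CARD('n) * power_const (CARD('m) - 1)) * (\<Sum>i\<in>range Inr. Pi_form (- {i}) vs))"
    unfolding wedge_def wedge_power_sum[OF beta_z_eq] wedge_power_sum[OF beta_t_eq] of_real_power_const
      zs ts cwedge_scale_left cwedge_scale_right cwedge_sum_right
    by (simp add: p mult.assoc)
qed

subsection \<open>Growth of the total mass\<close>

lemma norm_vec_le_of_coords:
  fixes v :: "complex ^ 'a::finite"
  assumes "\<And>i. cmod (v $ i) \<le> s"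
  shows "norm v \<le> real CARD('a) * s"
proof -
  have "norm v \<le> (\<Sum>i\<in>UNIV. cmod (v $ i))" unfolding norm_vec_def by (simp add: L2_set_le_sum)
  also have "\<dots> \<le> (\<Sum>i\<in>(UNIV :: 'a set). s)" by (intro sum_mono assms)
  finally show ?thesis by simp
qed

lemma norm_le_of_coord_diff:
  fixes v w :: "complex ^ 'a::finite"
  assumes "\<And>i. cmod (v $ i - w $ i) \<le> s"
  shows "dist v w \<le> real CARD('a) * s"
  using norm_vec_le_of_coords[of "v - w" s] assms by (simp add: dist_norm)

context ph_current
begin

text \<open>The scaling \<open>B\<close> serves two ends: the polydisc fits into
  \<open>A (B * r)\<close>, and \<open>B \<ge> r\<^sub>0\<close> brings the threshold for
  \<open>r\<close> down to 1.\<close>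

lemma poly_mass_base:
  assumes \<omega>: "\<omega> = (\<lambda>x vs. of_real a * (\<Sum>i\<in>I. Pi_form (- {i}) vs))" and a: "a > 0"
    and growth: "\<And>r. r \<ge> r\<^sub>0 \<Longrightarrow> current_integral T \<omega> (A r) \<le> r ^ p"
    and A: "\<And>r. A r \<in> sets borel" "\<And>r. bounded (A r)"
    and \<delta>: "\<delta> > 0" and B: "B \<ge> r\<^sub>0" "B \<ge> 0"
    and sub: "\<And>r. r \<ge> 1 \<Longrightarrow> polydisc c (\<lambda>k. 2 * radii W \<delta> r k) \<subseteq> A (B * r)"
    and i: "i \<in> I"
  shows "poly_mass c W i"
proof -
  have "mass i (cutoff UNIV c (radii W \<delta> r)) \<le> B ^ p / a * r ^ p" if r: "r \<ge> 1" for r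
  proof -
    have \<rho>: "radii W \<delta> r k > 0" for k using r \<delta> by (simp add: radii_def)
    have le: "cutoff UNIV c (radii W \<delta> r) x \<le> indicator (A (B * r)) x" for x
    proof (cases "cutoff UNIV c (radii W \<delta> r) x = 0")
      case False
      hence "x \<in> A (B * r)" using cutoff_neq_0_polydisc[OF False \<rho>] sub[OF r] by auto
      thus ?thesis by (simp add: cutoff_le_1)
    qed simp
    have "a * mass i (cutoff UNIV c (radii W \<delta> r)) \<le> current_integral T \<omega> (A (B * r))"
      by (rule current_integral_lower[OF \<omega> less_imp_le[OF a] test_function_cutoff[OF \<rho>] cutoff_nonneg le A i])
    also have "\<dots> \<le> (B * r) ^ p"
      using B r mult_left_mono[of 1 r B] by (intro growth) simp
    finally show ?thesis using a by (simp add: field_simps power_mult_distrib)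
  qed
  thus ?thesis unfolding poly_mass_def using \<delta> by blast
qed

text \<open>The normalising power only raises the exponent.\<close>

lemma growth_current_integral:
  assumes "growth_order (\<lambda>r. current_integral T \<omega> (A r) / r ^ q) < \<infinity>"
  shows "\<exists>p r\<^sub>0. \<forall>r\<ge>r\<^sub>0. current_integral T \<omega> (A r) \<le> r ^ p"
proof -
  obtain n r0 where n: "\<forall>r\<ge>r0. current_integral T \<omega> (A r) / r ^ q \<le> r ^ n"
    using growth_order_finiteD[OF assms] by blast
  have "current_integral T \<omega> (A r) \<le> r ^ (n + q)" if r: "r \<ge> max r0 1" for r
  proof -
    have "r ^ q > 0" using r by simp
    moreover have "current_integral T \<omega> (A r) / r ^ q \<le> r ^ n" using n r by simp
    ultimately show ?thesis by (simp add: pos_divide_le_eq power_add)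
  qed
  thus ?thesis by blast
qed

text \<open>\<open>W\<close> contains no coordinate of the second factor and \<open>c\<close> lies
  over \<open>y\<close> there, so that part of the polydisc stays inside \<open>D'\<close> while the
  other part grows linearly.\<close>

lemma poly_mass_Inl:
  assumes D': "compact D'" "ball y e \<subseteq> D'" "e > 0" and ord: "order_dir_n T D' < \<infinity>"
    and c: "\<And>k. c (Inr k) = y $ k" and W: "W \<subseteq> range Inl" "i \<in> W"
  shows "poly_mass c W i"
proof -
  define z where "z = (\<chi> k. c (Inl k))"
  obtain p r0 where p: "\<forall>r\<ge>r0. current_integral T (wedge_power beta_z (CARD('n) - 1) \<and>\<^sub>F wedge_power beta_t CARD('m)) (ball 0 r \<times> D') \<le> r ^ p"
    using growth_current_integral[of _ "\<lambda>r. ball 0 r \<times> D'"] ord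
    unfolding order_dir_n_def N_dir_def[abs_def] by blast
  \<comment> \<open>The cutoff reaches to \<open>2 * \<delta>\<close> in each coordinate, and the
    norm is bounded by the sum over the coordinates; the 4 leaves a strict inequality.\<close>
  define \<delta> where "\<delta> = e / (4 * real CARD('m))"
  have \<delta>: "\<delta> > 0" "real CARD('m) * (2 * \<delta>) < e" using D'(3) by (auto simp: \<delta>_def)
  define B where "B = 1 + norm z + real CARD('n) * (2 + 2 * \<delta>) + \<bar>r0\<bar>"
  have B0: "0 \<le> real CARD('n) * (2 + 2 * \<delta>)" using \<delta>(1) by simp
  show ?thesis
  proof (rule poly_mass_base[where A = "\<lambda>r. ball 0 r \<times> D'", OF N_form_eq _ p[rule_format]])
    show "power_const (CARD('n) - 1) * power_const CARD('m) > 0" by (simp add: power_const_pos)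
    show "(ball 0 r :: (complex ^ 'n) set) \<times> D' \<in> sets borel" for r
    proof -
      have "D' \<in> sets borel" by (rule borel_compact[OF D'(1)])
      hence "(ball 0 r :: (complex ^ 'n) set) \<times> D' \<in> sets (borel \<Otimes>\<^sub>M borel)" by (intro pair_measureI) auto
      thus ?thesis by (simp only: borel_prod)
    qed
    show "bounded ((ball 0 r :: (complex ^ 'n) set) \<times> D')" for r
      by (intro bounded_Times bounded_ball compact_imp_bounded D')
    show "\<delta> > 0" by (rule \<delta>)
    show "r0 \<le> B" "0 \<le> B" unfolding B_def using B0 abs_ge_self[of r0] abs_ge_zero[of r0] norm_ge_zero[of z] by linarith+
    show "i \<in> range Inl" using W by blast
    show "polydisc c (\<lambda>k. 2 * radii W \<delta> r k) \<subseteq> ball 0 (B * r) \<times> D'" if r: "r \<ge> 1" for r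
    proof
      fix x assume x: "x \<in> polydisc c (\<lambda>k. 2 * radii W \<delta> r k)"
      have "cmod (fst x $ k - z $ k) \<le> 2 * r + 2 * \<delta>" for k
      proof -
        have "cmod (coord (Inl k) x - c (Inl k)) \<le> 2 * radii W \<delta> r (Inl k)"
          using x by (auto simp: polydisc_def)
        also have "\<dots> \<le> 2 * r + 2 * \<delta>" using r \<delta>(1) by (simp add: radii_def)
        finally show ?thesis by (simp add: coord_def z_def)
      qed
      from norm_le_of_coord_diff[OF this]
      have "norm (fst x) \<le> norm z + real CARD('n) * (2 * r + 2 * \<delta>)"
        using norm_triangle_ineq2[of "fst x" z] by (simp add: dist_norm)
      also have "\<dots> \<le> norm z * r + real CARD('n) * ((2 + 2 * \<delta>) * r)"
        using r \<delta>(1) mult_left_mono[of 1 r "norm z"] mult_left_mono[of 1 r \<delta>]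
        by (intro add_mono mult_left_mono) (auto simp: algebra_simps)
      also have "\<dots> = (norm z + real CARD('n) * (2 + 2 * \<delta>)) * r" by (simp add: algebra_simps)
      also have "\<dots> < B * r" using r by (intro mult_strict_right_mono) (auto simp: B_def)
      finally have f: "fst x \<in> ball 0 (B * r)" by simp
      have "cmod (snd x $ k - y $ k) \<le> 2 * \<delta>" for k
      proof -
        have "cmod (coord (Inr k) x - c (Inr k)) \<le> 2 * radii W \<delta> r (Inr k)"
          using x by (auto simp: polydisc_def)
        also have "\<dots> = 2 * \<delta>" using W(1) by (auto simp: radii_def)
        finally show ?thesis by (simp add: coord_def c)
      qed
      from norm_le_of_coord_diff[OF this] \<delta>(2) have "dist (snd x) y < e" by linarith
      hence "snd x \<in> D'" using D'(2) by (auto simp: dist_commute)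
      with f show "x \<in> ball 0 (B * r) \<times> D'" by (simp add: mem_Times_iff)
    qed
  qed
qed

text \<open>The mirror image of \<open>poly_mass_Inl\<close>, with the factors exchanged.\<close>

lemma poly_mass_Inr:
  assumes D: "compact D" "ball z e \<subseteq> D" "e > 0" and ord: "order_dir_m D T < \<infinity>"
    and c: "\<And>k. c (Inl k) = z $ k" and W: "W \<subseteq> range Inr" "i \<in> W"
  shows "poly_mass c W i"
proof -
  define y where "y = (\<chi> k. c (Inr k))"
  obtain p r0 where p: "\<forall>r\<ge>r0. current_integral T (wedge_power beta_z CARD('n) \<and>\<^sub>F wedge_power beta_t (CARD('m) - 1)) (D \<times> ball 0 r) \<le> r ^ p"
    using growth_current_integral[of _ "\<lambda>r. D \<times> ball 0 r"] ord
    unfolding order_dir_m_def M_dir_def[abs_def] by blast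
  define \<delta> where "\<delta> = e / (4 * real CARD('n))"
  have \<delta>: "\<delta> > 0" "real CARD('n) * (2 * \<delta>) < e" using D(3) by (auto simp: \<delta>_def)
  define B where "B = 1 + norm y + real CARD('m) * (2 + 2 * \<delta>) + \<bar>r0\<bar>"
  have B0: "0 \<le> real CARD('m) * (2 + 2 * \<delta>)" using \<delta>(1) by simp
  show ?thesis
  proof (rule poly_mass_base[where A = "\<lambda>r. D \<times> ball 0 r", OF M_form_eq _ p[rule_format]])
    show "power_const CARD('n) * power_const (CARD('m) - 1) > 0" by (simp add: power_const_pos)
    show "D \<times> (ball 0 r :: (complex ^ 'm) set) \<in> sets borel" for r
    proof -
      have "D \<in> sets borel" by (rule borel_compact[OF D(1)])
      hence "D \<times> (ball 0 r :: (complex ^ 'm) set) \<in> sets (borel \<Otimes>\<^sub>M borel)" by (intro pair_measureI) auto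
      thus ?thesis by (simp only: borel_prod)
    qed
    show "bounded (D \<times> (ball 0 r :: (complex ^ 'm) set))" for r
      by (intro bounded_Times bounded_ball compact_imp_bounded D)
    show "\<delta> > 0" by (rule \<delta>)
    show "r0 \<le> B" "0 \<le> B" unfolding B_def using B0 abs_ge_self[of r0] abs_ge_zero[of r0] norm_ge_zero[of y] by linarith+
    show "i \<in> range Inr" using W by blast
    show "polydisc c (\<lambda>k. 2 * radii W \<delta> r k) \<subseteq> D \<times> ball 0 (B * r)" if r: "r \<ge> 1" for r
    proof
      fix x assume x: "x \<in> polydisc c (\<lambda>k. 2 * radii W \<delta> r k)"
      have "cmod (snd x $ k - y $ k) \<le> 2 * r + 2 * \<delta>" for k
      proof -
        have "cmod (coord (Inr k) x - c (Inr k)) \<le> 2 * radii W \<delta> r (Inr k)"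
          using x by (auto simp: polydisc_def)
        also have "\<dots> \<le> 2 * r + 2 * \<delta>" using r \<delta>(1) by (simp add: radii_def)
        finally show ?thesis by (simp add: coord_def y_def)
      qed
      from norm_le_of_coord_diff[OF this]
      have "norm (snd x) \<le> norm y + real CARD('m) * (2 * r + 2 * \<delta>)"
        using norm_triangle_ineq2[of "snd x" y] by (simp add: dist_norm)
      also have "\<dots> \<le> norm y * r + real CARD('m) * ((2 + 2 * \<delta>) * r)"
        using r \<delta>(1) mult_left_mono[of 1 r "norm y"] mult_left_mono[of 1 r \<delta>]
        by (intro add_mono mult_left_mono) (auto simp: algebra_simps)
      also have "\<dots> = (norm y + real CARD('m) * (2 + 2 * \<delta>)) * r" by (simp add: algebra_simps)
      also have "\<dots> < B * r" using r by (intro mult_strict_right_mono) (auto simp: B_def)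
      finally have s: "snd x \<in> ball 0 (B * r)" by simp
      have "cmod (fst x $ k - z $ k) \<le> 2 * \<delta>" for k
      proof -
        have "cmod (coord (Inl k) x - c (Inl k)) \<le> 2 * radii W \<delta> r (Inl k)"
          using x by (auto simp: polydisc_def)
        also have "\<dots> = 2 * \<delta>" using W(1) by (auto simp: radii_def)
        finally show ?thesis by (simp add: coord_def c)
      qed
      from norm_le_of_coord_diff[OF this] \<delta>(2) have "dist (fst x) z < e" by linarith
      hence "fst x \<in> D" using D(2) by (auto simp: dist_commute)
      with s show "x \<in> D \<times> ball 0 (B * r)" by (simp add: mem_Times_iff)
    qed
  qed
qed

text \<open>For \<open>W = UNIV\<close> all radii equal \<open>r\<close> and the width
  \<open>\<delta>\<close> disappears, so the masses bound the trace measure on polydiscs that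
  contain the balls.\<close>

lemma current_order_finite:
  assumes "\<And>i. poly_mass c UNIV i"
  shows "current_order T < \<infinity>"
proof -
  let ?q = "CARD('n) + CARD('m) - 1"
  have "\<forall>i. \<exists>C n. \<forall>r\<ge>1. mass i (cutoff UNIV c (\<lambda>_. r)) \<le> C * r ^ n"
    using assms unfolding poly_mass_def radii_def by simp
  then obtain C n where Cn: "\<And>i r. r \<ge> 1 \<Longrightarrow> mass i (cutoff UNIV c (\<lambda>_. r)) \<le> C i * r ^ n i"
    by metis
  \<comment> \<open>A common exponent for all coordinates; it dominates each \<open>n i\<close>
    because the base \<open>B * r\<close> is at least 1.\<close>
  define N where "N = (\<Sum>i\<in>UNIV. n i)"
  \<comment> \<open>Compensates for the centre: the polydisc of radii \<open>B * r\<close> about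
    \<open>c\<close> contains the ball of radius \<open>r\<close> about 0.\<close>
  define B where "B = 1 + (\<Sum>k\<in>UNIV. cmod (c k))"
  have Bk: "1 \<le> B" "cmod (c k) \<le> B - 1" for k
    unfolding B_def using member_le_sum[of k UNIV "\<lambda>k. cmod (c k)"] by (auto simp: sum_nonneg)
  have "nu T r \<le> (power_const ?q * (\<Sum>i\<in>UNIV. \<bar>C i\<bar>) * B ^ N) * r ^ N" if r: "r \<ge> 1" for r
  proof -
    have Br: "B * r \<ge> 1" using mult_mono[OF Bk(1) r] Bk(1) by simp
    have ind: "indicator (ball 0 r) x \<le> cutoff UNIV c (\<lambda>_. B * r) x" for x
    proof (cases "x \<in> ball 0 r")
      case True
      have "cmod (coord k x - c k) \<le> B * r" for k
      proof -
        have "cmod (coord k x - c k) \<le> norm x + cmod (c k)"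
          using norm_triangle_ineq4[of "coord k x" "c k"] norm_coord_le[of k x] by linarith
        also have "\<dots> \<le> r + (B - 1) * 1" using True Bk(2)[of k] by simp
        also have "\<dots> \<le> r + (B - 1) * r" using r Bk(1) by (intro add_left_mono mult_left_mono) auto
        finally show ?thesis by (simp add: algebra_simps)
      qed
      thus ?thesis using True by (subst cutoff_eq_1) auto
    next
      case False
      thus ?thesis by (simp add: cutoff_nonneg)
    qed
    have test: "test_real (cutoff UNIV c (\<lambda>_. B * r))" by (rule test_function_cutoff) (use Br in simp)
    have "current_integral T (wedge_power (form_add beta_z beta_t) ?q) (ball 0 r)
      \<le> power_const ?q * (\<Sum>i\<in>UNIV. mass i (cutoff UNIV c (\<lambda>_. B * r)))"
      by (rule current_integral_upper[OF nu_form_eq less_imp_le[OF power_const_pos] test ind]) simp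
    also have "\<dots> \<le> power_const ?q * (\<Sum>i\<in>UNIV. \<bar>C i\<bar> * (B * r) ^ N)"
    proof (intro mult_left_mono sum_mono less_imp_le[OF power_const_pos])
      fix i
      have "mass i (cutoff UNIV c (\<lambda>_. B * r)) \<le> C i * (B * r) ^ n i" by (rule Cn[OF Br])
      also have "\<dots> \<le> \<bar>C i\<bar> * (B * r) ^ N"
      proof (rule mult_mono)
        have "n i \<le> N" unfolding N_def by (rule member_le_sum) auto
        thus "(B * r) ^ n i \<le> (B * r) ^ N" using Br by (rule power_increasing)
      qed (use Br in auto)
      finally show "mass i (cutoff UNIV c (\<lambda>_. B * r)) \<le> \<bar>C i\<bar> * (B * r) ^ N" .
    qed
    also have "\<dots> = power_const ?q * (\<Sum>i\<in>UNIV. \<bar>C i\<bar>) * B ^ N * r ^ N"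
      by (simp add: sum_distrib_right[symmetric] power_mult_distrib)
    finally have le: "current_integral T (wedge_power (form_add beta_z beta_t) ?q) (ball 0 r)
      \<le> power_const ?q * (\<Sum>i\<in>UNIV. \<bar>C i\<bar>) * B ^ N * r ^ N" .
    have "current_integral T (wedge_power (form_add beta_z beta_t) ?q) (ball 0 r) \<ge> 0"
      by (simp add: current_integral_def)
    \<comment> \<open>Dividing by this power can only decrease the nonnegative integral, so the
      bound for the integral carries over to \<open>nu\<close>.\<close>
    moreover have "r ^ (2 * ?q) \<ge> 1" using r by (rule one_le_power)
    ultimately have "nu T r \<le> current_integral T (wedge_power (form_add beta_z beta_t) ?q) (ball 0 r)"
      unfolding nu_def using divide_left_mono[of 1 "r ^ (2 * ?q)" "current_integral T (wedge_power (form_add beta_z beta_t) ?q) (ball 0 r)"]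
      by simp
    thus ?thesis using le by linarith
  qed
  thus ?thesis unfolding current_order_def by (rule growth_order_finiteI)
qed

end

theorem mainTheorem4:
  fixes T :: "('n::finite, 'm::finite) functional"
  assumes "CARD('n) > 1" and "CARD('m) > 1"
    and "current 1 1 T" and "positive_current11 T" and "pluriharmonic11 T"
    and "\<exists>D :: (complex ^ 'n) set. compact D \<and> interior D \<noteq> {} \<and> order_dir_m D T < \<infinity>"
    and "\<exists>D' :: (complex ^ 'm) set. compact D' \<and> interior D' \<noteq> {} \<and> order_dir_n T D' < \<infinity>"
  shows "current_order T < \<infinity>"
proof -
  interpret ph_current T by unfold_locales (rule assms)+
  obtain D :: "(complex ^ 'n) set" where D: "compact D" "interior D \<noteq> {}" "order_dir_m D T < \<infinity>"
    using assms(6) by (elim exE conjE) (rule that)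
  obtain z where "z \<in> interior D" using D(2) by auto
  then obtain e where e: "e > 0" "ball z e \<subseteq> D" unfolding mem_interior by (elim exE conjE) (rule that)
  obtain D' :: "(complex ^ 'm) set" where D': "compact D'" "interior D' \<noteq> {}" "order_dir_n T D' < \<infinity>"
    using assms(7) by (elim exE conjE) (rule that)
  obtain y where "y \<in> interior D'" using D'(2) by auto
  then obtain e' where e': "e' > 0" "ball y e' \<subseteq> D'" unfolding mem_interior by (elim exE conjE) (rule that)
  \<comment> \<open>One centre lying over interior points of both \<open>D\<close> and
    \<open>D'\<close>, so that the base cases for the two factors concern the same family of
    polydiscs.\<close>
  define c where "c = case_sum (\<lambda>i. z $ i) (\<lambda>i. y $ i)"
  have "poly_mass c UNIV i" for i
  proof (rule poly_mass_all)
    show "poly_mass c W i" if "W \<subseteq> range Inl" "i \<in> W" for W i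
      by (rule poly_mass_Inl[OF D'(1) e'(2,1) D'(3) _ that]) (simp add: c_def)
    show "poly_mass c W i" if "W \<subseteq> range Inr" "i \<in> W" for W i
      by (rule poly_mass_Inr[OF D(1) e(2,1) D(3) _ that]) (simp add: c_def)
  qed simp
  thus ?thesis by (rule current_order_finite)
qed

end
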